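(* Let $\mathcal H$ be a well-structured preconditioner set, $\epsilon>0$, $\beta\in(0,1]$, $\eta>0$, $T\in\mathbb N$. Let $f:\mathbb R^d\to\mathbb R$ be twice continuously differentiable, bounded below, with $\Lambda_{\mathcal H}(f)<\infty$, and let $\Delta_0=f(x_0)-\inf_x f(x)$. Let $f_0,\dots,f_{T-1}$ be mutually independent random differentiable functions and $\Sigma\in\mathcal S_+^d$ such that for all $t$ and all $x$: $\mathbb E[\nabla f_t(x)]=\nabla f(x)$ and almost surely $-\Sigma\preceq\nabla f(x)\nabla f(x)^\top-\nabla f_t(x)\nabla f_t(x)^\top\preceq\Sigma$. Let $(x_t)$, $(V_t)$ be generated by the weighted adaptive algorithm. Then $$\mathbb E\Big[\frac1T\sum_{t=0}^{T-1}\|\nabla f(x_t)\|_{\mathcal H,*}\Big]\le\frac{\sqrt{\sum_{i=0}^{T-1}\beta^{i/2}}}{T}\,\xi+\frac{\sqrt{\operatorname{Tr}\big[P_{\mathcal H}\big((\sum_{i=0}^{T-1}\beta^i)\Sigma+\epsilon I_d\big)\big]}}{\sqrt T}\sqrt{\xi},$$ where $\xi=\frac{2\Delta_0}{\eta}+\eta\Lambda_{\mathcal H}(f)\|S_T\|_{\mathrm{op}}+\sqrt2\,d\,\|\Sigma\|_{\mathrm{op}}^{1/2}\|S_T\|_{\mathrm{op}}$ and $S_T=\mathbb E\sum_{t=0}^{T-1}V_t^{-1}(V_t^2-\beta V_{t-1}^2)V_t^{-1}$ with $V_{-1}:=\sqrt\epsilon I_d$.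
   Context: $\mathcal S^d_+$ (resp. $\mathcal S^d_{++}$) denotes the set of real symmetric positive semidefinite (resp. positive definite) $d\times d$ matrices; $\langle A,B\rangle=\operatorname{Tr}(A^\top B)$. A set $\mathcal H\subseteq\mathcal S_+^d$ is a well-structured preconditioner set if $\mathcal H=\mathcal S_+^d\cap\mathcal K$ for some set $\mathcal K$ of real $d\times d$ matrices that is closed under scalar multiplication, matrix addition and matrix multiplication and contains the identity $I_d$. For $M\in\mathcal S^d_{++}$, $P_{\mathcal H}(M):=\arg\min_{H\in\mathcal H\cap\mathcal S^d_{++}}\langle M,H^{-1}\rangle+\operatorname{Tr}(H)$ (the minimizer exists and is unique); for singular $M\in\mathcal S^d_+$, $P_{\mathcal H}(M):=\lim_{\delta\downarrow0}P_{\mathcal H}(M+\delta I_d)$. For $H\in\mathcal S_+^d$, $\|x\|_H=\sqrt{x^\top Hx}$; $\|x\|_{\mathcal H}:=\sup_{H\in\mathcal H,\operatorname{Tr}(H)\le 1}\|x\|_H$ and $\|y\|_{\mathcal H,*}:=\sup_{\|x\|_{\mathcal H}\le 1}\langle x,y\rangle$. The adaptive smoothness is $\Lambda_{\mathcal H}(f):=\inf\{\operatorname{Tr}(H): H\in\mathcal H,\ -H\preceq\nabla^2 f(x)\preceq H\ \text{for all }x\}$. Weighted adaptive algorithm: given $x_0\in\mathbb R^d$, set $M_{-1}=0$ and for $t=0,\dots,T-1$: $g_t=\nabla f_t(x_t)$, $M_t=\beta M_{t-1}+g_tg_t^\top$, $V_t=P_{\mathcal H}(M_t+\epsilon I_d)$,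 $x_{t+1}=x_t-\eta V_t^{-1}g_t$. *)

theory Defs
  imports "HOL-Analysis.Analysis" "HOL-Probability.Probability"
begin

definition sym_mat :: "real^'n^'n \<Rightarrow> bool" where
  "sym_mat A \<longleftrightarrow> transpose A = A"

definition psd :: "real^'n^'n \<Rightarrow> bool" where
  "psd A \<longleftrightarrow> sym_mat A \<and> (\<forall>x. 0 \<le> x \<bullet> (A *v x))"

definition pd :: "real^'n^'n \<Rightarrow> bool" where
  "pd A \<longleftrightarrow> sym_mat A \<and> (\<forall>x. x \<noteq> 0 \<longrightarrow> 0 < x \<bullet> (A *v x))"

definition loewner_le :: "real^'n^'n \<Rightarrow> real^'n^'n \<Rightarrow> bool" where
  "loewner_le A B \<longleftrightarrow> psd (B - A)"

definition mat_inner :: "real^'n^'n \<Rightarrow> real^'n^'n \<Rightarrow> real" where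
  "mat_inner A B = trace (transpose A ** B)"

definition outer :: "real^'n \<Rightarrow> real^'n \<Rightarrow> real^'n^'n" where
  "outer g h = (\<chi> i j. g $ i * h $ j)"

definition op_norm :: "real^'n^'n \<Rightarrow> real" where
  "op_norm A = onorm (\<lambda>x. A *v x)"

definition well_structured :: "(real^'n^'n) set \<Rightarrow> bool" where
  "well_structured Hs \<longleftrightarrow> (\<exists>K.
     (\<forall>c A. A \<in> K \<longrightarrow> c *\<^sub>R A \<in> K) \<and>
     (\<forall>A\<in>K. \<forall>B\<in>K. A + B \<in> K) \<and>
     (\<forall>A\<in>K. \<forall>B\<in>K. A ** B \<in> K) \<and>
     mat 1 \<in> K \<and>
     Hs = {A. psd A} \<inter> K)"

definition precond_pd :: "(real^'n^'n) set \<Rightarrow> real^'n^'n \<Rightarrow> real^'n^'n" where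
  "precond_pd Hs M = (THE H. H \<in> Hs \<and> pd H \<and>
      (\<forall>H'\<in>Hs. pd H' \<longrightarrow>
         mat_inner M (matrix_inv H) + trace H \<le> mat_inner M (matrix_inv H') + trace H'))"

definition precond :: "(real^'n^'n) set \<Rightarrow> real^'n^'n \<Rightarrow> real^'n^'n" where
  "precond Hs M = (if pd M then precond_pd Hs M
     else Lim (at_right 0) (\<lambda>\<delta>::real. precond_pd Hs (M + \<delta> *\<^sub>R mat 1)))"

definition H_norm :: "real^'n^'n \<Rightarrow> real^'n \<Rightarrow> real" where
  "H_norm H x = sqrt (x \<bullet> (H *v x))"

definition set_norm :: "(real^'n^'n) set \<Rightarrow> real^'n \<Rightarrow> real" where
  "set_norm Hs x = (SUP H\<in>{H\<in>Hs. trace H \<le> 1}. H_norm H x)"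

definition dual_norm :: "(real^'n^'n) set \<Rightarrow> real^'n \<Rightarrow> real" where
  "dual_norm Hs y = (SUP x\<in>{x. set_norm Hs x \<le> 1}. x \<bullet> y)"

definition grad :: "(real^'n \<Rightarrow> real) \<Rightarrow> real^'n \<Rightarrow> real^'n" where
  "grad f x = (\<chi> i. frechet_derivative f (at x) (axis i 1))"

definition hess :: "(real^'n \<Rightarrow> real) \<Rightarrow> real^'n \<Rightarrow> real^'n^'n" where
  "hess f x = matrix (frechet_derivative (grad f) (at x))"

definition adaptive_smoothness :: "(real^'n^'n) set \<Rightarrow> (real^'n \<Rightarrow> real) \<Rightarrow> real" where
  "adaptive_smoothness Hs f = Inf {trace H | H. H \<in> Hs \<and>
      (\<forall>x. loewner_le (- H) (hess f x) \<and> loewner_le (hess f x) H)}"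

text \<open>Weighted adaptive algorithm. State after t steps: (x_t, M_{t-1}), with M_{-1} = 0.
  G t is the gradient oracle at step t (here G t = \<nabla> f_t).\<close>
fun alg_state :: "(real^'n^'n) set \<Rightarrow> real \<Rightarrow> real \<Rightarrow> real \<Rightarrow> real^'n \<Rightarrow>
    (nat \<Rightarrow> real^'n \<Rightarrow> real^'n) \<Rightarrow> nat \<Rightarrow> (real^'n) \<times> (real^'n^'n)" where
  "alg_state Hs \<epsilon> \<beta> \<eta> x0 G 0 = (x0, 0)"
| "alg_state Hs \<epsilon> \<beta> \<eta> x0 G (Suc t) =
     (let (x, Mp) = alg_state Hs \<epsilon> \<beta> \<eta> x0 G t;
          g = G t x;
          M = \<beta> *\<^sub>R Mp + outer g g;
          V = precond Hs (M + \<epsilon> *\<^sub>R mat 1)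
      in (x - \<eta> *\<^sub>R (matrix_inv V *v g), M))"

definition alg_x where
  "alg_x Hs \<epsilon> \<beta> \<eta> x0 G t = fst (alg_state Hs \<epsilon> \<beta> \<eta> x0 G t)"

definition alg_M where
  "alg_M Hs \<epsilon> \<beta> \<eta> x0 G t = snd (alg_state Hs \<epsilon> \<beta> \<eta> x0 G (Suc t))"

definition alg_V where
  "alg_V Hs \<epsilon> \<beta> \<eta> x0 G t = precond Hs (alg_M Hs \<epsilon> \<beta> \<eta> x0 G t + \<epsilon> *\<^sub>R mat 1)"

definition alg_V_prev where
  "alg_V_prev Hs \<epsilon> \<beta> \<eta> x0 G t =
     (if t = 0 then sqrt \<epsilon> *\<^sub>R mat 1 else alg_V Hs \<epsilon> \<beta> \<eta> x0 G (t - 1))"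

end

theory Submission
  imports Defs
begin

text \<open>
  The symmetric members of the algebra \<open>K\<close> form a subspace \<open>L\<close> closed under \<open>A B A\<close> and inverses. With
  \<open>\<pi>\<close> the orthogonal projection onto \<open>L\<close>, completing the square gives \<open>P\<^sub>H(M) = \<pi>(M)\<^sup>1\<^sup>/\<^sup>2\<close>, so that
  \<open>V\<^sub>t\<^sup>2 - \<beta> V\<^sub>t\<^sub>-\<^sub>1\<^sup>2 = \<pi>(g\<^sub>t g\<^sub>t\<^sup>T) + (1 - \<beta>) \<epsilon> I\<close> is linear in the new gradient.

  Write \<open>a\<^sub>t\<close> for the exact gradient at \<open>x\<^sub>t\<close>. The preconditioner
  \<open>U\<^sub>t = P\<^sub>H(\<beta> M\<^sub>t\<^sub>-\<^sub>1 + a\<^sub>t a\<^sub>t\<^sup>T + \<Sigma> + \<epsilon> I)\<close> depends only on the past, and \<open>V\<^sub>t \<le> U\<^sub>t \<le> V\<^sub>t + (2 |\<Sigma>|)\<^sup>1\<^sup>/\<^sup>2 I\<close>.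
  Replacing \<open>V\<^sub>t\<close> by \<open>U\<^sub>t\<close> in the descent inequality makes the oracle unbiased, at a price controlled by
  \<open>tr S\<^sub>T\<close>; hence \<open>E = \<Sum>\<^sub>t a\<^sub>t \<bullet> U\<^sub>t\<^sup>-\<^sup>1 a\<^sub>t\<close> has expectation at most \<open>\<xi>\<close>.

  Finally let \<open>W\<^sub>t = P\<^sub>H(\<Sum>\<^sub>s \<beta>\<^sup>t\<^sup>-\<^sup>s a\<^sub>s a\<^sub>s\<^sup>T + C\<^sup>2)\<close>, where \<open>C\<close> is the preconditioner whose trace is in the bound.
  Then \<open>U\<^sub>t \<le> W\<^sub>t\<close>, the excess \<open>tr W\<^sub>t - tr C\<close> contracts by \<open>\<beta>\<^sup>1\<^sup>/\<^sup>2\<close> up to \<open>a\<^sub>t \<bullet> W\<^sub>t\<^sup>-\<^sup>1 a\<^sub>t\<close>, and the dual norm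
  of \<open>a\<^sub>t\<close> is at most \<open>(tr W\<^sub>t)\<^sup>1\<^sup>/\<^sup>2 (a\<^sub>t \<bullet> W\<^sub>t\<^sup>-\<^sup>1 a\<^sub>t)\<^sup>1\<^sup>/\<^sup>2\<close>; Cauchy-Schwarz and Jensen conclude.
\<close>


subsection \<open>Positive semidefinite matrices\<close>

text \<open>V_t contains g_t, so a_t . V_t^-1 g_t cannot be averaged directly; U_t is its
  predictable stand-in. The noise bound g_t g_t^T <= a_t a_t^T + \<Sigma> yields V_t^2 <= U_t^2, and
  its reverse limits U_t^2 - V_t^2 to 2 \<pi>(\<Sigma>), whence the 2 under the root. With p =
  U_t^-1 a_t and q = V_t^-1 g_t the replacement costs that root times |p| |q|, split by AM-GM. Here
  |q|^2 is at most the trace of the summand of S_T, whereas |p|^2 is controlled only in expectation: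
  p is the conditional mean of U_t^-1 g_t, and |U_t^-1 g_t| <= |q|. The two halves add up to tr S_T
  <= d |S_T|, which explains the last term of \<xi>.

  Integrability rests on the summands of S_T lying between 0 and I: every step has length at most
  \<eta> d^(1/2), so the iterates stay in a fixed ball. Since the noise bound and the unbiasedness
  are assumed only at fixed points x, they are carried to the random iterates by independence and
  Fubini.\<close>

lemma mat_inner_eq_inner: "mat_inner A B = A \<bullet> (B :: real^'n^'n)"
  unfolding mat_inner_def trace_def matrix_matrix_mult_def transpose_def inner_vec_def
  by (simp, rule sum.swap)

lemma trace_eq_inner: "trace A = mat 1 \<bullet> (A :: real^'n^'n)"
  by (simp add: mat_inner_eq_inner[symmetric] mat_inner_def)

lemma trace_scaleR: "trace (c *\<^sub>R (A :: real^'n^'n)) = c * trace A"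
  by (simp add: trace_eq_inner)

lemma inner_matrix_mult_left:
  fixes A B C :: "real^'n^'n"
  shows "(A ** B) \<bullet> C = B \<bullet> (transpose A ** C)"
  by (simp add: mat_inner_eq_inner[symmetric] mat_inner_def matrix_transpose_mul matrix_mul_assoc)

lemma inner_matrix_mult_right:
  fixes A B C :: "real^'n^'n"
  shows "(A ** B) \<bullet> C = A \<bullet> (C ** transpose B)"
proof -
  have "trace (transpose B ** transpose A ** C) = trace (transpose A ** C ** transpose B)"
    using trace_mul_sym[of "transpose B" "transpose A ** C"] by (simp add: matrix_mul_assoc)
  then show ?thesis
    by (simp add: mat_inner_eq_inner[symmetric] mat_inner_def matrix_transpose_mul matrix_mul_assoc)
qed

lemma trace_mult_sym_mat: "sym_mat A \<Longrightarrow> trace (A ** B) = A \<bullet> (B :: real^'n^'n)"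
  by (simp add: mat_inner_eq_inner[symmetric] mat_inner_def sym_mat_def)

lemma inner_outer: "A \<bullet> outer g h = g \<bullet> (A *v (h :: real^'n))"
  unfolding outer_def inner_vec_def matrix_vector_mult_def
  by (simp add: sum_distrib_left mult_ac)

lemma outer_mult_vec: "outer g h *v x = (h \<bullet> x) *\<^sub>R (g :: real^'n)"
  by (simp add: outer_def vec_eq_iff matrix_vector_mult_def inner_vec_def sum_distrib_left sum_distrib_right mult_ac)

lemma trace_outer: "trace (outer g h) = g \<bullet> (h :: real^'n)"
  by (simp add: trace_eq_inner inner_outer)

lemma bilinear_matrix_mult: "bilinear (\<lambda>(A :: real^'n^'n) B :: real^'n^'n. A ** B)"
  unfolding bilinear_def
  by (auto intro!: linearI simp: matrix_matrix_mult_def vec_eq_iff sum.distrib algebra_simps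
      sum_distrib_left)

lemmas matrix_mult_linear_simps =
  bilinear_ladd[OF bilinear_matrix_mult] bilinear_radd[OF bilinear_matrix_mult]
  bilinear_lsub[OF bilinear_matrix_mult] bilinear_rsub[OF bilinear_matrix_mult]
  bilinear_lmul[OF bilinear_matrix_mult] bilinear_rmul[OF bilinear_matrix_mult]
  bilinear_lzero[OF bilinear_matrix_mult] bilinear_rzero[OF bilinear_matrix_mult]

lemma bounded_bilinear_matrix_mult: "bounded_bilinear (\<lambda>(A :: real^'n^'n) B :: real^'n^'n. A ** B)"
  using bilinear_conv_bounded_bilinear bilinear_matrix_mult by blast

lemma bounded_bilinear_matrix_vector: "bounded_bilinear (\<lambda>(A :: real^'n^'n) x. A *v x)"
  unfolding bilinear_conv_bounded_bilinear[symmetric] bilinear_def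
  by (auto intro!: linearI simp: algebra_simps scaleR_matrix_vector_assoc matrix_vector_mult_scaleR)

lemma bounded_bilinear_outer: "bounded_bilinear (outer :: real^'n \<Rightarrow> real^'n \<Rightarrow> real^'n^'n)"
  unfolding bilinear_conv_bounded_bilinear[symmetric] bilinear_def
  by (auto intro!: linearI simp: outer_def vec_eq_iff algebra_simps)

lemmas continuous_on_matrix_mult [continuous_intros] =
  bounded_bilinear.continuous_on[OF bounded_bilinear_matrix_mult]
lemmas continuous_on_matrix_vector [continuous_intros] =
  bounded_bilinear.continuous_on[OF bounded_bilinear_matrix_vector]

lemma linear_transpose: "linear (transpose :: real^'n^'n \<Rightarrow> real^'n^'n)"
  by (auto intro!: linearI simp: transpose_def vec_eq_iff)

lemma sym_mat_add: "sym_mat A \<Longrightarrow> sym_mat B \<Longrightarrow> sym_mat (A + B)"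
  and sym_mat_diff: "sym_mat A \<Longrightarrow> sym_mat B \<Longrightarrow> sym_mat (A - B)"
  and sym_mat_uminus: "sym_mat A \<Longrightarrow> sym_mat (- A)"
  and sym_mat_scaleR: "sym_mat A \<Longrightarrow> sym_mat (c *\<^sub>R A)"
  and sym_mat_zero: "sym_mat 0"
  for A B :: "real^'n^'n"
  by (simp_all add: sym_mat_def linear_add[OF linear_transpose] linear_diff[OF linear_transpose]
      linear_neg[OF linear_transpose] linear_scale[OF linear_transpose] linear_0[OF linear_transpose])

lemma sym_mat_one: "sym_mat (mat 1 :: real^'n^'n)"
  by (simp add: sym_mat_def)

lemma sym_mat_outer: "sym_mat (outer g g)"
  by (simp add: sym_mat_def outer_def transpose_def vec_eq_iff mult.commute)

lemma sym_mat_congruence: "sym_mat A \<Longrightarrow> sym_mat B \<Longrightarrow> sym_mat (A ** B ** (A :: real^'n^'n))"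
  by (simp add: sym_mat_def matrix_transpose_mul matrix_mul_assoc)

lemma sym_mat_square: "sym_mat A \<Longrightarrow> sym_mat (A ** (A :: real^'n^'n))"
  by (simp add: sym_mat_def matrix_transpose_mul)

lemmas sym_mat_intros = sym_mat_add sym_mat_diff sym_mat_uminus sym_mat_scaleR sym_mat_zero
  sym_mat_one sym_mat_outer sym_mat_congruence sym_mat_square

lemma sym_mat_inner: "sym_mat A \<Longrightarrow> (A *v x) \<bullet> y = x \<bullet> (A *v (y :: real^'n))"
  by (metis dot_lmul_matrix sym_mat_def transpose_matrix_vector)

lemma psd_sym: "psd A \<Longrightarrow> sym_mat A"
  and psd_nonneg: "psd A \<Longrightarrow> 0 \<le> x \<bullet> (A *v x)"
  by (auto simp: psd_def)

lemma pd_imp_psd: "pd A \<Longrightarrow> psd A"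
  unfolding pd_def psd_def by (metis inner_zero_left less_imp_le order_refl)

lemma psd_one: "psd (mat 1 :: real^'n^'n)"
  by (simp add: psd_def sym_mat_one)

lemma psd_outer: "psd (outer g g)"
  by (simp add: psd_def sym_mat_outer outer_mult_vec inner_commute)

lemma psd_zero: "psd (0 :: real^'n^'n)"
  by (simp add: psd_def sym_mat_zero)

lemma psd_add: "psd A \<Longrightarrow> psd B \<Longrightarrow> psd (A + B)"
  by (simp add: psd_def sym_mat_add algebra_simps inner_add_right)

lemma psd_scaleR: "psd A \<Longrightarrow> 0 \<le> c \<Longrightarrow> psd (c *\<^sub>R A)"
  by (simp add: psd_def sym_mat_scaleR flip: scaleR_matrix_vector_assoc)

lemma psd_congruence: "sym_mat A \<Longrightarrow> psd B \<Longrightarrow> psd (A ** B ** A)"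
  using psd_nonneg[of B "A *v _"]
  by (auto simp: psd_def sym_mat_congruence sym_mat_inner simp flip: matrix_vector_mul_assoc)

lemma psd_square: "sym_mat A \<Longrightarrow> psd (A ** A)"
  using psd_congruence[OF _ psd_one, of A] by simp

lemma pd_add_scaleR_one: "psd A \<Longrightarrow> 0 < c \<Longrightarrow> pd (A + c *\<^sub>R mat 1)"
  unfolding pd_def psd_def
  by (auto simp: sym_mat_intros matrix_vector_mult_add_rdistrib inner_add_right
      add_nonneg_pos simp flip: scaleR_matrix_vector_assoc)

lemma pd_scaleR: "pd A \<Longrightarrow> 0 < c \<Longrightarrow> pd (c *\<^sub>R A)"
  by (simp add: pd_def sym_mat_scaleR flip: scaleR_matrix_vector_assoc)

lemma pd_add_psd: "pd A \<Longrightarrow> psd B \<Longrightarrow> pd (A + B)"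
  unfolding pd_def psd_def
  by (auto simp: sym_mat_add matrix_vector_mult_add_rdistrib inner_add_right add_pos_nonneg)

lemma loewner_leD: "loewner_le A B \<Longrightarrow> x \<bullet> (A *v x) \<le> x \<bullet> (B *v x)"
  using psd_nonneg[of "B - A" x]
  by (simp add: loewner_le_def matrix_vector_mult_diff_rdistrib inner_diff_right)

lemma loewner_leI:
  "sym_mat A \<Longrightarrow> sym_mat B \<Longrightarrow> (\<And>x. x \<bullet> (A *v x) \<le> x \<bullet> (B *v x)) \<Longrightarrow> loewner_le A B"
  by (simp add: loewner_le_def psd_def sym_mat_diff matrix_vector_mult_diff_rdistrib inner_diff_right)

lemma loewner_le_trans: "loewner_le A B \<Longrightarrow> loewner_le B C \<Longrightarrow> loewner_le A C"
  using psd_add[of "B - A" "C - B"] by (simp add: loewner_le_def)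

lemma loewner_le_add: "loewner_le A B \<Longrightarrow> loewner_le C D \<Longrightarrow> loewner_le (A + C) (B + D)"
  using psd_add[of "B - A" "D - C"] by (simp add: loewner_le_def algebra_simps)

lemma loewner_le_refl: "loewner_le A A"
  by (simp add: loewner_le_def psd_zero)

lemma loewner_le_scaleR: "loewner_le A B \<Longrightarrow> 0 \<le> c \<Longrightarrow> loewner_le (c *\<^sub>R A) (c *\<^sub>R B)"
  using psd_scaleR[of "B - A" c] by (simp add: loewner_le_def algebra_simps)

lemma pd_mono: "pd A \<Longrightarrow> loewner_le A B \<Longrightarrow> pd B"
  using pd_add_psd[of A "B - A"] by (simp add: loewner_le_def)

lemma psd_Cauchy_Schwarz:
  assumes "psd A"
  shows "(x \<bullet> (A *v y))\<^sup>2 \<le> (x \<bullet> (A *v x)) * (y \<bullet> (A *v (y :: real^'n)))"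
proof -
  define a b c where "a = x \<bullet> (A *v x)" and "b = x \<bullet> (A *v y)" and "c = y \<bullet> (A *v y)"
  have sym: "y \<bullet> (A *v x) = b"
    using sym_mat_inner[OF psd_sym[OF assms], of y x] by (simp add: b_def inner_commute)
  have q: "0 \<le> a + 2 * t * b + t\<^sup>2 * c" for t
    using psd_nonneg[OF assms, of "x + t *\<^sub>R y"] sym
    by (simp add: a_def b_def c_def matrix_vector_right_distrib matrix_vector_mult_scaleR
        inner_add_left inner_add_right algebra_simps power2_eq_square)
  have c0: "0 \<le> c" using psd_nonneg[OF assms] by (simp add: c_def)
  have "b\<^sup>2 \<le> a * c"
  proof (cases "c = 0")
    case True
    have "b = 0"
    proof (rule ccontr)
      assume "b \<noteq> 0"
      \<comment> \<open>For c = 0 the form is affine in t, and this t gives it the value -1.\<close>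
      with q[of "- (a + 1) / (2 * b)"] True show False by (simp add: field_simps)
    qed
    then show ?thesis by (simp add: True)
  next
    case False
    with c0 have "c > 0" by simp
    with q[of "- b / c"] have "0 \<le> a - b\<^sup>2 / c"
      by (simp add: power2_eq_square field_simps)
    with \<open>c > 0\<close> show ?thesis by (simp add: field_simps)
  qed
  then show ?thesis by (simp add: a_def b_def c_def)
qed

lemma psd_kernel:
  assumes "psd A" "x \<bullet> (A *v x) = 0"
  shows "A *v (x :: real^'n) = 0"
  using psd_Cauchy_Schwarz[OF assms(1), of "A *v x" x] assms(2) by simp

text \<open>Cauchy-Schwarz for the form of \<open>A\<close>, applied to Ax and x, bounds |Ax|^4 by
  c^2 |Ax|^2 |x|^2. A bound on the quadratic form thus becomes one on the norm without
  diagonalization.\<close>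

lemma psd_norm_le:
  assumes A: "psd A" and le: "\<And>x. x \<bullet> (A *v x) \<le> c * (x \<bullet> x)"
  shows "norm (A *v x) \<le> c * norm (x :: real^'n)"
proof (cases "x = 0 \<or> A *v x = 0")
  case True
  have "0 \<le> c * (x \<bullet> x)" using psd_nonneg[OF A, of x] le[of x] by linarith
  then have "0 \<le> c * norm x"
    by (cases "x = 0") (auto simp: zero_le_mult_iff dest: antisym[OF _ inner_ge_zero])
  then show ?thesis using True by auto
next
  case False
  let ?y = "A *v x"
  have "0 \<le> c * (x \<bullet> x)" using psd_nonneg[OF A, of x] le[of x] by linarith
  moreover have "0 < x \<bullet> x" using False by simp
  ultimately have c: "0 \<le> c" by (simp add: zero_le_mult_iff)
  have "(?y \<bullet> ?y)\<^sup>2 \<le> (c * (?y \<bullet> ?y)) * (c * (x \<bullet> x))"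
    using psd_Cauchy_Schwarz[OF A, of ?y x] mult_mono[OF le[of ?y] le[of x]]
      psd_nonneg[OF A] c by (meson inner_ge_zero mult_nonneg_nonneg order_trans)
  then have "(norm ?y)\<^sup>2 * (norm ?y)\<^sup>2 \<le> (norm ?y)\<^sup>2 * (c * norm x)\<^sup>2"
    by (simp add: power2_norm_eq_inner[symmetric] power2_eq_square mult_ac)
  then have "(norm ?y)\<^sup>2 \<le> (c * norm x)\<^sup>2"
    using False by (subst (asm) mult_le_cancel_left_pos) auto
  then show ?thesis using c by (simp add: power2_le_iff_abs_le)
qed

section \<open>Extremal eigenvalues and monotonicity of the square root\<close>

text \<open>A maximizer v of the form on the unit sphere makes \<mu> I - A positive semidefinite
  with vanishing form at v, and a zero of a semidefinite form lies in the kernel. This top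
  eigenvector replaces the full spectral theorem throughout.\<close>

lemma sym_mat_max_eigenvector:
  assumes A: "sym_mat (A :: real^'n^'n)"
  obtains v \<mu> where "norm v = 1" "A *v v = \<mu> *\<^sub>R v" "\<And>x. x \<bullet> (A *v x) \<le> \<mu> * (x \<bullet> x)"
proof -
  have "continuous_on (sphere 0 1) (\<lambda>x. x \<bullet> (A *v x))"
    by (intro continuous_intros)
  moreover have "sphere (0 :: real^'n) 1 \<noteq> {}" by simp
  ultimately obtain v where v: "v \<in> sphere 0 1"
    and max: "\<And>x. x \<in> sphere 0 1 \<Longrightarrow> x \<bullet> (A *v x) \<le> v \<bullet> (A *v v)"
    using continuous_attains_sup[OF compact_sphere] by blast
  define \<mu> where "\<mu> = v \<bullet> (A *v v)"
  have le: "x \<bullet> (A *v x) \<le> \<mu> * (x \<bullet> x)" for x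
  proof (cases "x = 0")
    case False
    with max[of "x /\<^sub>R norm x"] have "(x \<bullet> (A *v x)) / (norm x * norm x) \<le> \<mu>"
      by (simp add: \<mu>_def matrix_vector_mult_scaleR field_simps)
    with False show ?thesis
      by (simp add: field_simps power2_norm_eq_inner[symmetric] power2_eq_square)
  qed simp
  let ?B = "\<mu> *\<^sub>R mat 1 - A"
  have B: "psd ?B" using le
    by (simp add: psd_def sym_mat_intros A matrix_vector_mult_diff_rdistrib inner_diff_right
        flip: scaleR_matrix_vector_assoc)
  have v1: "norm v = 1" using v by simp
  have "v \<bullet> (?B *v v) = 0" using v1
    by (simp add: \<mu>_def matrix_vector_mult_diff_rdistrib inner_diff_right
        power2_norm_eq_inner[symmetric] flip: scaleR_matrix_vector_assoc)
  from psd_kernel[OF B this] have "A *v v = \<mu> *\<^sub>R v"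
    by (simp add: matrix_vector_mult_diff_rdistrib flip: scaleR_matrix_vector_assoc)
  then show ?thesis by (rule that[OF v1 _ le])
qed

lemma pd_lower_bound:
  assumes "pd (A :: real^'n^'n)"
  obtains \<kappa> where "0 < \<kappa>" "\<And>x. \<kappa> * (x \<bullet> x) \<le> x \<bullet> (A *v x)"
proof -
  from assms have "sym_mat (- A)" by (simp add: pd_def sym_mat_uminus)
  then obtain v \<mu> where v: "norm v = 1" "- A *v v = \<mu> *\<^sub>R v"
    and le: "\<And>x. x \<bullet> (- A *v x) \<le> \<mu> * (x \<bullet> x)"
    using sym_mat_max_eigenvector by blast
  have neg: "- A *v x = - (A *v x)" for x
    using matrix_vector_mult_diff_rdistrib[of 0 A x] by simp
  have "0 < v \<bullet> (A *v v)" using assms v(1) unfolding pd_def by (metis norm_zero zero_neq_one)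
  also have "\<dots> = - \<mu>" using arg_cong[OF v(2), of "inner v"] v(1)
    by (simp add: neg power2_norm_eq_inner[symmetric])
  finally have "0 < - \<mu>" .
  moreover have "- \<mu> * (x \<bullet> x) \<le> x \<bullet> (A *v x)" for x
    using le[of x] by (simp add: neg)
  ultimately show ?thesis by (rule that)
qed

text \<open>With \<open>\<mu>\<close> the largest eigenvalue of \<open>A - B\<close> and \<open>v\<close> its eigenvector,
  \<open>v \<bullet> (A\<^sup>2 - B\<^sup>2) v = \<mu> (v \<bullet> (A + B) v)\<close>.\<close>

lemma diff_le_of_square_diff_le:
  assumes A: "sym_mat (A :: real^'n^'n)" and B: "sym_mat B"
    and \<kappa>: "\<And>x. \<kappa> * (x \<bullet> x) \<le> x \<bullet> (B *v x)"
    and c: "\<And>x. x \<bullet> ((A ** A - B ** B) *v x) \<le> c * (x \<bullet> x)"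
  obtains \<mu> where "\<And>x. x \<bullet> ((A - B) *v x) \<le> \<mu> * (x \<bullet> x)" "0 < \<mu> \<longrightarrow> \<mu> * (\<mu> + 2 * \<kappa>) \<le> c"
proof -
  obtain v \<mu> where v: "norm v = 1" "(A - B) *v v = \<mu> *\<^sub>R v"
    and le: "\<And>x. x \<bullet> ((A - B) *v x) \<le> \<mu> * (x \<bullet> x)"
    using sym_mat_max_eigenvector[OF sym_mat_diff[OF A B]] by blast
  have v2: "A *v v = B *v v + \<mu> *\<^sub>R v"
    using v(2) by (simp add: matrix_vector_mult_diff_rdistrib algebra_simps)
  have vv: "v \<bullet> v = 1" using v(1) by (simp add: power2_norm_eq_inner[symmetric])
  have "v \<bullet> ((A ** A - B ** B) *v v) = (A *v v) \<bullet> (A *v v) - (B *v v) \<bullet> (B *v v)"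
    by (simp add: matrix_vector_mult_diff_rdistrib inner_diff_right sym_mat_inner[OF A]
        sym_mat_inner[OF B] flip: matrix_vector_mul_assoc)
  also have "\<dots> = \<mu> * (\<mu> + 2 * (v \<bullet> (B *v v)))"
    by (simp add: v2 inner_add_left inner_add_right vv inner_commute algebra_simps)
  finally have eq: "\<mu> * (\<mu> + 2 * (v \<bullet> (B *v v))) \<le> c" using c[of v] vv by simp
  show ?thesis
  proof (rule that[of \<mu>])
    show "0 < \<mu> \<longrightarrow> \<mu> * (\<mu> + 2 * \<kappa>) \<le> c"
    proof
      assume "0 < \<mu>"
      with \<kappa>[of v] vv have "\<mu> * (\<mu> + 2 * \<kappa>) \<le> \<mu> * (\<mu> + 2 * (v \<bullet> (B *v v)))"
        by (intro mult_left_mono) auto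
      with eq show "\<mu> * (\<mu> + 2 * \<kappa>) \<le> c" by simp
    qed
  qed (rule le)
qed

text \<open>With \<kappa> = 0 the eigenvalue estimate reads \<mu>^2 <= c, so the top eigenvalue of A
  - B is at most sqrt c. With c = 2 |\<Sigma>| this measures how far U_t can exceed V_t.\<close>

lemma sqrt_diff_le:
  assumes A: "sym_mat (A :: real^'n^'n)" and B: "psd B" and c0: "0 \<le> c"
    and c: "loewner_le (A ** A) (B ** B + c *\<^sub>R mat 1)"
  shows "loewner_le A (B + sqrt c *\<^sub>R mat 1)"
proof -
  have "x \<bullet> ((A ** A - B ** B) *v x) \<le> c * (x \<bullet> x)" for x
    using loewner_leD[OF c, of x]
    by (simp add: matrix_vector_mult_diff_rdistrib matrix_vector_mult_add_rdistrib inner_diff_right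
        inner_add_right flip: scaleR_matrix_vector_assoc)
  then obtain \<mu> where le: "\<And>x. x \<bullet> ((A - B) *v x) \<le> \<mu> * (x \<bullet> x)"
    and \<mu>: "0 < \<mu> \<longrightarrow> \<mu> * (\<mu> + 2 * 0) \<le> c"
    using diff_le_of_square_diff_le[OF A psd_sym[OF B], of 0 c] psd_nonneg[OF B]
    by (metis mult_zero_left)
  have "\<mu> \<le> sqrt c"
  proof (cases "0 < \<mu>")
    case True
    with \<mu> show ?thesis by (intro real_le_rsqrt) (simp add: power2_eq_square)
  next
    case False
    then show ?thesis using real_sqrt_ge_zero[OF c0] by linarith
  qed
  then have le': "x \<bullet> ((A - B) *v x) \<le> sqrt c * (x \<bullet> x)" for x
    by (rule order_trans[OF le mult_right_mono]) simp
  show ?thesis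
    by (intro loewner_leI sym_mat_intros A psd_sym[OF B])
      (use le' in \<open>simp add: matrix_vector_mult_diff_rdistrib matrix_vector_mult_add_rdistrib
        inner_diff_right inner_add_right algebra_simps flip: scaleR_matrix_vector_assoc\<close>)
qed

text \<open>Operator monotonicity of the square root, as the case c = 0.\<close>

lemma sqrt_mono:
  assumes "sym_mat (A :: real^'n^'n)" "psd B" "loewner_le (A ** A) (B ** B)"
  shows "loewner_le A B"
  using sqrt_diff_le[of A B 0] assms by simp

section \<open>Inverses of positive definite matrices\<close>

lemma pd_invertible:
  assumes "pd (A :: real^'n^'n)"
  shows "A ** matrix_inv A = mat 1" "matrix_inv A ** A = mat 1"
proof -
  have "\<forall>x. A *v x = 0 \<longrightarrow> x = 0"
    using assms unfolding pd_def by (metis inner_zero_right less_irrefl)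
  then have "invertible A"
    by (simp add: matrix_left_invertible_ker[symmetric] invertible_left_inverse)
  then show "A ** matrix_inv A = mat 1" "matrix_inv A ** A = mat 1"
    using someI_ex[of "\<lambda>A'. A ** A' = mat 1 \<and> A' ** A = mat 1"]
    by (auto simp: invertible_def matrix_inv_def)
qed

lemma pd_inv_mult_vec:
  assumes "pd (A :: real^'n^'n)"
  shows "A *v (matrix_inv A *v x) = x" "matrix_inv A *v (A *v x) = x"
  using pd_invertible[OF assms] by (simp_all add: matrix_vector_mul_assoc)

lemma matrix_inv_eqI:
  assumes "pd (A :: real^'n^'n)" "A ** B = mat 1"
  shows "matrix_inv A = B"
  by (metis assms matrix_mul_assoc matrix_mul_lid matrix_mul_rid pd_invertible(2))

lemma pd_inv:
  assumes A: "pd (A :: real^'n^'n)"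
  shows "pd (matrix_inv A)"
  unfolding pd_def
proof (intro conjI allI impI)
  have "transpose (matrix_inv A) ** A = mat 1"
    using pd_invertible(1)[OF A] A
    by (metis matrix_transpose_mul pd_def sym_mat_def transpose_mat)
  then show "sym_mat (matrix_inv A)"
    by (metis A matrix_mul_assoc matrix_mul_lid matrix_mul_rid pd_invertible(1) sym_mat_def)
  fix x :: "real^'n" assume "x \<noteq> 0"
  let ?y = "matrix_inv A *v x"
  have "?y \<noteq> 0" using \<open>x \<noteq> 0\<close> pd_inv_mult_vec(1)[OF A, of x] by auto
  then have "0 < ?y \<bullet> (A *v ?y)" using A by (simp add: pd_def)
  then show "0 < x \<bullet> ?y" by (simp add: pd_inv_mult_vec[OF A] inner_commute)
qed

lemma pd_inner_le:
  assumes A: "pd (A :: real^'n^'n)"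
  shows "(x \<bullet> y)\<^sup>2 \<le> (x \<bullet> (A *v x)) * (y \<bullet> (matrix_inv A *v y))"
  using psd_Cauchy_Schwarz[OF pd_imp_psd[OF A], of x "matrix_inv A *v y"]
  by (simp add: pd_inv_mult_vec[OF A] inner_commute)

text \<open>For y = B^-1 x, \<open>pd_inner_le\<close> gives (x . y)^2 <= (y . A y) (x . A^-1 x),
  and y . A y <= y . B y = x . y; one factor x . y cancels.\<close>

lemma pd_inv_antimono:
  assumes A: "pd (A :: real^'n^'n)" and le: "loewner_le A B"
  shows "loewner_le (matrix_inv B) (matrix_inv A)"
proof (rule loewner_leI)
  note B = pd_mono[OF A le]
  show "sym_mat (matrix_inv A)" "sym_mat (matrix_inv B)"
    using pd_inv[OF A] pd_inv[OF B] by (auto simp: pd_def)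
  fix x :: "real^'n"
  let ?y = "matrix_inv B *v x" and ?a = "x \<bullet> (matrix_inv A *v x)"
  have a: "0 \<le> ?a" using pd_imp_psd[OF pd_inv[OF A]] psd_nonneg by blast
  have yx: "0 \<le> x \<bullet> ?y" using pd_imp_psd[OF pd_inv[OF B]] psd_nonneg by blast
  have "(?y \<bullet> x)\<^sup>2 \<le> (?y \<bullet> (A *v ?y)) * ?a" by (rule pd_inner_le[OF A])
  also have "\<dots> \<le> (?y \<bullet> (B *v ?y)) * ?a"
    by (intro mult_right_mono loewner_leD le a)
  finally have "(x \<bullet> ?y) * (x \<bullet> ?y) \<le> (x \<bullet> ?y) * ?a"
    by (simp add: pd_inv_mult_vec[OF B] inner_commute power2_eq_square)
  then show "x \<bullet> ?y \<le> ?a" using yx a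
    by (cases "x \<bullet> ?y = 0") auto
qed

lemma pd_square: 
  assumes A: "pd (A :: real^'n^'n)"
  shows "pd (A ** A)" "matrix_inv (A ** A) = matrix_inv A ** matrix_inv A"
proof -
  have "A *v x \<noteq> 0" if "x \<noteq> 0" for x
    using that pd_inv_mult_vec(2)[OF A, of x] by auto
  moreover have "x \<bullet> ((A ** A) *v x) = (A *v x) \<bullet> (A *v x)" for x
    using A by (simp add: pd_def sym_mat_inner flip: matrix_vector_mul_assoc)
  ultimately show "pd (A ** A)"
    using A by (simp add: pd_def sym_mat_square)
  then show "matrix_inv (A ** A) = matrix_inv A ** matrix_inv A"
    using pd_invertible[OF A]
    by (intro matrix_inv_eqI) (auto simp: matrix_mul_assoc, metis matrix_mul_assoc matrix_mul_rid)
qed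

lemma psd_trace_nonneg: "psd A \<Longrightarrow> 0 \<le> trace A"
  unfolding trace_def
proof (rule sum_nonneg)
  fix i assume "psd A"
  then have "0 \<le> axis i 1 \<bullet> (A *v axis i 1)" by (rule psd_nonneg)
  then show "0 \<le> A $ i $ i"
    by (simp add: inner_axis' matrix_vector_mult_basis column_def)
qed

lemma trace_congruence_nonneg:
  assumes "sym_mat R" "\<And>x. 0 \<le> x \<bullet> (B *v (x :: real^'n))"
  shows "0 \<le> trace (R ** B ** R)"
  unfolding trace_def
proof (rule sum_nonneg)
  fix i
  have "0 \<le> (R *v axis i 1) \<bullet> (B *v (R *v axis i 1))" by (rule assms(2))
  then have "0 \<le> axis i 1 \<bullet> ((R ** B ** R) *v axis i 1)"
    by (simp add: sym_mat_inner[OF assms(1)] flip: matrix_vector_mul_assoc)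
  then show "0 \<le> (R ** B ** R) $ i $ i"
    by (simp add: inner_axis' matrix_vector_mult_basis column_def)
qed


text \<open>Polarization recovers each entry from the form at e_i + e_j and e_i - e_j, whose squared
  lengths add up to 4 even when i = j. The crude dimension factor is harmless: the estimate serves
  only boundedness and continuity.\<close>

lemma sym_mat_norm_le:
  fixes D :: "real^'n^'n"
  assumes D: "sym_mat D" and m: "\<And>x. \<bar>x \<bullet> (D *v x)\<bar> \<le> m * (x \<bullet> x)"
  shows "norm D \<le> (real CARD('n))\<^sup>2 * m"
proof -
  have comp: "\<bar>D $ i $ j\<bar> \<le> m" for i j
  proof -
    let ?p = "axis i 1 + axis j 1 :: real^'n" and ?q = "axis i 1 - axis j 1 :: real^'n"
    have Dij: "axis i 1 \<bullet> (D *v axis j 1) = D $ i $ j"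
      by (simp add: inner_axis' matrix_vector_mult_basis column_def)
    have "axis j 1 \<bullet> (D *v axis i 1) = D $ i $ j"
      using sym_mat_inner[OF D, of "axis j 1" "axis i 1"] Dij by (simp add: inner_commute)
    then have "?p \<bullet> (D *v ?p) - ?q \<bullet> (D *v ?q) = 4 * D $ i $ j"
      using Dij by (simp add: matrix_vector_right_distrib matrix_vector_mult_diff_distrib
          inner_add_left inner_add_right inner_diff_left inner_diff_right)
    moreover have "?p \<bullet> ?p + ?q \<bullet> ?q = 4"
      by (simp add: inner_add_left inner_add_right inner_diff_left inner_diff_right inner_axis_axis)
    then have "m * (?p \<bullet> ?p) + m * (?q \<bullet> ?q) = 4 * m"
      by (metis distrib_left mult.commute)
    ultimately show ?thesis using m[of ?p] m[of ?q] by linarith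
  qed
  have "norm D \<le> (\<Sum>i\<in>UNIV. norm (D $ i))"
    unfolding norm_vec_def[of D] by (rule L2_set_le_sum) simp
  also have "\<dots> \<le> (\<Sum>i\<in>UNIV. \<Sum>j\<in>UNIV. \<bar>D $ i $ j\<bar>)"
    by (intro sum_mono norm_le_l1_cart)
  also have "\<dots> \<le> (\<Sum>i\<in>(UNIV :: 'n set). \<Sum>j\<in>(UNIV :: 'n set). m)"
    by (intro sum_mono comp)
  finally show ?thesis by (simp add: power2_eq_square)
qed

subsection \<open>Jordan algebras of symmetric matrices\<close>

text \<open>Products of symmetric matrices need not be symmetric, so the symmetric part of a matrix
  algebra is in general no algebra. What survives is A B A, the structure of a Jordan
  algebra.\<close>

locale sym_algebra =
  fixes L :: "(real^'n^'n) set"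
  assumes subspace_L: "subspace L"
    and sym_L: "A \<in> L \<Longrightarrow> sym_mat A"
    and one_L: "mat 1 \<in> L"
    and congruence_L: "A \<in> L \<Longrightarrow> B \<in> L \<Longrightarrow> A ** B ** A \<in> L"
begin

lemmas L_intros = subspace_add[OF subspace_L] subspace_diff[OF subspace_L]
  subspace_scale[OF subspace_L] subspace_0[OF subspace_L] one_L congruence_L

lemma square_L: "A \<in> L \<Longrightarrow> A ** A \<in> L"
  using congruence_L[OF _ one_L, of A] by simp

text \<open>The map X |-> A X A is injective and sends \<open>L\<close> into itself, hence onto
  itself by finite dimension. A preimage X of A satisfies A X A = A, so X is the inverse.\<close>

lemma inv_L:
  assumes "A \<in> L" "pd A"
  shows "matrix_inv A \<in> L"
proof -
  define f where "f = (\<lambda>X. A ** X ** A)"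
  have lin: "linear f"
    by (auto intro!: linearI simp: f_def matrix_mult_linear_simps)
  have inv: "matrix_inv A ** f X ** matrix_inv A = X" for X
    by (simp add: f_def matrix_mul_assoc pd_invertible[OF assms(2)])
      (simp add: pd_invertible[OF assms(2)] flip: matrix_mul_assoc)
  have "inj f" by (rule injI) (metis inv)
  have sub: "f ` L \<subseteq> L" using assms(1) by (auto simp: f_def congruence_L)
  have "dim (f ` L) = dim L"
    by (rule dim_image_eq[OF lin]) (use \<open>inj f\<close> in \<open>auto intro: inj_on_subset\<close>)
  then have "f ` L = L"
    by (intro subspace_dim_equal linear_subspace_image lin subspace_L sub) simp
  then obtain X where X: "X \<in> L" "A = A ** X ** A" using assms(1) by (auto simp: f_def)
  then have "mat 1 = A ** X ** A ** matrix_inv A" using pd_invertible[OF assms(2)] by metis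
  then have "A ** X = mat 1"
    by (simp add: pd_invertible[OF assms(2)] flip: matrix_mul_assoc)
  then show ?thesis using matrix_inv_eqI[OF assms(2)] X(1) by blast
qed

text \<open>After scaling, \<open>Q = I - Z\<close> with \<open>0 \<le> Z < I\<close>, and \<open>I - Y\<close> is a square root of \<open>Q\<close> for every
  fixed point of \<open>Y \<mapsto> (Z + Y\<^sup>2) / 2\<close>; Brouwer provides one of small operator norm in \<open>L\<close>.\<close>

lemma sqrt_L:
  assumes Q: "Q \<in> L" "pd Q"
  obtains R where "R \<in> L" "pd R" "R ** R = Q"
proof -
  obtain \<kappa> where \<kappa>: "0 < \<kappa>" "\<And>x. \<kappa> * (x \<bullet> x) \<le> x \<bullet> (Q *v x)"
    using pd_lower_bound[OF Q(2)] by blast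
  obtain v c where v: "norm v = 1" "Q *v v = c *\<^sub>R v" "\<And>x. x \<bullet> (Q *v x) \<le> c * (x \<bullet> x)"
    using sym_mat_max_eigenvector[OF sym_L[OF Q(1)]] by blast
  have "\<kappa> * (v \<bullet> v) \<le> c * (v \<bullet> v)" using \<kappa>(2)[of v] v(3)[of v] by linarith
  then have "\<kappa> \<le> c" using v(1) by (simp add: power2_norm_eq_inner[symmetric])
  with \<kappa>(1) have c: "0 < c" by simp
  \<comment> \<open>The radius r = 1 - q of the Brouwer ball solves (1 - q^2) + r^2 = 2 r. As |Zx|
    <= (1 - q^2) |x|, this is exactly what makes \<open>F\<close> preserve the ball.\<close>
  define q where "q = sqrt (\<kappa> / c)"
  define r where "r = 1 - q"
  have q: "0 < q" "q \<le> 1" "q\<^sup>2 = \<kappa> / c" using \<kappa>(1) c \<open>\<kappa> \<le> c\<close> by (auto simp: q_def)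
  have r: "0 \<le> r" "r < 1" using q by (auto simp: r_def)
  define Z where "Z = mat 1 - (1 / c) *\<^sub>R Q"
  have Z_L: "Z \<in> L" by (simp add: Z_def L_intros Q(1))
  have Zq: "x \<bullet> (Z *v x) = x \<bullet> x - (x \<bullet> (Q *v x)) / c" for x
    by (simp add: Z_def matrix_vector_mult_diff_rdistrib inner_diff_right flip: scaleR_matrix_vector_assoc)
  have "psd Z"
    using sym_L[OF Z_L] v(3) c by (auto simp: psd_def Zq field_simps)
  moreover have "x \<bullet> (Z *v x) \<le> (1 - q\<^sup>2) * (x \<bullet> x)" for x
    using \<kappa>(2)[of x] c by (simp add: Zq q(3) field_simps)
  ultimately have Zn: "norm (Z *v x) \<le> (1 - q\<^sup>2) * norm x" for x
    by (rule psd_norm_le)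
  define S where "S = {Y \<in> L. \<forall>x. norm (Y *v x) \<le> r * norm x}"
  define F where "F = (\<lambda>Y. (1/2) *\<^sub>R (Z + Y ** Y))"
  have "closed S"
  proof -
    have "closed {Y :: real^'n^'n. norm (Y *v x) \<le> r * norm x}" for x
      by (intro closed_Collect_le continuous_intros)
    then have "closed (\<Inter>x. {Y :: real^'n^'n. norm (Y *v x) \<le> r * norm x})" by blast
    moreover have "S = L \<inter> (\<Inter>x. {Y. norm (Y *v x) \<le> r * norm x})" by (auto simp: S_def)
    ultimately show ?thesis using closed_subspace[OF subspace_L] by auto
  qed
  moreover have "bounded S"
  proof (rule boundedI)
    fix Y assume Y: "Y \<in> S"
    have "\<bar>x \<bullet> (Y *v x)\<bar> \<le> r * (x \<bullet> x)" for x
    proof -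
      have "\<bar>x \<bullet> (Y *v x)\<bar> \<le> norm x * norm (Y *v x)" by (rule Cauchy_Schwarz_ineq2)
      also have "\<dots> \<le> norm x * (r * norm x)" using Y by (intro mult_left_mono) (auto simp: S_def)
      finally show ?thesis by (simp add: power2_norm_eq_inner[symmetric] power2_eq_square mult_ac)
    qed
    then show "norm Y \<le> (real CARD('n))\<^sup>2 * r"
      using Y sym_L by (intro sym_mat_norm_le) (auto simp: S_def)
  qed
  ultimately have "compact S" by (simp add: compact_eq_bounded_closed)
  moreover have "convex S"
  proof (rule convexI)
    fix A B and u w :: real assume *: "A \<in> S" "B \<in> S" "0 \<le> u" "0 \<le> w" "u + w = 1"
    have "norm ((u *\<^sub>R A + w *\<^sub>R B) *v x) \<le> r * norm x" for x
    proof -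
      have "norm ((u *\<^sub>R A + w *\<^sub>R B) *v x) \<le> u * norm (A *v x) + w * norm (B *v x)"
        using norm_triangle_ineq[of "u *\<^sub>R (A *v x)" "w *\<^sub>R (B *v x)"] *
        by (simp add: matrix_vector_mult_add_rdistrib flip: scaleR_matrix_vector_assoc)
      also have "\<dots> \<le> u * (r * norm x) + w * (r * norm x)"
        using * by (intro add_mono mult_left_mono) (auto simp: S_def)
      also have "\<dots> = r * norm x" using *(5) by (simp flip: distrib_right)
      finally show ?thesis .
    qed
    then show "u *\<^sub>R A + w *\<^sub>R B \<in> S" using * by (auto simp: S_def L_intros)
  qed
  moreover have "0 \<in> S" using r by (simp add: S_def L_intros)
  moreover have "continuous_on S F" unfolding F_def by (intro continuous_intros)
  moreover have "F \<in> S \<rightarrow> S"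
  proof
    fix Y assume Y: "Y \<in> S"
    have "norm (F Y *v x) \<le> r * norm x" for x
    proof -
      have "norm (Y *v (Y *v x)) \<le> r * norm (Y *v x)" using Y by (auto simp: S_def)
      also have "\<dots> \<le> r * (r * norm x)" using Y r by (intro mult_left_mono) (auto simp: S_def)
      finally have "norm (Z *v x + Y *v (Y *v x)) \<le> (1 - q\<^sup>2) * norm x + r * (r * norm x)"
        using Zn[of x] norm_triangle_ineq[of "Z *v x" "Y *v (Y *v x)"] by linarith
      also have "\<dots> = 2 * (r * norm x)" by (simp add: r_def power2_eq_square algebra_simps)
      finally show ?thesis
        by (simp add: F_def matrix_vector_mult_add_rdistrib matrix_vector_mul_assoc[symmetric]
            flip: scaleR_matrix_vector_assoc)
    qed
    moreover have "F Y \<in> L" using Y Z_L by (auto simp: F_def S_def L_intros square_L)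
    ultimately show "F Y \<in> S" by (simp add: S_def)
  qed
  ultimately obtain Y where Y: "Y \<in> S" "F Y = Y"
    using brouwer[of S F] by blast
  then have Y_L: "Y \<in> L" and Yn: "\<And>x. norm (Y *v x) \<le> r * norm x" by (auto simp: S_def)
  have "2 *\<^sub>R Y = Z + Y ** Y" by (subst Y(2)[symmetric]) (simp add: F_def)
  then have "(mat 1 - Y) ** (mat 1 - Y) = mat 1 - Z"
    by (simp add: matrix_mult_linear_simps algebra_simps scaleR_2)
  then have sq: "(mat 1 - Y) ** (mat 1 - Y) = (1 / c) *\<^sub>R Q" by (simp add: Z_def)
  have "pd (mat 1 - Y)"
    unfolding pd_def
  proof (intro conjI allI impI)
    show "sym_mat (mat 1 - Y)" using sym_L[OF Y_L] by (simp add: sym_mat_intros)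
    fix x :: "real^'n" assume "x \<noteq> 0"
    then have x: "0 < x \<bullet> x" by simp
    have "x \<bullet> (Y *v x) \<le> norm x * norm (Y *v x)" by (rule norm_cauchy_schwarz)
    also have "\<dots> \<le> norm x * (r * norm x)" by (intro mult_left_mono Yn) simp
    also have "\<dots> = r * (x \<bullet> x)"
      by (simp add: power2_norm_eq_inner[symmetric] power2_eq_square)
    also have "\<dots> < 1 * (x \<bullet> x)" using r x by (intro mult_strict_right_mono)
    finally show "0 < x \<bullet> ((mat 1 - Y) *v x)"
      by (simp add: matrix_vector_mult_diff_rdistrib inner_diff_right)
  qed
  then have "pd (sqrt c *\<^sub>R (mat 1 - Y))" using c by (simp add: pd_scaleR)
  moreover have "(sqrt c *\<^sub>R (mat 1 - Y)) ** (sqrt c *\<^sub>R (mat 1 - Y)) = Q"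
    using sq c by (simp add: matrix_mult_linear_simps(5,6))
  moreover have "sqrt c *\<^sub>R (mat 1 - Y) \<in> L" by (simp add: L_intros Y_L)
  ultimately show ?thesis by (intro that)
qed

end

text \<open>With \<open>L\<close> all symmetric matrices, \<open>sqrt_L\<close> provides square
  roots of arbitrary positive definite matrices, on which the trace inequalities below rely.\<close>

interpretation all_sym: sym_algebra "{A :: real^'n^'n. sym_mat A}"
  by unfold_locales (auto simp: sym_mat_intros subspace_def)

section \<open>Trace inequalities\<close>

lemma pd_inner_nonneg:
  assumes "pd (A :: real^'n^'n)" "\<And>x. 0 \<le> x \<bullet> (B *v x)"
  shows "0 \<le> A \<bullet> B"
proof -
  obtain R where R: "sym_mat R" "R ** R = A"
    using all_sym.sqrt_L[of A] assms(1) by (auto simp: pd_def)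
  have "A \<bullet> B = trace (R ** (R ** B))"
    using R by (simp add: trace_mult_sym_mat sym_mat_square matrix_mul_assoc flip: R(2))
  also have "\<dots> = trace (R ** B ** R)" by (rule trace_mul_sym)
  finally show ?thesis using trace_congruence_nonneg[OF R(1) assms(2)] by simp
qed

lemma psd_inner_nonneg:
  assumes A: "psd (A :: real^'n^'n)" and B: "\<And>x. 0 \<le> x \<bullet> (B *v x)"
  shows "0 \<le> A \<bullet> B"
proof (rule ccontr)
  assume neg: "\<not> 0 \<le> A \<bullet> B"
  have le: "0 \<le> A \<bullet> B + \<delta> * trace B" if "0 < \<delta>" for \<delta>
    using pd_inner_nonneg[OF pd_add_scaleR_one[OF A that] B]
    by (simp add: inner_add_left trace_eq_inner)
  have "0 < trace B" using le[of 1] neg by simp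
  \<comment> \<open>This \<delta> cancels only half of the negative number A . B.\<close>
  with neg le[of "- (A \<bullet> B) / (2 * trace B)"] show False by (simp add: field_simps)
qed

lemma inner_mono_loewner:
  "psd H \<Longrightarrow> loewner_le A B \<Longrightarrow> H \<bullet> A \<le> H \<bullet> (B :: real^'n^'n)"
  using psd_inner_nonneg[of H "B - A"] psd_nonneg[of "B - A"]
  by (simp add: loewner_le_def inner_diff_right)

lemma trace_mono: "loewner_le A B \<Longrightarrow> trace A \<le> trace (B :: real^'n^'n)"
  using inner_mono_loewner[OF psd_one] by (simp add: trace_eq_inner)

lemma outer_le_scaleR_one: "loewner_le (outer v v) ((v \<bullet> v) *\<^sub>R mat 1)"
  for v :: "real^'n"
  using Cauchy_Schwarz_ineq[of v]
  by (intro loewner_leI) (simp_all add: sym_mat_intros outer_mult_vec inner_commute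
      flip: scaleR_matrix_vector_assoc power2_eq_square)

lemma quad_le_trace:
  assumes "psd (A :: real^'n^'n)"
  shows "v \<bullet> (A *v v) \<le> (v \<bullet> v) * trace A"
  using inner_mono_loewner[OF assms outer_le_scaleR_one[of v]]
  by (simp add: inner_outer trace_eq_inner inner_commute)

text \<open>Supplies the uniqueness of the minimizer: the diagonal entries of D P D are values of
  the form of P at the columns of D, so a nonpositive sum forces every column to vanish.\<close>

lemma trace_congruence_pd_zero:
  assumes D: "sym_mat D" and P: "pd (P :: real^'n^'n)" and 0: "trace (D ** P ** D) \<le> 0"
  shows "D = 0"
proof -
  have eq: "(D ** P ** D) $ i $ i = (D *v axis i 1) \<bullet> (P *v (D *v axis i 1))" for i
  proof -
    have "(D ** P ** D) $ i $ i = axis i 1 \<bullet> ((D ** P ** D) *v axis i 1)"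
      by (simp add: inner_axis' matrix_vector_mult_basis column_def)
    then show ?thesis by (simp add: sym_mat_inner[OF D] flip: matrix_vector_mul_assoc)
  qed
  have nn: "0 \<le> (D ** P ** D) $ i $ i" for i
    unfolding eq by (rule psd_nonneg[OF pd_imp_psd[OF P]])
  have "(\<Sum>i\<in>UNIV. (D ** P ** D) $ i $ i) = 0"
    using 0 nn by (intro antisym sum_nonneg) (auto simp: trace_def)
  then have "(D ** P ** D) $ i $ i = 0" for i
    using nn by (simp add: sum_nonneg_eq_0_iff)
  then have "D *v axis i 1 = 0" for i
    using P unfolding eq pd_def by (metis less_irrefl)
  then have "column i D = 0" for i by (simp add: matrix_vector_mult_basis)
  then show ?thesis by (simp add: vec_eq_iff column_def)
qed

text \<open>The matrix version of (r - h)^2 / h = r^2 / h - 2 r + h. With R^2 the projection of M,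
  it splits the objective into the constant 2 tr R and a nonnegative square.\<close>

lemma trace_completing_square:
  assumes R: "sym_mat R" and H: "pd (H :: real^'n^'n)"
  shows "trace ((R - H) ** matrix_inv H ** (R - H)) =
    (R ** R) \<bullet> matrix_inv H - 2 * trace R + trace H"
proof -
  have "(R - H) ** matrix_inv H ** (R - H) = R ** matrix_inv H ** R - R - R + H"
    by (simp add: matrix_mult_linear_simps pd_invertible[OF H] flip: matrix_mul_assoc)
  then have "trace ((R - H) ** matrix_inv H ** (R - H)) =
      trace (R ** matrix_inv H ** R) - trace R - trace R + trace H"
    by (simp only: trace_add trace_sub)
  moreover have "trace (R ** matrix_inv H ** R) = (R ** R) \<bullet> matrix_inv H"
    using trace_mul_sym[of "R ** matrix_inv H" R]
    by (simp add: trace_mult_sym_mat sym_mat_square R matrix_mul_assoc)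
  ultimately show ?thesis by simp
qed


lemma pd_ge_scaleR_one:
  assumes "pd (M :: real^'n^'n)"
  obtains \<kappa> where "0 < \<kappa>" "loewner_le (\<kappa> *\<^sub>R mat 1) M"
proof -
  obtain \<kappa> where "0 < \<kappa>" "\<And>x. \<kappa> * (x \<bullet> x) \<le> x \<bullet> (M *v x)"
    using pd_lower_bound[OF assms] by blast
  then show ?thesis using assms
    by (intro that[of \<kappa>] loewner_leI) (auto simp: pd_def sym_mat_intros simp flip: scaleR_matrix_vector_assoc)
qed

lemma pd_scaleR_one: "0 < \<kappa> \<Longrightarrow> pd (\<kappa> *\<^sub>R mat 1 :: real^'n^'n)"
  using pd_add_scaleR_one[OF psd_zero] by simp

lemma pd_of_scaleR_one_le: "0 < \<kappa> \<Longrightarrow> loewner_le (\<kappa> *\<^sub>R mat 1) (A :: real^'n^'n) \<Longrightarrow> pd A"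
  by (rule pd_mono[OF pd_scaleR_one])

section \<open>Projection onto the algebra and the preconditioner\<close>

context sym_algebra
begin

text \<open>The objective sees M only through its inner products with the inverses of members of
  \<open>L\<close>, which lie in \<open>L\<close> again. M may therefore be replaced by the member
  of \<open>L\<close> with the same inner products.\<close>

definition proj_L :: "real^'n^'n \<Rightarrow> real^'n^'n" where
  "proj_L M = (SOME Q. Q \<in> L \<and> (\<forall>A\<in>L. Q \<bullet> A = M \<bullet> A))"

lemma proj_L: "proj_L M \<in> L" "A \<in> L \<Longrightarrow> proj_L M \<bullet> A = M \<bullet> A"
proof -
  obtain Q Q' where "Q \<in> span L" "\<And>w. w \<in> span L \<Longrightarrow> orthogonal Q' w" "M = Q + Q'"
    using orthogonal_subspace_decomp_exists[of L M] by blast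
  then have "\<exists>Q. Q \<in> L \<and> (\<forall>A\<in>L. Q \<bullet> A = M \<bullet> A)"
    using span_eq_iff[THEN iffD2, OF subspace_L]
    by (intro exI[of _ Q]) (auto simp: inner_add_left orthogonal_def)
  from someI_ex[OF this] show "proj_L M \<in> L" "A \<in> L \<Longrightarrow> proj_L M \<bullet> A = M \<bullet> A"
    by (auto simp: proj_L_def)
qed

lemma proj_L_eqI:
  assumes "Q \<in> L" "\<And>A. A \<in> L \<Longrightarrow> Q \<bullet> A = M \<bullet> A"
  shows "proj_L M = Q"
proof -
  have "proj_L M - Q \<in> L" by (simp add: L_intros proj_L assms)
  then have "(proj_L M - Q) \<bullet> (proj_L M - Q) = 0"
    using proj_L(2)[of "proj_L M - Q" M] assms(2)[of "proj_L M - Q"] by (simp add: inner_diff_left)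
  then show ?thesis by simp
qed

lemma proj_L_id: "Q \<in> L \<Longrightarrow> proj_L Q = Q"
  by (rule proj_L_eqI) auto

lemma linear_proj_L: "linear proj_L"
  by (auto intro!: linearI proj_L_eqI simp: L_intros proj_L inner_add_left)

lemmas proj_L_simps = linear_add[OF linear_proj_L] linear_diff[OF linear_proj_L]
  linear_scale[OF linear_proj_L] linear_0[OF linear_proj_L] proj_L_id[OF one_L]

text \<open>If \<open>- \<mu> < 0\<close> were the least eigenvalue of the projection \<open>Q\<close> of a positive semidefinite \<open>M\<close>,
  the resolvents \<open>(Q + (\<mu> + \<delta>) I)\<^sup>-\<^sup>1\<close>, which lie in \<open>L\<close>, would have negative inner product with \<open>M\<close>
  for small \<open>\<delta>\<close>.\<close>

lemma psd_proj_L: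
  assumes M: "psd M"
  shows "psd (proj_L M)"
proof -
  let ?Q = "proj_L M"
  have sym: "sym_mat ?Q" by (simp add: sym_L proj_L)
  have neg: "- ?Q *v x = - (?Q *v x)" for x
    using matrix_vector_mult_diff_rdistrib[of 0 ?Q x] by simp
  obtain v \<mu> where v: "norm v = 1" "- ?Q *v v = \<mu> *\<^sub>R v"
    and le: "\<And>x. x \<bullet> (- ?Q *v x) \<le> \<mu> * (x \<bullet> x)"
    using sym_mat_max_eigenvector[OF sym_mat_uminus[OF sym]] by blast
  have "\<mu> \<le> 0"
  proof (rule ccontr)
    assume "\<not> \<mu> \<le> 0"
    then have \<mu>: "0 < \<mu>" by simp
    define d where "d = real CARD('n)"
    \<comment> \<open>With this choice (\<mu> + \<delta>) / \<delta> = d + 2. Pairing M with the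
      resolvent allows at most d, while the eigenvector v forces the trace of the resolvent up to 1
      / \<delta>.\<close>
    define \<delta> where "\<delta> = \<mu> / (d + 1)"
    have \<delta>: "0 < \<delta>" using \<mu> by (simp add: \<delta>_def d_def)
    define R where "R = (?Q + \<mu> *\<^sub>R mat 1) + \<delta> *\<^sub>R mat 1"
    have R_L: "R \<in> L" by (simp add: R_def L_intros proj_L)
    have "psd (?Q + \<mu> *\<^sub>R mat 1)"
    proof -
      have "0 \<le> x \<bullet> (?Q *v x) + \<mu> * (x \<bullet> x)" for x
        using le[of x] unfolding neg inner_minus_right by linarith
      then show ?thesis
        by (simp add: psd_def sym sym_mat_intros matrix_vector_mult_add_rdistrib inner_add_right
            flip: scaleR_matrix_vector_assoc)
    qed
    then have R: "pd R" unfolding R_def using \<delta> by (rule pd_add_scaleR_one)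
    let ?S = "matrix_inv R"
    have S: "pd ?S" "?S \<in> L" using R R_L by (auto intro: pd_inv inv_L)
    have "R *v v = \<delta> *\<^sub>R v"
      using v(2) unfolding neg
      by (simp add: R_def matrix_vector_mult_add_rdistrib neg_eq_iff_add_eq_0 flip: scaleR_matrix_vector_assoc)
    then have "\<delta> *\<^sub>R (?S *v v) = v"
      using pd_inv_mult_vec(2)[OF R, of v] by (simp add: matrix_vector_mult_scaleR)
    moreover have "?S *v v = (1 / \<delta>) *\<^sub>R (\<delta> *\<^sub>R (?S *v v))" using \<delta> by simp
    ultimately have "?S *v v = (1 / \<delta>) *\<^sub>R v" by simp
    then have "v \<bullet> (?S *v v) = 1 / \<delta>"
      using v(1) by (simp add: power2_norm_eq_inner[symmetric])
    then have tr: "1 / \<delta> \<le> trace ?S"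
      using quad_le_trace[OF pd_imp_psd[OF S(1)], of v] v(1)
      by (simp add: power2_norm_eq_inner[symmetric])
    have "0 \<le> M \<bullet> ?S"
      using psd_inner_nonneg[OF M] psd_nonneg[OF pd_imp_psd[OF S(1)]] by blast
    also have "M \<bullet> ?S = ?Q \<bullet> ?S" using proj_L(2)[OF S(2)] by simp
    also have "?Q = R - (\<mu> + \<delta>) *\<^sub>R mat 1" by (simp add: R_def algebra_simps)
    also have "(R - (\<mu> + \<delta>) *\<^sub>R mat 1) \<bullet> ?S = d - (\<mu> + \<delta>) * trace ?S"
      using trace_mult_sym_mat[OF sym_L[OF R_L], of ?S]
      by (simp add: inner_diff_left pd_invertible[OF R] d_def trace_I flip: trace_eq_inner)
    finally have "(\<mu> + \<delta>) * trace ?S \<le> d" by simp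
    moreover have "(\<mu> + \<delta>) * (1 / \<delta>) \<le> (\<mu> + \<delta>) * trace ?S"
      using tr \<mu> \<delta> by (intro mult_left_mono) auto
    moreover have "(\<mu> + \<delta>) * (1 / \<delta>) = d + 2"
    proof -
      have "d + 1 \<noteq> 0" by (simp add: d_def add_nonneg_eq_0_iff)
      with \<mu> show ?thesis by (simp add: \<delta>_def divide_simps) (simp add: algebra_simps)
    qed
    ultimately show False by simp
  qed
  then have "\<mu> * (x \<bullet> x) \<le> 0" for x :: "real^'n"
    by (simp add: mult_nonpos_nonneg)
  then have "- (x \<bullet> (?Q *v x)) \<le> 0" for x
    using le[of x] unfolding neg inner_minus_right by (meson order_trans)
  then show ?thesis using sym by (simp add: psd_def)
qed

lemma proj_L_mono: "loewner_le A B \<Longrightarrow> loewner_le (proj_L A) (proj_L B)"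
  using psd_proj_L[of "B - A"] by (simp add: loewner_le_def proj_L_simps)

lemma pd_proj_L:
  assumes "pd M"
  shows "pd (proj_L M)"
proof -
  obtain \<kappa> where \<kappa>: "0 < \<kappa>" "loewner_le (\<kappa> *\<^sub>R mat 1) M" using pd_ge_scaleR_one[OF assms] .
  then have "loewner_le (\<kappa> *\<^sub>R mat 1) (proj_L M)"
    using proj_L_mono[OF \<kappa>(2)] by (simp add: proj_L_simps)
  then show ?thesis by (rule pd_of_scaleR_one_le[OF \<kappa>(1)])
qed

abbreviation psd_L :: "(real^'n^'n) set" where
  "psd_L \<equiv> {A \<in> L. psd A}"

text \<open>Completing the square identifies the minimizer as the square root of the projection.\<close>

lemma precond:
  assumes M: "pd M"
  shows precond_L: "precond psd_L M \<in> L"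
    and pd_precond: "pd (precond psd_L M)"
    and precond_square: "precond psd_L M ** precond psd_L M = proj_L M"
proof -
  obtain R where R: "R \<in> L" "pd R" "R ** R = proj_L M"
    using sqrt_L[OF proj_L(1) pd_proj_L[OF M]] .
  have val: "mat_inner M (matrix_inv H) + trace H =
      2 * trace R + trace ((R - H) ** matrix_inv H ** (R - H))" if H: "H \<in> L" "pd H" for H
    using trace_completing_square[OF sym_L[OF R(1)] H(2)] proj_L(2)[OF inv_L[OF H], of M]
    by (simp add: mat_inner_eq_inner R(3))
  have nn: "0 \<le> trace ((R - H) ** matrix_inv H ** (R - H))" if H: "H \<in> L" "pd H" for H
    by (intro trace_congruence_nonneg sym_mat_diff sym_L R H psd_nonneg pd_imp_psd pd_inv)
  have valR: "mat_inner M (matrix_inv R) + trace R = 2 * trace R"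
    using val[OF R(1,2)] by (simp add: matrix_mult_linear_simps trace_eq_inner)
  have "precond_pd psd_L M = R"
    unfolding precond_pd_def
  proof (rule the_equality, goal_cases)
    case 1
    have "mat_inner M (matrix_inv R) + trace R \<le> mat_inner M (matrix_inv H) + trace H"
      if "H \<in> L" "pd H" for H
      unfolding valR val[OF that] using nn[OF that] by simp
    then show ?case using R(1,2) by (auto simp: pd_imp_psd)
  next
    case (2 H)
    then have H: "H \<in> L" "pd H" by auto
    have "mat_inner M (matrix_inv H) + trace H \<le> mat_inner M (matrix_inv R) + trace R"
      using 2 R(1,2) by (auto simp: pd_imp_psd)
    then have "trace ((R - H) ** matrix_inv H ** (R - H)) \<le> 0"
      using val[OF H] valR by simp
    then have "R - H = 0"
      by (rule trace_congruence_pd_zero[rotated 2]) (intro sym_mat_diff sym_L R H pd_inv)+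
    then show ?case by simp
  qed
  then have "precond psd_L M = R" using M by (simp add: precond_def)
  then show "precond psd_L M \<in> L" "pd (precond psd_L M)"
    "precond psd_L M ** precond psd_L M = proj_L M" using R by auto
qed

lemma precond_mono:
  assumes "pd A" "loewner_le A B"
  shows "loewner_le (precond psd_L A) (precond psd_L B)"
proof -
  have B: "pd B" using assms pd_mono by blast
  show ?thesis
    using proj_L_mono[OF assms(2)] unfolding precond_square[OF assms(1), symmetric] precond_square[OF B, symmetric]
    by (rule sqrt_mono[OF sym_L[OF precond_L[OF assms(1)]] pd_imp_psd[OF pd_precond[OF B]]])
qed

lemma precond_scaleR_one_le:
  assumes "0 < \<epsilon>" "loewner_le (\<epsilon> *\<^sub>R mat 1) M"
  shows "loewner_le (sqrt \<epsilon> *\<^sub>R mat 1) (precond psd_L M)"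
proof -
  note M = pd_of_scaleR_one_le[OF assms]
  have "loewner_le ((sqrt \<epsilon> *\<^sub>R mat 1) ** (sqrt \<epsilon> *\<^sub>R mat 1)) (precond psd_L M ** precond psd_L M)"
    using proj_L_mono[OF assms(2)] assms(1) unfolding precond_square[OF M]
    by (simp add: matrix_mult_linear_simps(5,6) proj_L_simps)
  then show ?thesis
    by (rule sqrt_mono[OF sym_mat_scaleR[OF sym_mat_one] pd_imp_psd[OF pd_precond[OF M]]])
qed

text \<open>Each root is at least sqrt \<epsilon> times I, so the linear term of \<mu> (\<mu> + 2
  \<kappa>) <= c bounds \<mu> by c / (2 sqrt \<epsilon>), in both orders of A and B. The resulting
  continuity is what makes the preconditioners measurable.\<close>

lemma precond_lipschitz:
  assumes "0 < \<epsilon>"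
  shows "\<exists>K. \<forall>A B. loewner_le (\<epsilon> *\<^sub>R mat 1) A \<longrightarrow> loewner_le (\<epsilon> *\<^sub>R mat 1) B \<longrightarrow>
    norm (precond psd_L A - precond psd_L B) \<le> K * norm (A - B)"
proof -
  obtain K1 where K1: "0 < K1" "\<And>X. norm (proj_L X) \<le> norm X * K1"
    using bounded_linear.pos_bounded[OF linear_conv_bounded_linear[THEN iffD1, OF linear_proj_L]] by blast
  obtain K2 where K2: "0 < K2" "\<And>(X :: real^'n^'n) x. norm (X *v x) \<le> norm X * norm x * K2"
    using bounded_bilinear.pos_bounded[OF bounded_bilinear_matrix_vector] by blast
  have le: "x \<bullet> ((precond psd_L A - precond psd_L B) *v x) \<le> K2 * K1 * norm (A - B) / (2 * sqrt \<epsilon>) * (x \<bullet> x)"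
    if A: "loewner_le (\<epsilon> *\<^sub>R mat 1) A" and B: "loewner_le (\<epsilon> *\<^sub>R mat 1) B" for A B :: "real^'n^'n" and x
  proof -
    note pdA = pd_of_scaleR_one_le[OF assms A] and pdB = pd_of_scaleR_one_le[OF assms B]
    let ?c = "K2 * K1 * norm (A - B)"
    have ge: "sqrt \<epsilon> * (x \<bullet> x) \<le> x \<bullet> (precond psd_L B *v x)" for x
      using loewner_leD[OF precond_scaleR_one_le[OF assms B], of x]
      by (simp flip: scaleR_matrix_vector_assoc)
    have sq: "x \<bullet> ((precond psd_L A ** precond psd_L A - precond psd_L B ** precond psd_L B) *v x)
      \<le> ?c * (x \<bullet> x)" for x
    proof -
      have "x \<bullet> (proj_L (A - B) *v x) \<le> norm x * norm (proj_L (A - B) *v x)" by (rule norm_cauchy_schwarz)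
      also have "\<dots> \<le> norm x * (norm (proj_L (A - B)) * norm x * K2)"
        by (intro mult_left_mono K2) simp
      also have "\<dots> \<le> norm x * ((norm (A - B) * K1) * norm x * K2)"
        using K2(1) by (intro mult_left_mono mult_right_mono K1) auto
      also have "\<dots> = ?c * (x \<bullet> x)" by (simp add: power2_norm_eq_inner[symmetric] power2_eq_square)
      finally show ?thesis by (simp add: precond_square pdA pdB proj_L_simps)
    qed
    obtain \<mu> where \<mu>: "\<And>x. x \<bullet> ((precond psd_L A - precond psd_L B) *v x) \<le> \<mu> * (x \<bullet> x)"
      "0 < \<mu> \<longrightarrow> \<mu> * (\<mu> + 2 * sqrt \<epsilon>) \<le> ?c"
      using diff_le_of_square_diff_le[OF sym_L[OF precond_L[OF pdA]] sym_L[OF precond_L[OF pdB]] ge sq]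
      by blast
    have "\<mu> \<le> ?c / (2 * sqrt \<epsilon>)"
    proof (cases "0 < \<mu>")
      case True
      with \<mu>(2) have "\<mu> * \<mu> + \<mu> * (2 * sqrt \<epsilon>) \<le> ?c" by (simp add: distrib_left)
      then have "\<mu> * (2 * sqrt \<epsilon>) \<le> ?c" using zero_le_square[of \<mu>] by linarith
      then show ?thesis using assms by (simp add: pos_le_divide_eq)
    next
      case False
      moreover have "0 \<le> ?c / (2 * sqrt \<epsilon>)" using K1(1) K2(1) assms by auto
      ultimately show ?thesis by linarith
    qed
    then show ?thesis by (rule order_trans[OF \<mu>(1) mult_right_mono]) simp
  qed
  show ?thesis
  proof (intro exI[of _ "(real CARD('n))\<^sup>2 * (K2 * K1 / (2 * sqrt \<epsilon>))"] allI impI)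
    fix A B :: "real^'n^'n"
    assume A: "loewner_le (\<epsilon> *\<^sub>R mat 1) A" and B: "loewner_le (\<epsilon> *\<^sub>R mat 1) B"
    note pdA = pd_of_scaleR_one_le[OF assms A] and pdB = pd_of_scaleR_one_le[OF assms B]
    have "\<bar>x \<bullet> ((precond psd_L A - precond psd_L B) *v x)\<bar>
        \<le> (K2 * K1 * norm (A - B) / (2 * sqrt \<epsilon>)) * (x \<bullet> x)" for x
    proof -
      have "x \<bullet> ((precond psd_L B - precond psd_L A) *v x) = - (x \<bullet> ((precond psd_L A - precond psd_L B) *v x))"
        by (simp add: matrix_vector_mult_diff_rdistrib inner_diff_right)
      then show ?thesis using le[OF A B, of x] le[OF B A, of x] by (simp add: norm_minus_commute[of B])
    qed
    then have "norm (precond psd_L A - precond psd_L B)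
        \<le> (real CARD('n))\<^sup>2 * (K2 * K1 * norm (A - B) / (2 * sqrt \<epsilon>))"
      by (intro sym_mat_norm_le sym_mat_diff sym_L precond_L pdA pdB)
    then show "norm (precond psd_L A - precond psd_L B)
        \<le> (real CARD('n))\<^sup>2 * (K2 * K1 / (2 * sqrt \<epsilon>)) * norm (A - B)"
      by (simp add: mult_ac)
  qed
qed

lemma continuous_on_precond:
  assumes "0 < \<epsilon>"
  shows "continuous_on {M. loewner_le (\<epsilon> *\<^sub>R mat 1) M} (precond psd_L)"
proof -
  obtain K where K: "\<And>A B. loewner_le (\<epsilon> *\<^sub>R mat 1) A \<Longrightarrow> loewner_le (\<epsilon> *\<^sub>R mat 1) B \<Longrightarrow>
    norm (precond psd_L A - precond psd_L B) \<le> K * norm (A - B)"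
    using precond_lipschitz[OF assms] by blast
  have "\<bar>K\<bar>-lipschitz_on {M. loewner_le (\<epsilon> *\<^sub>R mat 1) M} (precond psd_L)"
    by (intro lipschitz_onI) (auto simp: dist_norm intro!: order_trans[OF K] mult_right_mono)
  then show ?thesis by (rule lipschitz_on_continuous_on)
qed

end

section \<open>Continuity of inversion and bounds by the operator norm\<close>

lemma pd_inv_le_scaleR_one:
  assumes "0 < \<kappa>" "loewner_le (\<kappa> *\<^sub>R mat 1) (A :: real^'n^'n)"
  shows "loewner_le (matrix_inv A) ((1 / \<kappa>) *\<^sub>R mat 1)"
proof -
  have pd: "pd (\<kappa> *\<^sub>R mat 1 :: real^'n^'n)" using assms(1) by (rule pd_scaleR_one)
  have "matrix_inv (\<kappa> *\<^sub>R mat 1 :: real^'n^'n) = (1 / \<kappa>) *\<^sub>R mat 1"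
    using assms(1) by (intro matrix_inv_eqI[OF pd]) (simp add: matrix_mult_linear_simps(5,6))
  with pd_inv_antimono[OF pd assms(2)] show ?thesis by simp
qed

lemma norm_matrix_inv_le:
  assumes "0 < \<kappa>" "loewner_le (\<kappa> *\<^sub>R mat 1) (A :: real^'n^'n)"
  shows "norm (matrix_inv A *v x) \<le> (1 / \<kappa>) * norm x"
  using loewner_leD[OF pd_inv_le_scaleR_one[OF assms]]
  by (intro psd_norm_le pd_imp_psd[OF pd_inv] pd_of_scaleR_one_le[OF assms])
    (simp flip: scaleR_matrix_vector_assoc)

text \<open>The resolvent identity A^-1 - B^-1 = A^-1 (B - A) B^-1, with both inverses bounded by 1
  / \<kappa>, gives a Lipschitz constant.\<close>

lemma continuous_on_matrix_inv:
  assumes "0 < \<kappa>"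
  shows "continuous_on {A :: real^'n^'n. loewner_le (\<kappa> *\<^sub>R mat 1) A} matrix_inv"
proof -
  obtain K where K: "0 < K" "\<And>(X :: real^'n^'n) x. norm (X *v x) \<le> norm X * norm x * K"
    using bounded_bilinear.pos_bounded[OF bounded_bilinear_matrix_vector] by blast
  have pd: "pd A" if "loewner_le (\<kappa> *\<^sub>R mat 1) A" for A :: "real^'n^'n"
    using that assms by (rule pd_of_scaleR_one_le[rotated])
  have "norm (matrix_inv A - matrix_inv B) \<le> (real CARD('n))\<^sup>2 * ((K / \<kappa>\<^sup>2) * norm (A - B))"
    if A: "loewner_le (\<kappa> *\<^sub>R mat 1) A" and B: "loewner_le (\<kappa> *\<^sub>R mat 1) B" for A B :: "real^'n^'n"
  proof (rule sym_mat_norm_le)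
    note pA = pd[OF A] and pB = pd[OF B]
    have sA: "sym_mat (matrix_inv A)" and sB: "sym_mat (matrix_inv B)"
      using pd_inv[OF pA] pd_inv[OF pB] by (auto simp: pd_def)
    then show "sym_mat (matrix_inv A - matrix_inv B)" by (rule sym_mat_diff)
    fix x
    have "matrix_inv A - matrix_inv B = matrix_inv A ** (B - A) ** matrix_inv B"
      by (simp add: matrix_mult_linear_simps pd_invertible[OF pA])
        (simp add: pd_invertible[OF pB] flip: matrix_mul_assoc)
    then have "x \<bullet> ((matrix_inv A - matrix_inv B) *v x)
        = (matrix_inv A *v x) \<bullet> ((B - A) *v (matrix_inv B *v x))"
      by (simp add: sym_mat_inner[OF sA] flip: matrix_vector_mul_assoc)
    also have "\<bar>\<dots>\<bar> \<le> norm (matrix_inv A *v x) * norm ((B - A) *v (matrix_inv B *v x))"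
      by (rule Cauchy_Schwarz_ineq2)
    also have "\<dots> \<le> ((1 / \<kappa>) * norm x) * (norm (B - A) * ((1 / \<kappa>) * norm x) * K)"
    proof (rule mult_mono[OF norm_matrix_inv_le[OF assms A]])
      show "norm ((B - A) *v (matrix_inv B *v x)) \<le> norm (B - A) * ((1 / \<kappa>) * norm x) * K"
        using K(1) norm_matrix_inv_le[OF assms B, of x]
        by (intro order_trans[OF K(2)[of "B - A"]] mult_right_mono mult_left_mono) auto
    qed (use assms in auto)
    also have "\<dots> = (K / \<kappa>\<^sup>2) * norm (A - B) * (x \<bullet> x)"
      by (simp add: power2_norm_eq_inner[symmetric] power2_eq_square norm_minus_commute)
    finally show "\<bar>x \<bullet> ((matrix_inv A - matrix_inv B) *v x)\<bar> \<le> (K / \<kappa>\<^sup>2) * norm (A - B) * (x \<bullet> x)" .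
  qed
  then have "((real CARD('n))\<^sup>2 * (K / \<kappa>\<^sup>2))-lipschitz_on {A :: real^'n^'n. loewner_le (\<kappa> *\<^sub>R mat 1) A} matrix_inv"
    using K(1) by (intro lipschitz_onI) (auto simp: dist_norm mult.assoc)
  then show ?thesis by (rule lipschitz_on_continuous_on)
qed


lemma pd_trace_pos:
  assumes "pd (A :: real^'n^'n)"
  shows "0 < trace A"
proof -
  let ?v = "axis undefined 1 :: real^'n"
  have "?v \<noteq> 0" by (simp add: axis_eq_0_iff)
  then have "0 < ?v \<bullet> (A *v ?v)" using assms by (simp add: pd_def)
  also have "\<dots> \<le> trace A"
    using quad_le_trace[OF pd_imp_psd[OF assms], of ?v] by (simp add: inner_axis_axis)
  finally show ?thesis .
qed

lemma op_norm_vec: "norm (A *v x) \<le> op_norm A * norm (x :: real^'n)"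
  unfolding op_norm_def by (rule onorm) (rule matrix_vector_mul_bounded_linear)

lemma op_norm_nonneg: "0 \<le> op_norm (A :: real^'n^'n)"
  unfolding op_norm_def by (rule onorm_pos_le) (rule matrix_vector_mul_bounded_linear)

lemma quad_le_op_norm: "x \<bullet> (A *v x) \<le> op_norm A * (x \<bullet> (x :: real^'n))"
proof -
  have "x \<bullet> (A *v x) \<le> norm x * norm (A *v x)" by (rule norm_cauchy_schwarz)
  also have "\<dots> \<le> norm x * (op_norm A * norm x)" by (intro mult_left_mono op_norm_vec) simp
  finally show ?thesis by (simp add: power2_norm_eq_inner[symmetric] power2_eq_square mult_ac)
qed

text \<open>The form of |S| I - S is nonnegative, so its pairing with H is too. Applied to S_T, a
  Hessian bound H produces the smoothness term of \<xi>, and H = I produces the factor d.\<close>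

lemma inner_le_trace_op_norm:
  assumes "psd (H :: real^'n^'n)"
  shows "H \<bullet> S \<le> trace H * op_norm S"
proof -
  have "0 \<le> H \<bullet> (op_norm S *\<^sub>R mat 1 - S)"
    using quad_le_op_norm[of _ S]
    by (intro psd_inner_nonneg assms)
      (simp add: matrix_vector_mult_diff_rdistrib inner_diff_right flip: scaleR_matrix_vector_assoc)
  then show ?thesis by (simp add: inner_diff_right trace_eq_inner inner_commute mult.commute)
qed

lemma psd_le_op_norm: "psd A \<Longrightarrow> loewner_le A (op_norm A *\<^sub>R mat 1)"
  using quad_le_op_norm[of _ A]
  by (intro loewner_leI) (auto simp: psd_sym sym_mat_intros simp flip: scaleR_matrix_vector_assoc)

lemma inner_square_inv: "pd (A :: real^'n^'n) \<Longrightarrow> (A ** A) \<bullet> matrix_inv A = trace A"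
  using pd_invertible[of A]
  by (simp add: inner_matrix_mult_left pd_def sym_mat_def trace_eq_inner inner_commute[of "mat 1"])

text \<open>The right-hand side is \<open>trace Z\<close> with \<open>Z = s W + (1 - s) C\<close>, and
  \<open>A\<^sup>2 = Z\<^sup>2 - (1 - s) (Z C + C Z - 2 C\<^sup>2)\<close>.\<close>

lemma trace_sqrt_mix_le:
  fixes A W C :: "real^'n^'n"
  assumes A: "sym_mat A" and C: "pd C" and CW: "loewner_le C W" and s: "0 \<le> s" "s \<le> 1"
    and sq: "A ** A = s\<^sup>2 *\<^sub>R (W ** W) + (1 - s\<^sup>2) *\<^sub>R (C ** C)"
  shows "trace A \<le> s * trace W + (1 - s) * trace C"
proof -
  define Z where "Z = s *\<^sub>R W + (1 - s) *\<^sub>R C"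
  have CZ: "loewner_le C Z"
    using loewner_le_scaleR[OF CW s(1)]
    by (simp add: loewner_le_def Z_def algebra_simps)
  have Z: "pd Z" by (rule pd_mono[OF C CZ])
  have symC: "sym_mat C" and symZ: "sym_mat Z" using C Z by (auto simp: pd_def)
  have "A ** A = Z ** Z - (1 - s) *\<^sub>R (Z ** C + C ** Z - 2 *\<^sub>R (C ** C))"
    unfolding sq Z_def
    by (simp add: matrix_mult_linear_simps algebra_simps power2_eq_square scaleR_2)
  moreover have "(Z ** C) \<bullet> matrix_inv Z = trace C" "(C ** Z) \<bullet> matrix_inv Z = trace C"
    using symZ pd_invertible[OF Z]
    by (simp_all add: inner_matrix_mult_left[of Z] inner_matrix_mult_right[of C] sym_mat_def
        trace_eq_inner inner_commute[of "mat 1"])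
  ultimately have "(A ** A) \<bullet> matrix_inv Z
      = trace Z - (1 - s) * (2 * trace C - 2 * ((C ** C) \<bullet> matrix_inv Z))"
    by (simp add: inner_diff_left inner_add_left inner_square_inv[OF Z])
  moreover have "(C ** C) \<bullet> matrix_inv Z \<le> trace C"
    using inner_mono_loewner[OF psd_square[OF symC] pd_inv_antimono[OF C CZ]] inner_square_inv[OF C]
    by simp
  then have "0 \<le> (1 - s) * (2 * trace C - 2 * ((C ** C) \<bullet> matrix_inv Z))"
    using s by simp
  ultimately have "(A ** A) \<bullet> matrix_inv Z \<le> trace Z" by simp
  \<comment> \<open>The square completed at Z gives 2 tr A <= A^2 . Z^-1 + tr Z, and the right-hand
    side is at most 2 tr Z.\<close>
  moreover have "0 \<le> (A ** A) \<bullet> matrix_inv Z - 2 * trace A + trace Z"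
    unfolding trace_completing_square[OF A Z, symmetric]
    by (intro trace_congruence_nonneg sym_mat_diff A symZ psd_nonneg[OF pd_imp_psd[OF pd_inv[OF Z]]])
  ultimately have "trace A \<le> trace Z" by simp
  then show ?thesis by (simp add: Z_def trace_add trace_scaleR)
qed

text \<open>Each e_t reaches the later values of u with weights 1, s, s^2, ..., of total at most the
  geometric sum b_n. The induction rests on b_(n+1) = 1 + s b_n.\<close>

lemma sum_recursion_le:
  fixes u e :: "nat \<Rightarrow> real"
  assumes u0: "u 0 \<le> 0" and step: "\<And>t. t < n \<Longrightarrow> u (Suc t) \<le> s * u t + e t"
    and e: "\<And>t. 0 \<le> e t" and s: "0 \<le> s"
  shows "(\<Sum>t<n. u (Suc t)) \<le> (\<Sum>i<n. s ^ i) * (\<Sum>t<n. e t)"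
  using step
proof (induction n)
  case (Suc n)
  let ?E = "\<lambda>n. \<Sum>t<n. e t" and ?b = "\<lambda>n. \<Sum>i<n. s ^ i"
  have E: "0 \<le> ?E n" "0 \<le> e n" using e by (auto intro: sum_nonneg)
  have b: "0 \<le> ?b n" using s by (auto intro: sum_nonneg)
  have "(\<Sum>t<Suc n. u (Suc t)) \<le> (\<Sum>t<Suc n. s * u t + e t)"
    by (intro sum_mono Suc.prems) simp
  also have "\<dots> = s * (\<Sum>t<Suc n. u t) + ?E (Suc n)"
    by (simp add: sum.distrib sum_distrib_left del: sum.lessThan_Suc)
  also have "(\<Sum>t<Suc n. u t) = u 0 + (\<Sum>t<n. u (Suc t))" by (rule sum.lessThan_Suc_shift)
  also have "s * (u 0 + (\<Sum>t<n. u (Suc t))) + ?E (Suc n) \<le> s * (?b n * ?E (Suc n)) + ?E (Suc n)"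
  proof -
    have "(\<Sum>t<n. u (Suc t)) \<le> ?b n * ?E n" using Suc by simp
    also have "\<dots> \<le> ?b n * ?E (Suc n)" using b E by (intro mult_left_mono) auto
    finally show ?thesis using u0 s by (intro add_right_mono mult_left_mono) auto
  qed
  also have "\<dots> = ?b (Suc n) * ?E (Suc n)"
    by (subst (3) sum.lessThan_Suc_shift) (simp add: sum_distrib_left algebra_simps del: sum.lessThan_Suc)
  finally show ?case .
qed simp

section \<open>Dual norms and growth of the accumulated preconditioner\<close>

context sym_algebra
begin

text \<open>H / tr H competes in the supremum defining the primal norm, so every x of norm at most 1
  satisfies x . H x <= tr H. Cauchy-Schwarz between the forms of H and H^-1 does the rest.\<close>

lemma dual_norm_le:
  assumes H: "H \<in> L" "pd H"
  shows "dual_norm psd_L y \<le> sqrt (trace H) * sqrt (y \<bullet> (matrix_inv H *v y))"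
  unfolding dual_norm_def
proof (rule cSUP_least)
  let ?S = "{H \<in> psd_L. trace H \<le> 1}"
  have "0 \<in> ?S" by (simp add: L_intros psd_zero trace_eq_inner)
  then have "set_norm psd_L 0 = 0"
    unfolding set_norm_def H_norm_def by (subst cSUP_const[symmetric, of ?S]) (auto intro!: SUP_cong)
  then show "{x. set_norm psd_L x \<le> 1} \<noteq> {}" by (auto intro!: exI[of _ 0])
  fix x assume "x \<in> {x. set_norm psd_L x \<le> 1}"
  then have x: "set_norm psd_L x \<le> 1" by simp
  define c where "c = trace H"
  have c: "0 < c" using pd_trace_pos[OF H(2)] by (simp add: c_def)
  \<comment> \<open>A real \<open>SUP\<close> dominates its members only over a bounded family;
    trace at most 1 bounds every member by |x|.\<close>
  have "bdd_above ((\<lambda>H. H_norm H x) ` ?S)"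
  proof (rule bdd_aboveI2)
    fix A assume "A \<in> ?S"
    then have A: "psd A" "trace A \<le> 1" by auto
    have "x \<bullet> (A *v x) \<le> (x \<bullet> x) * trace A" by (rule quad_le_trace[OF A(1)])
    also have "\<dots> \<le> x \<bullet> x" using A(2) by (simp add: mult_left_le)
    finally show "H_norm A x \<le> norm x" by (simp add: H_norm_def norm_eq_sqrt_inner)
  qed
  moreover have "(1 / c) *\<^sub>R H \<in> ?S"
    using H c by (auto simp: L_intros psd_scaleR pd_imp_psd trace_scaleR c_def)
  ultimately have "H_norm ((1 / c) *\<^sub>R H) x \<le> set_norm psd_L x"
    unfolding set_norm_def by (intro cSUP_upper)
  from order_trans[OF this x] have "sqrt ((x \<bullet> (H *v x)) / c) \<le> 1"
    by (simp add: H_norm_def flip: scaleR_matrix_vector_assoc)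
  then have le: "x \<bullet> (H *v x) \<le> c" using c by simp
  have Hi: "0 \<le> y \<bullet> (matrix_inv H *v y)" by (intro psd_nonneg pd_imp_psd pd_inv H)
  have "(x \<bullet> y)\<^sup>2 \<le> c * (y \<bullet> (matrix_inv H *v y))"
    by (intro order_trans[OF pd_inner_le[OF H(2)]] mult_right_mono le Hi)
  then have "x \<bullet> y \<le> sqrt (c * (y \<bullet> (matrix_inv H *v y)))"
    by (rule real_le_rsqrt)
  then show "x \<bullet> y \<le> sqrt (trace H) * sqrt (y \<bullet> (matrix_inv H *v y))"
    by (simp add: c_def real_sqrt_mult)
qed

text \<open>Pairing W'^2 = A^2 + \<pi>(a a^T) with W'^-1, a member of \<open>L\<close>, gives tr W'
  = A^2 . W'^-1 + a . W'^-1 a, and A <= W' bounds the first summand by tr A. Since Q is not damped,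
  A^2 = \<beta> W^2 + (1 - \<beta>) C^2, which is \<open>trace_sqrt_mix_le\<close> with s = sqrt
  \<beta>.\<close>

lemma trace_precond_step:
  assumes N: "psd N" and Q: "pd Q" and \<beta>: "0 \<le> \<beta>" "\<beta> \<le> 1"
    and W'_def: "W' = precond psd_L (\<beta> *\<^sub>R N + outer a a + Q)"
  shows "trace W' - trace (precond psd_L Q)
    \<le> sqrt \<beta> * (trace (precond psd_L (N + Q)) - trace (precond psd_L Q)) + a \<bullet> (matrix_inv W' *v a)"
proof -
  define A where "A = precond psd_L (\<beta> *\<^sub>R N + Q)"
  define W where "W = precond psd_L (N + Q)"
  define C where "C = precond psd_L Q"
  have pd1: "pd (\<beta> *\<^sub>R N + Q)" "pd (N + Q)" "pd (\<beta> *\<^sub>R N + outer a a + Q)"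
    using pd_add_psd[OF Q psd_scaleR[OF N \<beta>(1)]] pd_add_psd[OF Q N]
      pd_add_psd[OF Q psd_add[OF psd_scaleR[OF N \<beta>(1)] psd_outer[of a]]]
    by (simp_all add: add.commute)
  have A: "A \<in> L" "pd A" "A ** A = \<beta> *\<^sub>R proj_L N + proj_L Q"
    using precond[OF pd1(1)] by (simp_all add: A_def proj_L_simps)
  have W: "W \<in> L" "pd W" "W ** W = proj_L N + proj_L Q"
    using precond[OF pd1(2)] by (simp_all add: W_def proj_L_simps)
  have C: "C \<in> L" "pd C" "C ** C = proj_L Q"
    using precond[OF Q] by (simp_all add: C_def)
  have W': "W' \<in> L" "pd W'" "W' ** W' = A ** A + proj_L (outer a a)"
    using precond[OF pd1(3)] by (simp_all add: W'_def A(3) proj_L_simps algebra_simps)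
  have AW': "loewner_le A W'"
    unfolding A_def W'_def by (rule precond_mono[OF pd1(1)]) (simp add: loewner_le_def psd_outer)
  have CW: "loewner_le C W"
    unfolding C_def W_def by (rule precond_mono[OF Q]) (simp add: loewner_le_def N)
  have "A ** A = (sqrt \<beta>)\<^sup>2 *\<^sub>R (W ** W) + (1 - (sqrt \<beta>)\<^sup>2) *\<^sub>R (C ** C)"
    using \<beta> by (simp add: A(3) W(3) C(3) algebra_simps)
  then have trA: "trace A \<le> sqrt \<beta> * trace W + (1 - sqrt \<beta>) * trace C"
    using \<beta> by (intro trace_sqrt_mix_le sym_L A C CW) auto
  have "trace W' = (A ** A) \<bullet> matrix_inv W' + proj_L (outer a a) \<bullet> matrix_inv W'"
    using inner_square_inv[OF W'(2)] W'(3) by (simp add: inner_add_left)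
  also have "proj_L (outer a a) \<bullet> matrix_inv W' = a \<bullet> (matrix_inv W' *v a)"
    using proj_L(2)[OF inv_L[OF W'(1,2)]] by (simp add: inner_commute[of "outer a a"] inner_outer)
  also have "(A ** A) \<bullet> matrix_inv W' \<le> trace A"
    using inner_mono_loewner[OF psd_square[OF sym_L[OF A(1)]] pd_inv_antimono[OF A(2) AW']]
      inner_square_inv[OF A(2)] by simp
  finally show ?thesis using trA by (simp add: W_def C_def algebra_simps)
qed

text \<open>The pathwise core of the rate; its V is instantiated with the predictable U. Replacing
  each g_t g_t^T by a_t a_t^T + \<Sigma> accumulates geometric multiples of \<Sigma>. Enlarging the
  partial geometric sums to the full one makes Q the same at all times, so that
  \<open>trace_precond_step\<close> can be iterated with one fixed C.\<close>

lemma sum_dual_norm_le: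
  fixes a g :: "nat \<Rightarrow> real^'n"
  assumes \<beta>: "0 \<le> \<beta>" "\<beta> \<le> 1" and \<epsilon>: "0 < \<epsilon>" and \<Sigma>: "psd \<Sigma>"
    and M0: "M 0 = 0" and MSuc: "\<And>t. M (Suc t) = \<beta> *\<^sub>R M t + outer (g t) (g t)"
    and noise: "\<And>t. t < T \<Longrightarrow> loewner_le (outer (g t) (g t)) (outer (a t) (a t) + \<Sigma>)"
    and V_def: "\<And>t. V t = precond psd_L (\<beta> *\<^sub>R M t + outer (a t) (a t) + \<Sigma> + \<epsilon> *\<^sub>R mat 1)"
    and R_def: "R = trace (precond psd_L ((\<Sum>i<T. \<beta> ^ i) *\<^sub>R \<Sigma> + \<epsilon> *\<^sub>R mat 1))"
    and E_def: "E = (\<Sum>t<T. a t \<bullet> (matrix_inv (V t) *v a t))"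
  shows "(\<Sum>t<T. dual_norm psd_L (a t)) \<le> sqrt (real T * R * E) + sqrt (\<Sum>i<T. sqrt \<beta> ^ i) * E"
proof -
  define N where "N = rec_nat 0 (\<lambda>t X. \<beta> *\<^sub>R X + outer (a t) (a t))"
  have N: "N 0 = 0" "N (Suc t) = \<beta> *\<^sub>R N t + outer (a t) (a t)" for t by (simp_all add: N_def)
  have psdN: "psd (N t)" for t
    by (induction t) (simp_all add: N psd_zero psd_add psd_scaleR psd_outer \<beta>)
  have psdM: "psd (M t)" for t
    by (induction t) (simp_all add: M0 MSuc psd_zero psd_add psd_scaleR psd_outer \<beta>)
  have geo: "(\<Sum>i<Suc t. \<beta> ^ i) = 1 + \<beta> * (\<Sum>i<t. \<beta> ^ i)" for t
    by (subst sum.lessThan_Suc_shift) (simp add: sum_distrib_left)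
  have step: "loewner_le (\<beta> *\<^sub>R M t + X) (\<beta> *\<^sub>R N t + Y + (\<Sum>i<Suc t. \<beta> ^ i) *\<^sub>R \<Sigma>)"
    if "loewner_le (M t) (N t + (\<Sum>i<t. \<beta> ^ i) *\<^sub>R \<Sigma>)" "loewner_le X (Y + \<Sigma>)" for t X Y
    using loewner_le_add[OF loewner_le_scaleR[OF that(1) \<beta>(1)] that(2)]
    unfolding geo by (simp add: algebra_simps)
  have MN: "loewner_le (M t) (N t + (\<Sum>i<t. \<beta> ^ i) *\<^sub>R \<Sigma>)" if "t \<le> T" for t
    using that
  proof (induction t)
    case (Suc t)
    then show ?case using step[OF _ noise[of t]] by (simp add: MSuc N)
  qed (simp add: M0 N loewner_le_refl)
  define Q where "Q = (\<Sum>i<T. \<beta> ^ i) *\<^sub>R \<Sigma> + \<epsilon> *\<^sub>R mat 1"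
  have Q: "pd Q"
    unfolding Q_def by (intro pd_add_scaleR_one psd_scaleR \<Sigma> \<epsilon> sum_nonneg) (simp add: \<beta>)
  define W where "W t = precond psd_L (N t + Q)" for t
  have pdNQ: "pd (N t + Q)" for t using pd_add_psd[OF Q psdN] by (simp add: add.commute)
  have W: "W t \<in> L" "pd (W t)" for t using precond[OF pdNQ] by (simp_all add: W_def)
  have pdV: "pd (\<beta> *\<^sub>R M t + outer (a t) (a t) + \<Sigma> + \<epsilon> *\<^sub>R mat 1)" for t
    by (intro pd_add_scaleR_one psd_add psd_scaleR psdM psd_outer \<Sigma> \<epsilon> \<beta>)
  have VW: "loewner_le (V t) (W (Suc t))" if "t < T" for t
    unfolding V_def W_def
  proof (rule precond_mono[OF pdV])
    have "0 \<le> (\<Sum>i<T. \<beta> ^ i) - (\<Sum>i<Suc t. \<beta> ^ i)"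
      using that \<beta> by (simp add: sum_mono2 Suc_le_eq del: sum.lessThan_Suc)
    from psd_scaleR[OF \<Sigma> this] have le: "loewner_le ((\<Sum>i<Suc t. \<beta> ^ i) *\<^sub>R \<Sigma>) ((\<Sum>i<T. \<beta> ^ i) *\<^sub>R \<Sigma>)"
      by (simp add: loewner_le_def scaleR_diff_left)
    have "loewner_le (\<beta> *\<^sub>R M t + (outer (a t) (a t) + \<Sigma>)) (N (Suc t) + (\<Sum>i<Suc t. \<beta> ^ i) *\<^sub>R \<Sigma>)"
      unfolding N using that by (intro step MN loewner_le_refl) auto
    then have "loewner_le (\<beta> *\<^sub>R M t + (outer (a t) (a t) + \<Sigma>)) (N (Suc t) + (\<Sum>i<T. \<beta> ^ i) *\<^sub>R \<Sigma>)"
      by (rule loewner_le_trans) (rule loewner_le_add[OF loewner_le_refl le])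
    from loewner_le_add[OF this loewner_le_refl[of "\<epsilon> *\<^sub>R mat 1"]]
    show "loewner_le (\<beta> *\<^sub>R M t + outer (a t) (a t) + \<Sigma> + \<epsilon> *\<^sub>R mat 1) (N (Suc t) + Q)"
      by (simp add: Q_def add.assoc)
  qed
  \<comment> \<open>The index is \<open>Suc t\<close> because \<open>N (Suc t)\<close> is the first
    accumulated matrix to contain a_t, as V_t does.\<close>
  define e where "e t = a t \<bullet> (matrix_inv (W (Suc t)) *v a t)" for t
  define w where "w t = trace (W (Suc t))" for t
  have e: "0 \<le> e t" for t
    unfolding e_def by (intro psd_nonneg pd_imp_psd pd_inv W)
  have w: "0 \<le> w t" for t
    unfolding w_def by (intro psd_trace_nonneg pd_imp_psd W)
  have "a t \<bullet> (matrix_inv (W (Suc t)) *v a t) \<le> a t \<bullet> (matrix_inv (V t) *v a t)" if "t < T" for t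
    using precond[OF pdV] by (intro loewner_leD pd_inv_antimono VW that) (simp add: V_def)
  then have eE: "sum e {..<T} \<le> E"
    unfolding E_def e_def by (intro sum_mono) auto
  have R: "R = trace (precond psd_L Q)" by (simp add: R_def Q_def)
  have R0: "0 \<le> R" unfolding R by (intro psd_trace_nonneg pd_imp_psd pd_precond Q)
  let ?b = "\<Sum>i<T. sqrt \<beta> ^ i"
  have b: "0 \<le> ?b" using \<beta> by (intro sum_nonneg) simp
  have "(\<Sum>t<T. trace (W (Suc t)) - R) \<le> ?b * sum e {..<T}"
  proof (rule sum_recursion_le[where u = "\<lambda>t. trace (W t) - R"])
    show "trace (W 0) - R \<le> 0" by (simp add: W_def N R)
    show "trace (W (Suc t)) - R \<le> sqrt \<beta> * (trace (W t) - R) + e t" for t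
      unfolding R e_def W_def[of t]
      by (rule trace_precond_step[OF psdN Q \<beta>]) (simp add: W_def N)
  qed (use e \<beta> in auto)
  then have wE: "sum w {..<T} \<le> real T * R + ?b * sum e {..<T}"
    by (simp add: w_def sum_subtractf)
  have E0: "0 \<le> sum e {..<T}" by (intro sum_nonneg e)
  have "(\<Sum>t<T. dual_norm psd_L (a t)) \<le> (\<Sum>t<T. \<bar>sqrt (w t)\<bar> * \<bar>sqrt (e t)\<bar>)"
    using w e by (intro sum_mono) (simp add: w_def e_def dual_norm_le W)
  also have "\<dots> \<le> L2_set (\<lambda>t. sqrt (w t)) {..<T} * L2_set (\<lambda>t. sqrt (e t)) {..<T}"
    by (rule L2_set_mult_ineq)
  also have "\<dots> = sqrt (sum w {..<T} * sum e {..<T})"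
    using w e by (simp add: L2_set_def real_sqrt_mult)
  also have "\<dots> \<le> sqrt ((real T * R + ?b * E) * E)"
    using wE eE E0 b R0 w
    by (intro real_sqrt_le_mono mult_mono order_trans[OF wE] add_left_mono mult_left_mono)
      (auto intro!: add_nonneg_nonneg mult_nonneg_nonneg)
  also have "\<dots> \<le> sqrt (real T * R * E) + sqrt (?b * E * E)"
    using R0 b E0 eE by (simp add: distrib_right) (intro sqrt_add_le_add_sqrt mult_nonneg_nonneg; simp)
  also have "sqrt (?b * E * E) = sqrt ?b * E"
    using E0 eE by (simp add: real_sqrt_mult)
  finally show ?thesis .
qed

end


lemma psd_le_one_norm:
  assumes "psd S" "loewner_le S (mat 1)"
  shows "norm (S :: real^'n^'n) \<le> (real CARD('n))\<^sup>2"
  using sym_mat_norm_le[OF psd_sym[OF assms(1)], of 1] psd_nonneg[OF assms(1)] loewner_leD[OF assms(2)]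
  by simp

section \<open>Exchanging the preconditioner for a predictable one, and its increment\<close>

context sym_algebra
begin

text \<open>Between the squares, V^2 <= U^2 <= V^2 + 2 \<pi>(\<Sigma>), so U - V is positive
  semidefinite of norm at most sqrt (2 |\<Sigma>|). By the resolvent identity a . (V^-1 - U^-1) g =
  p . (U - V) q with p = U^-1 a and q = V^-1 g, and AM-GM separates p from q.\<close>

lemma precond_perturbation:
  assumes Q: "pd Q" and \<Sigma>: "psd \<Sigma>"
    and upper: "loewner_le (outer g g) (outer a a + \<Sigma>)"
    and lower: "loewner_le (outer a a) (outer g g + \<Sigma>)"
    and V_def: "V = precond psd_L (Q + outer g g)"
    and U_def: "U = precond psd_L (Q + outer a a + \<Sigma>)"
  shows "- (a \<bullet> (matrix_inv V *v g)) \<le> - (a \<bullet> (matrix_inv U *v g))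
      + sqrt (2 * op_norm \<Sigma>) / 2 * ((norm (matrix_inv U *v a))\<^sup>2 + (norm (matrix_inv V *v g))\<^sup>2)"
    and "(norm (matrix_inv U *v g))\<^sup>2 \<le> (norm (matrix_inv V *v g))\<^sup>2"
proof -
  define \<sigma> where "\<sigma> = op_norm \<Sigma>"
  have pd1: "pd (Q + outer g g)" "pd (Q + outer a a + \<Sigma>)"
    by (intro pd_add_psd Q psd_outer \<Sigma>)+
  have V: "V \<in> L" "pd V" "V ** V = proj_L (Q + outer g g)"
    using precond[OF pd1(1)] by (simp_all add: V_def)
  have U: "U \<in> L" "pd U" "U ** U = proj_L (Q + outer a a + \<Sigma>)"
    using precond[OF pd1(2)] by (simp_all add: U_def)
  have symV: "sym_mat (matrix_inv V)" and symU: "sym_mat (matrix_inv U)"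
    using V U pd_inv by (auto simp: pd_def)
  have le1: "loewner_le (Q + outer g g) (Q + outer a a + \<Sigma>)"
    using loewner_le_add[OF loewner_le_refl upper, of Q] by (simp add: add.assoc)
  have VU: "loewner_le V U" unfolding V_def U_def by (rule precond_mono[OF pd1(1) le1])
  have "loewner_le (proj_L \<Sigma>) (\<sigma> *\<^sub>R mat 1)"
    using proj_L_mono[OF psd_le_op_norm[OF \<Sigma>]] by (simp add: proj_L_simps \<sigma>_def)
  from loewner_le_scaleR[OF this, of 2]
  have S2: "loewner_le (2 *\<^sub>R proj_L \<Sigma>) ((2 * \<sigma>) *\<^sub>R mat 1)" by simp
  have "loewner_le (Q + outer a a + \<Sigma>) ((Q + outer g g) + 2 *\<^sub>R \<Sigma>)"
    using lower by (simp add: loewner_le_def algebra_simps scaleR_2)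
  then have "loewner_le (U ** U) (V ** V + 2 *\<^sub>R proj_L \<Sigma>)"
    using proj_L_mono unfolding U(3) V(3) by (metis linear_add[OF linear_proj_L] linear_scale[OF linear_proj_L])
  then have "loewner_le (U ** U) (V ** V + (2 * \<sigma>) *\<^sub>R mat 1)"
    by (rule loewner_le_trans) (rule loewner_le_add[OF loewner_le_refl S2])
  then have "loewner_le U (V + sqrt (2 * \<sigma>) *\<^sub>R mat 1)"
    using op_norm_nonneg[of \<Sigma>]
    by (intro sqrt_diff_le sym_L U pd_imp_psd V) (simp_all add: \<sigma>_def)
  then have "x \<bullet> ((U - V) *v x) \<le> sqrt (2 * \<sigma>) * (x \<bullet> x)" for x
    using loewner_leD[of U "V + sqrt (2 * \<sigma>) *\<^sub>R mat 1" x]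
    by (simp add: matrix_vector_mult_diff_rdistrib matrix_vector_mult_add_rdistrib inner_diff_right
        inner_add_right flip: scaleR_matrix_vector_assoc)
  then have nD: "norm ((U - V) *v x) \<le> sqrt (2 * \<sigma>) * norm x" for x
    using VU by (intro psd_norm_le) (simp_all add: loewner_le_def)
  let ?p = "matrix_inv U *v a" and ?q = "matrix_inv V *v g"
  have "matrix_inv U ** (U - V) ** matrix_inv V = matrix_inv V - matrix_inv U"
    using pd_invertible[OF U(2)] pd_invertible[OF V(2)]
    by (simp add: matrix_mult_linear_simps) (simp add: matrix_mul_assoc[symmetric])
  then have "a \<bullet> (matrix_inv V *v g) - a \<bullet> (matrix_inv U *v g)
      = a \<bullet> ((matrix_inv U ** (U - V) ** matrix_inv V) *v g)"
    by (simp add: matrix_vector_mult_diff_rdistrib inner_diff_right)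
  also have "\<dots> = ?p \<bullet> ((U - V) *v ?q)"
    by (simp add: sym_mat_inner[OF symU] flip: matrix_vector_mul_assoc)
  also have "- \<dots> \<le> norm ?p * norm ((U - V) *v ?q)"
    using Cauchy_Schwarz_ineq2[of ?p "(U - V) *v ?q"] by linarith
  also have "\<dots> \<le> norm ?p * (sqrt (2 * \<sigma>) * norm ?q)" by (intro mult_left_mono nD) simp
  also have "\<dots> = sqrt (2 * \<sigma>) / 2 * (2 * norm ?p * norm ?q)" by simp
  also have "\<dots> \<le> sqrt (2 * \<sigma>) / 2 * ((norm ?p)\<^sup>2 + (norm ?q)\<^sup>2)"
    using op_norm_nonneg[of \<Sigma>] by (intro mult_left_mono sum_squares_bound) (simp add: \<sigma>_def)
  finally show "- (a \<bullet> (matrix_inv V *v g)) \<le> - (a \<bullet> (matrix_inv U *v g))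
      + sqrt (2 * op_norm \<Sigma>) / 2 * ((norm ?p)\<^sup>2 + (norm ?q)\<^sup>2)"
    unfolding \<sigma>_def by linarith
  have sq: "(norm (matrix_inv A *v x))\<^sup>2 = x \<bullet> (matrix_inv (A ** A) *v x)" if "pd A" for A :: "real^'n^'n" and x
  proof -
    have "sym_mat (matrix_inv A)" using pd_inv[OF that] by (simp add: pd_def)
    then show ?thesis
      by (simp add: pd_square(2)[OF that] power2_norm_eq_inner sym_mat_inner flip: matrix_vector_mul_assoc)
  qed
  \<comment> \<open>Read off from the projections: squaring is not operator monotone, so V <= U
    alone would not give it.\<close>
  have "loewner_le (V ** V) (U ** U)" unfolding V(3) U(3) by (rule proj_L_mono[OF le1])
  then show "(norm (matrix_inv U *v g))\<^sup>2 \<le> (norm (matrix_inv V *v g))\<^sup>2"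
    unfolding sq[OF U(2)] sq[OF V(2)]
    by (intro loewner_leD pd_inv_antimono pd_square V)
qed

text \<open>V^2 - \<beta> V'^2 equals \<pi>(g g^T) plus the semidefinite remainder (1 - \<beta>)
  \<epsilon> I. For H in \<open>L\<close> the congruence V^-1 H V^-1 stays in \<open>L\<close>, so
  it does not distinguish \<pi>(g g^T) from g g^T: the second-order term of the descent step is
  thereby dominated by S. The bound by I holds because S is I minus a semidefinite matrix.\<close>

lemma preconditioned_increment:
  assumes M: "psd M" and \<epsilon>: "0 < \<epsilon>" and \<beta>: "0 \<le> \<beta>" "\<beta> \<le> 1"
    and V_def: "V = precond psd_L (\<beta> *\<^sub>R M + outer g g + \<epsilon> *\<^sub>R mat 1)"
    and V': "sym_mat V'" "V' ** V' = proj_L (M + \<epsilon> *\<^sub>R mat 1)"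
    and S_def: "S = matrix_inv V ** (V ** V - \<beta> *\<^sub>R (V' ** V')) ** matrix_inv V"
  shows "\<And>H. H \<in> psd_L \<Longrightarrow> (matrix_inv V *v g) \<bullet> (H *v (matrix_inv V *v g)) \<le> H \<bullet> S"
    and "(norm (matrix_inv V *v g))\<^sup>2 \<le> trace S"
    and "psd S" and "loewner_le S (mat 1)"
proof -
  have pdV: "pd (\<beta> *\<^sub>R M + outer g g + \<epsilon> *\<^sub>R mat 1)"
    by (intro pd_add_scaleR_one psd_add psd_scaleR M psd_outer \<epsilon> \<beta>)
  have V: "V \<in> L" "pd V" "V ** V = proj_L (\<beta> *\<^sub>R M + outer g g + \<epsilon> *\<^sub>R mat 1)"
    using precond[OF pdV] by (simp_all add: V_def)
  have symV: "sym_mat (matrix_inv V)" using pd_inv[OF V(2)] by (simp add: pd_def)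
  note inv = pd_invertible[OF V(2)]
  define D where "D = V ** V - \<beta> *\<^sub>R (V' ** V')"
  have D: "D = proj_L (outer g g) + ((1 - \<beta>) * \<epsilon>) *\<^sub>R mat 1"
    by (simp add: D_def V(3) V'(2) proj_L_simps algebra_simps)
  have c: "0 \<le> (1 - \<beta>) * \<epsilon>" using \<beta> \<epsilon> by simp
  have Dg: "loewner_le (proj_L (outer g g)) D"
    by (simp add: D loewner_le_def psd_scaleR psd_one c)
  have psdD: "psd D"
    unfolding D by (intro psd_add psd_proj_L psd_outer psd_scaleR psd_one c)
  show le: "(matrix_inv V *v g) \<bullet> (H *v (matrix_inv V *v g)) \<le> H \<bullet> S" if H: "H \<in> psd_L" for H
  proof -
    define X where "X = matrix_inv V ** H ** matrix_inv V"
    have X: "X \<in> L" "psd X"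
      using H by (auto simp: X_def intro!: congruence_L inv_L V psd_congruence symV)
    have "(matrix_inv V *v g) \<bullet> (H *v (matrix_inv V *v g)) = X \<bullet> outer g g"
      by (simp add: X_def inner_outer sym_mat_inner[OF symV] flip: matrix_vector_mul_assoc)
    also have "\<dots> = X \<bullet> proj_L (outer g g)" using proj_L(2)[OF X(1)] by (simp add: inner_commute)
    also have "\<dots> \<le> X \<bullet> D" by (rule inner_mono_loewner[OF X(2) Dg])
    also have "\<dots> = H \<bullet> S"
      using symV by (simp add: X_def S_def D_def[symmetric] inner_matrix_mult_right[of "matrix_inv V ** H"]
          inner_matrix_mult_left[of "matrix_inv V" H] sym_mat_def matrix_mul_assoc)
    finally show ?thesis .
  qed
  show "(norm (matrix_inv V *v g))\<^sup>2 \<le> trace S"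
    using le[of "mat 1"] by (simp add: one_L psd_one power2_norm_eq_inner trace_eq_inner)
  show "psd S" unfolding S_def D_def[symmetric] by (intro psd_congruence symV psdD)
  have "S = mat 1 - \<beta> *\<^sub>R (matrix_inv V ** (V' ** V') ** matrix_inv V)"
    using inv by (simp add: S_def matrix_mult_linear_simps) (simp add: matrix_mul_assoc)
  moreover have "psd (\<beta> *\<^sub>R (matrix_inv V ** (V' ** V') ** matrix_inv V))"
    by (intro psd_scaleR psd_congruence symV psd_square V'(1) \<beta>)
  ultimately show "loewner_le S (mat 1)" by (simp add: loewner_le_def)
qed

end

subsection \<open>Smoothness and descent\<close>

lemma has_derivative_grad:
  fixes f :: "real^'n \<Rightarrow> real"
  assumes "f differentiable (at x)"
  shows "(f has_derivative (\<lambda>h. grad f x \<bullet> h)) (at x)"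
proof -
  let ?D = "frechet_derivative f (at x)"
  have D: "(f has_derivative ?D) (at x)" using assms by (simp add: frechet_derivative_works[symmetric])
  then have lin: "linear ?D" by (rule has_derivative_linear)
  have "?D h = grad f x \<bullet> h" for h
  proof -
    have "?D h = ?D (\<Sum>i\<in>UNIV. h $ i *\<^sub>R axis i 1)"
      using basis_expansion[of h] by (simp add: scalar_mult_eq_scaleR)
    also have "\<dots> = (\<Sum>i\<in>UNIV. h $ i * ?D (axis i 1))"
      by (simp add: linear_sum[OF lin] linear_scale[OF lin])
    finally show ?thesis by (simp add: grad_def inner_vec_def mult.commute)
  qed
  then have "?D = (\<lambda>h. grad f x \<bullet> h)" by (rule ext)
  with D show ?thesis by simp
qed

text \<open>Monotonicity is used twice along the segment: the Hessian bound makes the directional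
  derivative \<phi> grow at most linearly, and then f minus the comparison parabola is
  nonincreasing.\<close>

lemma descent_inequality:
  fixes f :: "real^'n \<Rightarrow> real"
  assumes f: "\<forall>x. f differentiable (at x)" and g: "\<forall>x. grad f differentiable (at x)"
    and H: "\<And>x. loewner_le (hess f x) H"
  shows "f (x + v) \<le> f x + grad f x \<bullet> v + (v \<bullet> (H *v v)) / 2"
proof -
  define c where "c = v \<bullet> (H *v v)"
  define \<phi> where "\<phi> t = grad f (x + t *\<^sub>R v) \<bullet> v" for t
  have d1: "((\<lambda>t. f (x + t *\<^sub>R v)) has_real_derivative \<phi> t) (at t)" for t
  proof -
    have "((\<lambda>t. f (x + t *\<^sub>R v)) has_derivative (\<lambda>s. grad f (x + t *\<^sub>R v) \<bullet> (s *\<^sub>R v))) (at t)"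
      by (rule has_derivative_compose[OF _ has_derivative_grad]) (use f in \<open>auto intro!: derivative_eq_intros\<close>)
    then show ?thesis
      unfolding has_field_derivative_def \<phi>_def by (simp add: mult_commute_abs)
  qed
  have d2: "(\<phi> has_real_derivative (v \<bullet> (hess f (x + t *\<^sub>R v) *v v))) (at t)" for t
  proof -
    have G: "(grad f has_derivative (\<lambda>h. hess f y *v h)) (at y)" for y
    proof -
      have "(grad f has_derivative frechet_derivative (grad f) (at y)) (at y)"
        using g frechet_derivative_works by blast
      then show ?thesis
        unfolding hess_def by (simp add: matrix_works has_derivative_linear matrix_vector_mul)
    qed
    have "((\<lambda>t. grad f (x + t *\<^sub>R v)) has_derivative (\<lambda>s. hess f (x + t *\<^sub>R v) *v (s *\<^sub>R v))) (at t)"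
      by (rule has_derivative_compose[OF _ G]) (auto intro!: derivative_eq_intros)
    from has_derivative_inner_left[OF this, of v]
    show ?thesis
      unfolding has_field_derivative_def \<phi>_def
      by (simp add: matrix_vector_mult_scaleR inner_commute mult_commute_abs)
  qed
  have \<phi>: "\<phi> t \<le> \<phi> 0 + c * t" if "0 \<le> t" for t
  proof -
    have "\<phi> t - c * t \<le> \<phi> 0 - c * 0"
      using that
    proof (rule DERIV_nonpos_imp_nonincreasing)
      fix s
      have "((\<lambda>t. \<phi> t - c * t) has_real_derivative (v \<bullet> (hess f (x + s *\<^sub>R v) *v v) - c)) (at s)"
        by (auto intro!: derivative_eq_intros d2)
      moreover have "v \<bullet> (hess f (x + s *\<^sub>R v) *v v) - c \<le> 0"
        using loewner_leD[OF H, of v] by (simp add: c_def)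
      ultimately show "\<exists>y. ((\<lambda>t. \<phi> t - c * t) has_real_derivative y) (at s) \<and> y \<le> 0" by blast
    qed
    then show ?thesis by simp
  qed
  define \<psi> where "\<psi> t = f (x + t *\<^sub>R v) - \<phi> 0 * t - c / 2 * t\<^sup>2" for t
  have "\<psi> 1 \<le> \<psi> 0"
  proof (rule DERIV_nonpos_imp_nonincreasing[of 0 1 \<psi>])
    fix s :: real assume "0 \<le> s"
    have "(\<psi> has_real_derivative (\<phi> s - \<phi> 0 - c * s)) (at s)"
      unfolding \<psi>_def by (auto intro!: derivative_eq_intros d1)
    moreover have "\<phi> s - \<phi> 0 - c * s \<le> 0" using \<phi>[OF \<open>0 \<le> s\<close>] by simp
    ultimately show "\<exists>y. (\<psi> has_real_derivative y) (at s) \<and> y \<le> 0"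
      by blast
  qed simp
  then show ?thesis by (simp add: \<psi>_def \<phi>_def c_def)
qed


subsection \<open>Measurability\<close>

lemma borel_measurable_matrix_mult [measurable (raw)]:
  fixes f g :: "'a \<Rightarrow> real^'n^'n"
  assumes "f \<in> borel_measurable A" "g \<in> borel_measurable A"
  shows "(\<lambda>\<omega>. f \<omega> ** g \<omega>) \<in> borel_measurable A"
  by (rule borel_measurable_continuous_Pair[OF assms, where H = "(**)"]) (intro continuous_intros)

lemma borel_measurable_matrix_vector [measurable (raw)]:
  fixes f :: "'a \<Rightarrow> real^'n^'n"
  assumes "f \<in> borel_measurable A" "g \<in> borel_measurable A"
  shows "(\<lambda>\<omega>. f \<omega> *v g \<omega>) \<in> borel_measurable A"
  by (rule borel_measurable_continuous_Pair[OF assms, where H = "(*v)"]) (intro continuous_intros)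

lemma borel_measurable_outer [measurable (raw)]:
  fixes f g :: "'a \<Rightarrow> real^'n"
  assumes "f \<in> borel_measurable A" "g \<in> borel_measurable A"
  shows "(\<lambda>\<omega>. outer (f \<omega>) (g \<omega>)) \<in> borel_measurable A"
  by (rule borel_measurable_continuous_Pair[OF assms, where H = outer])
    (intro bounded_bilinear.continuous_on[OF bounded_bilinear_outer] continuous_intros)

text \<open>Continuity of \<open>precond\<close> and \<open>matrix_inv\<close> is available only
  above a positive multiple of I, so composition goes through the restricted Borel space.\<close>

lemma borel_measurable_continuous_on_compose:
  assumes "continuous_on S f" "m \<in> borel_measurable A" "\<And>\<omega>. \<omega> \<in> space A \<Longrightarrow> m \<omega> \<in> S"
  shows "(\<lambda>\<omega>. f (m \<omega>)) \<in> borel_measurable A"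
proof -
  have "m \<in> A \<rightarrow>\<^sub>M restrict_space borel S"
    using assms(2,3) by (intro measurable_restrict_space2) auto
  from measurable_compose[OF this borel_measurable_continuous_on_restrict[OF assms(1)]] show ?thesis .
qed

lemma borel_measurable_matrix_inv:
  assumes "0 < \<kappa>" "m \<in> borel_measurable A"
    and "\<And>\<omega>. \<omega> \<in> space A \<Longrightarrow> loewner_le (\<kappa> *\<^sub>R mat 1) (m \<omega> :: real^'n^'n)"
  shows "(\<lambda>\<omega>. matrix_inv (m \<omega>)) \<in> borel_measurable A"
  by (rule borel_measurable_continuous_on_compose[OF continuous_on_matrix_inv[OF assms(1)] assms(2)])
    (use assms(3) in simp)

lemma (in sym_algebra) borel_measurable_precond:
  assumes "0 < \<epsilon>" "m \<in> borel_measurable A"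
    and "\<And>\<omega>. \<omega> \<in> space A \<Longrightarrow> loewner_le (\<epsilon> *\<^sub>R mat 1) (m \<omega>)"
  shows "(\<lambda>\<omega>. precond psd_L (m \<omega>)) \<in> borel_measurable A"
    and "(\<lambda>\<omega>. matrix_inv (precond psd_L (m \<omega>))) \<in> borel_measurable A"
proof -
  show *: "(\<lambda>\<omega>. precond psd_L (m \<omega>)) \<in> borel_measurable A"
    by (rule borel_measurable_continuous_on_compose[OF continuous_on_precond[OF assms(1)] assms(2)])
      (use assms(3) in simp)
  show "(\<lambda>\<omega>. matrix_inv (precond psd_L (m \<omega>))) \<in> borel_measurable A"
    using assms(1)
    by (intro borel_measurable_matrix_inv[OF _ *, of "sqrt \<epsilon>"] precond_scaleR_one_le[OF assms(1,3)]) auto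
qed

lemma closed_psd: "closed {A :: real^'n^'n. psd A}"
proof -
  have "closed {A :: real^'n^'n. 0 \<le> x \<bullet> (A *v x)}" for x
    by (intro closed_Collect_le continuous_intros)
  then have "closed (\<Inter>x. {A :: real^'n^'n. 0 \<le> x \<bullet> (A *v x)})" by blast
  moreover have "closed {A :: real^'n^'n. sym_mat A}"
    using closed_subspace[OF all_sym.subspace_L] by simp
  moreover have "{A :: real^'n^'n. psd A} = {A. sym_mat A} \<inter> (\<Inter>x. {A. 0 \<le> x \<bullet> (A *v x)})"
    by (auto simp: psd_def)
  ultimately show ?thesis by auto
qed

lemma pred_loewner_le [measurable (raw)]:
  fixes f g :: "'a \<Rightarrow> real^'n^'n"
  assumes [measurable]: "f \<in> borel_measurable A" "g \<in> borel_measurable A"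
  shows "Measurable.pred A (\<lambda>\<omega>. loewner_le (f \<omega>) (g \<omega>))"
  unfolding loewner_le_def
  by (rule measurable_compose[of "\<lambda>\<omega>. g \<omega> - f \<omega>" A borel])
    (measurable, simp add: pred_def borel_closed closed_psd)

text \<open>The evaluation \<open>(\<phi>, x) \<mapsto> \<phi> x\<close> is not measurable for the product \<open>\<sigma>\<close>-algebra on functions, but
  evaluation at a point of the grid of mesh \<open>1 / (n + 1)\<close> below \<open>x\<close> is. Limits of the latter give a
  jointly measurable substitute for the gradient which agrees with it on differentiable functions.\<close>

definition grid_floor :: "nat \<Rightarrow> real^'n \<Rightarrow> real^'n" where
  "grid_floor n x = (\<chi> i. of_int \<lfloor>real (Suc n) * x $ i\<rfloor> / real (Suc n))"

definition eval_lim :: "(real^'n \<Rightarrow> real) \<Rightarrow> real^'n \<Rightarrow> real" where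
  "eval_lim \<phi> x = lim (\<lambda>n. \<phi> (grid_floor n x))"

definition grad_lim :: "(real^'n \<Rightarrow> real) \<Rightarrow> real^'n \<Rightarrow> real^'n" where
  "grad_lim \<phi> x = (\<chi> i. lim (\<lambda>m. (eval_lim \<phi> (x + (1 / real (Suc m)) *\<^sub>R axis i 1) - eval_lim \<phi> x)
     / (1 / real (Suc m))))"

abbreviation fun_space :: "(real^'n \<Rightarrow> real) measure" where
  "fun_space \<equiv> \<Pi>\<^sub>M x\<in>UNIV. (borel :: real measure)"

lemma grid_floor_LIMSEQ: "(\<lambda>n. grid_floor n x) \<longlonglongrightarrow> x"
proof (rule vec_tendstoI)
  fix i
  have bound: "norm (of_int \<lfloor>real (Suc n) * x $ i\<rfloor> / real (Suc n) - x $ i) \<le> 1 / real (Suc n)" for n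
  proof -
    have "\<bar>of_int \<lfloor>real (Suc n) * x $ i\<rfloor> - real (Suc n) * x $ i\<bar> \<le> 1" by linarith
    then have "\<bar>of_int \<lfloor>real (Suc n) * x $ i\<rfloor> - real (Suc n) * x $ i\<bar> / real (Suc n) \<le> 1 / real (Suc n)"
      by (rule divide_right_mono) simp
    also have "\<bar>of_int \<lfloor>real (Suc n) * x $ i\<rfloor> - real (Suc n) * x $ i\<bar> / real (Suc n)
        = \<bar>(of_int \<lfloor>real (Suc n) * x $ i\<rfloor> - real (Suc n) * x $ i) / real (Suc n)\<bar>"
      by simp
    also have "(of_int \<lfloor>real (Suc n) * x $ i\<rfloor> - real (Suc n) * x $ i) / real (Suc n)
        = of_int \<lfloor>real (Suc n) * x $ i\<rfloor> / real (Suc n) - x $ i"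
      by (simp add: diff_divide_distrib del: of_nat_Suc)
    finally show ?thesis by (simp only: real_norm_def)
  qed
  have "(\<lambda>n. 1 / real (Suc n)) \<longlonglongrightarrow> 0"
    using LIMSEQ_inverse_real_of_nat by (simp add: inverse_eq_divide)
  then have "(\<lambda>n. of_int \<lfloor>real (Suc n) * x $ i\<rfloor> / real (Suc n) - x $ i) \<longlonglongrightarrow> 0"
    by (rule Lim_null_comparison[OF always_eventually[OF allI[OF bound]]])
  then have "(\<lambda>n. of_int \<lfloor>real (Suc n) * x $ i\<rfloor> / real (Suc n)) \<longlonglongrightarrow> x $ i"
    by (rule LIM_zero_cancel)
  then show "(\<lambda>n. grid_floor n x $ i) \<longlonglongrightarrow> x $ i"
    by (simp add: grid_floor_def del: of_nat_Suc)
qed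

lemma eval_lim_eq:
  assumes "isCont \<phi> x"
  shows "eval_lim \<phi> x = \<phi> x"
  unfolding eval_lim_def by (intro limI isCont_tendsto_compose[OF assms] grid_floor_LIMSEQ)

lemma grad_lim_eq:
  assumes "\<forall>x. \<phi> differentiable (at x)"
  shows "grad_lim \<phi> x = grad \<phi> x"
proof -
  have "isCont \<phi> y" for y using assms by (simp add: differentiable_imp_continuous_within)
  then have ev: "eval_lim \<phi> y = \<phi> y" for y by (rule eval_lim_eq)
  have "(\<lambda>m. (\<phi> (x + (1 / real (Suc m)) *\<^sub>R axis i 1) - \<phi> x) / (1 / real (Suc m))) \<longlonglongrightarrow> grad \<phi> x $ i" for i
  proof -
    let ?h = "\<lambda>t. \<phi> (x + t *\<^sub>R axis i 1)"
    have D: "(\<phi> has_derivative (\<lambda>h. grad \<phi> x \<bullet> h)) (at (x + 0 *\<^sub>R axis i 1))"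
      using has_derivative_grad[of \<phi> x] assms by simp
    have "(?h has_derivative (\<lambda>s. grad \<phi> x \<bullet> (s *\<^sub>R axis i 1))) (at 0)"
      by (rule has_derivative_compose[where f = "\<lambda>t. x + t *\<^sub>R axis i 1" and x = 0, OF _ D])
        (auto intro!: derivative_eq_intros)
    then have "(?h has_real_derivative grad \<phi> x $ i) (at 0)"
      unfolding has_field_derivative_def by (simp add: inner_axis mult_commute_abs)
    then have "(\<lambda>t. (?h t - ?h 0) / t) \<midarrow>0\<rightarrow> grad \<phi> x $ i"
      by (simp add: DERIV_def)
    moreover have "filterlim (\<lambda>m. 1 / real (Suc m)) (at 0) sequentially"
      using LIMSEQ_inverse_real_of_nat by (auto simp: filterlim_at inverse_eq_divide)
    ultimately show ?thesis
      by (auto dest: filterlim_compose)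
  qed
  then show ?thesis
    by (simp add: grad_lim_def ev vec_eq_iff limI)
qed

lemma borel_measurable_vec_lambda:
  assumes "\<And>i. (\<lambda>\<omega>. f \<omega> i) \<in> borel_measurable A"
  shows "(\<lambda>\<omega>. \<chi> i. f \<omega> i :: real^'n) \<in> borel_measurable A"
  using assms by (subst borel_measurable_euclidean_space) (auto simp: Basis_vec_def inner_axis)

lemma borel_measurable_vec_nth [measurable (raw)]:
  "f \<in> borel_measurable A \<Longrightarrow> (\<lambda>\<omega>. (f \<omega> :: real^'n) $ i) \<in> borel_measurable A"
  by (rule borel_measurable_continuous_on[OF continuous_on_component]) (auto intro!: continuous_intros)

lemma measurable_eval_lim:
  assumes \<Phi> [measurable]: "\<Phi> \<in> A \<rightarrow>\<^sub>M fun_space" and x [measurable]: "x \<in> borel_measurable A"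
  shows "(\<lambda>\<omega>. eval_lim (\<Phi> \<omega>) (x \<omega> :: real^'n)) \<in> borel_measurable A"
  unfolding eval_lim_def
proof (rule borel_measurable_lim_metric)
  fix n
  \<comment> \<open>k names the grid point by an integer vector. It takes countably many values, and
    for each of them the evaluation is a coordinate of the product space.\<close>
  define k where "k \<omega> = (\<chi> i. \<lfloor>real (Suc n) * x \<omega> $ i\<rfloor> :: int^'n)" for \<omega>
  have "k \<in> A \<rightarrow>\<^sub>M count_space UNIV"
  proof (subst measurable_count_space_eq2_countable, safe)
    fix z :: "int^'n"
    have "k -` {z} \<inter> space A = {\<omega> \<in> space A. \<forall>i. \<lfloor>real (Suc n) * x \<omega> $ i\<rfloor> = z $ i}"
      by (auto simp: k_def vec_eq_iff)
    also have "\<dots> \<in> sets A" by measurable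
    finally show "k -` {z} \<inter> space A \<in> sets A" .
  qed auto
  moreover have "(\<lambda>\<omega>. \<Phi> \<omega> (\<chi> i. of_int (z $ i) / real (Suc n))) \<in> borel_measurable A" for z :: "int^'n"
    using measurable_compose[OF \<Phi> measurable_component_singleton] by simp
  ultimately have "(\<lambda>\<omega>. \<Phi> \<omega> (\<chi> i. of_int (k \<omega> $ i) / real (Suc n))) \<in> borel_measurable A"
    by (rule measurable_compose_countable[rotated])
  then show "(\<lambda>\<omega>. \<Phi> \<omega> (grid_floor n (x \<omega>))) \<in> borel_measurable A"
    by (simp add: grid_floor_def k_def)
qed

lemma measurable_grad_lim:
  assumes [measurable]: "\<Phi> \<in> A \<rightarrow>\<^sub>M fun_space" "x \<in> borel_measurable A"
  shows "(\<lambda>\<omega>. grad_lim (\<Phi> \<omega>) (x \<omega>)) \<in> borel_measurable A"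
proof -
  have [measurable]: "(\<lambda>\<omega>. eval_lim (\<Phi> \<omega>) (x \<omega> + c)) \<in> borel_measurable A" for c
    by (rule measurable_eval_lim) measurable
  have [measurable]: "(\<lambda>\<omega>. eval_lim (\<Phi> \<omega>) (x \<omega>)) \<in> borel_measurable A"
    by (rule measurable_eval_lim) measurable
  show ?thesis
    unfolding grad_lim_def by (intro borel_measurable_vec_lambda borel_measurable_lim_metric) measurable
qed

section \<open>Freezing one of two independent variables\<close>

context prob_space
begin

text \<open>The exceptional null set may depend on x. As the joint law is a product, Fubini merges
  these null sets into one for the random point X.\<close>

lemma indep_var_AE:
  assumes indep: "indep_var S X N Y"
    and P [measurable]: "Measurable.pred (S \<Otimes>\<^sub>M N) (\<lambda>p. P (fst p) (snd p))"
    and AE: "\<And>x. x \<in> space S \<Longrightarrow> AE \<omega> in M. P x (Y \<omega>)"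
  shows "AE \<omega> in M. P (X \<omega>) (Y \<omega>)"
proof -
  have X [measurable]: "X \<in> M \<rightarrow>\<^sub>M S" and Y [measurable]: "Y \<in> M \<rightarrow>\<^sub>M N"
    and D: "distr M S X \<Otimes>\<^sub>M distr M N Y = distr M (S \<Otimes>\<^sub>M N) (\<lambda>\<omega>. (X \<omega>, Y \<omega>))"
    using indep by (auto simp: indep_var_distribution_eq)
  interpret D1: prob_space "distr M S X" by (rule prob_space_distr[OF X])
  interpret D2: prob_space "distr M N Y" by (rule prob_space_distr[OF Y])
  interpret pair_sigma_finite "distr M S X" "distr M N Y" ..
  have "AE p in distr M S X \<Otimes>\<^sub>M distr M N Y. P (fst p) (snd p)"
  proof (rule AE_pair_measure)
    show "{p \<in> space (distr M S X \<Otimes>\<^sub>M distr M N Y). P (fst p) (snd p)} \<in> sets (distr M S X \<Otimes>\<^sub>M distr M N Y)"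
      using P by (simp add: pred_def space_pair_measure cong: sets_pair_measure_cong)
    have "AE y in distr M N Y. P x y" if "x \<in> space S" for x
    proof -
      have "Measurable.pred N (\<lambda>y. P x y)"
        using measurable_compose[OF measurable_Pair1'[OF that] P] by simp
      then show ?thesis using AE[OF that] by (subst AE_distr_iff[OF Y]) (auto simp: pred_def)
    qed
    then show "AE x in distr M S X. AE y in distr M N Y. P (fst (x, y)) (snd (x, y))"
      by (intro AE_I2[where M = "distr M S X"]) simp
  qed
  then show ?thesis
    unfolding D using P by (subst (asm) AE_distr_iff) (auto simp: pred_def)
qed

text \<open>Takes the place of conditioning on X: under the product law, Y is integrated out first
  with X held fixed.\<close>

lemma indep_var_integral:
  fixes h :: "'b \<Rightarrow> 'b \<Rightarrow> real"
  assumes indep: "indep_var S X N Y"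
    and h [measurable]: "(\<lambda>p. h (fst p) (snd p)) \<in> borel_measurable (S \<Otimes>\<^sub>M N)"
    and int: "integrable M (\<lambda>\<omega>. h (X \<omega>) (Y \<omega>))"
    and k: "\<And>x. x \<in> space S \<Longrightarrow> (\<integral>\<omega>. h x (Y \<omega>) \<partial>M) = k x"
  shows "(\<integral>\<omega>. h (X \<omega>) (Y \<omega>) \<partial>M) = (\<integral>\<omega>. k (X \<omega>) \<partial>M)"
proof -
  have X [measurable]: "X \<in> M \<rightarrow>\<^sub>M S" and Y [measurable]: "Y \<in> M \<rightarrow>\<^sub>M N"
    and D: "distr M S X \<Otimes>\<^sub>M distr M N Y = distr M (S \<Otimes>\<^sub>M N) (\<lambda>\<omega>. (X \<omega>, Y \<omega>))"
    using indep by (auto simp: indep_var_distribution_eq)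
  interpret D1: prob_space "distr M S X" by (rule prob_space_distr[OF X])
  interpret D2: prob_space "distr M N Y" by (rule prob_space_distr[OF Y])
  interpret pair_sigma_finite "distr M S X" "distr M N Y" ..
  have inner: "(\<integral>y. h x y \<partial>distr M N Y) = k x" if "x \<in> space S" for x
  proof -
    have "(\<lambda>y. h x y) \<in> borel_measurable N"
      using measurable_compose[OF measurable_Pair1'[OF that] h] by simp
    then show ?thesis using k[OF that] by (subst integral_distr[OF Y]) auto
  qed
  have "(\<integral>\<omega>. h (X \<omega>) (Y \<omega>) \<partial>M) = (\<integral>p. h (fst p) (snd p) \<partial>(distr M S X \<Otimes>\<^sub>M distr M N Y))"
    unfolding D by (subst integral_distr) auto
  also have "\<dots> = (\<integral>x. (\<integral>y. h x y \<partial>distr M N Y) \<partial>distr M S X)"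
  proof -
    have "integrable (distr M S X \<Otimes>\<^sub>M distr M N Y) (\<lambda>p. h (fst p) (snd p))"
      unfolding D using int by (subst integrable_distr_eq) auto
    from integral_fst'[OF this] show ?thesis by simp
  qed
  also have "\<dots> = (\<integral>\<omega>. (\<integral>y. h (X \<omega>) y \<partial>distr M N Y) \<partial>M)"
  proof (rule integral_distr[OF X])
    have "(\<lambda>p. h (fst p) (snd p)) \<in> borel_measurable (S \<Otimes>\<^sub>M distr M N Y)"
      using h by (simp cong: measurable_cong_sets sets_pair_measure_cong)
    from D2.borel_measurable_lebesgue_integral[of "\<lambda>x y. h x y"] this
    show "(\<lambda>x. \<integral>y. h x y \<partial>distr M N Y) \<in> borel_measurable S"
      by (simp add: split_beta')
  qed
  also have "\<dots> = (\<integral>\<omega>. k (X \<omega>) \<partial>M)"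
    using measurable_space[OF X] by (intro Bochner_Integration.integral_cong) (auto simp: inner)
  finally show ?thesis .
qed

end


subsection \<open>The algorithm\<close>

lemma alg_state_cong:
  assumes "\<And>s. s < t \<Longrightarrow> G s = G' s"
  shows "alg_state Hs \<epsilon> \<beta> \<eta> x0 G t = alg_state Hs \<epsilon> \<beta> \<eta> x0 G' t"
  using assms by (induction t) auto

lemma alg_state_Suc_components:
  fixes Hs :: "(real^'n^'n) set" and \<epsilon> \<beta> \<eta> x0 G
  defines "st \<equiv> alg_state Hs \<epsilon> \<beta> \<eta> x0 G"
  shows "snd (st (Suc t)) = \<beta> *\<^sub>R snd (st t) + outer (G t (fst (st t))) (G t (fst (st t)))"
    and "fst (st (Suc t)) = fst (st t) - \<eta> *\<^sub>R
      (matrix_inv (precond Hs (snd (st (Suc t)) + \<epsilon> *\<^sub>R mat 1)) *v G t (fst (st t)))"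
  by (simp_all add: st_def Let_def split_beta)

lemma psd_alg_state: "0 \<le> \<beta> \<Longrightarrow> psd (snd (alg_state Hs \<epsilon> \<beta> \<eta> x0 G t))"
  by (induction t) (simp_all add: Let_def split_beta psd_zero psd_add psd_scaleR psd_outer)

lemma scaleR_one_le_add: "psd A \<Longrightarrow> loewner_le (c *\<^sub>R mat 1) (A + c *\<^sub>R mat 1)"
  by (simp add: loewner_le_def)

text \<open>Left general in the underlying space: it is used over the probability space, and again
  over the product space of past functions with F s the s-th coordinate.\<close>

lemma (in sym_algebra) measurable_alg_state:
  assumes \<epsilon>: "0 < \<epsilon>" and \<beta>: "0 \<le> \<beta>" and F: "\<And>s. s < t \<Longrightarrow> F s \<in> A \<rightarrow>\<^sub>M fun_space"
  shows "(\<lambda>\<omega>. fst (alg_state psd_L \<epsilon> \<beta> \<eta> x0 (\<lambda>s. grad_lim (F s \<omega>)) t)) \<in> borel_measurable A"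
    and "(\<lambda>\<omega>. snd (alg_state psd_L \<epsilon> \<beta> \<eta> x0 (\<lambda>s. grad_lim (F s \<omega>)) t)) \<in> borel_measurable A"
proof -
  let ?st = "\<lambda>t \<omega>. alg_state psd_L \<epsilon> \<beta> \<eta> x0 (\<lambda>s. grad_lim (F s \<omega>)) t"
  have "(\<lambda>\<omega>. fst (?st t \<omega>)) \<in> borel_measurable A \<and> (\<lambda>\<omega>. snd (?st t \<omega>)) \<in> borel_measurable A"
    using F
  proof (induction t)
    case (Suc t)
    then have [measurable]: "(\<lambda>\<omega>. fst (?st t \<omega>)) \<in> borel_measurable A"
        "(\<lambda>\<omega>. snd (?st t \<omega>)) \<in> borel_measurable A" "F t \<in> A \<rightarrow>\<^sub>M fun_space"
      by auto
    have [measurable]: "(\<lambda>\<omega>. grad_lim (F t \<omega>) (fst (?st t \<omega>))) \<in> borel_measurable A"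
      by (rule measurable_grad_lim) measurable
    have snd [measurable]: "(\<lambda>\<omega>. snd (?st (Suc t) \<omega>)) \<in> borel_measurable A"
      unfolding alg_state_Suc_components(1) by measurable
    have [measurable]: "(\<lambda>\<omega>. matrix_inv (precond psd_L (snd (?st (Suc t) \<omega>) + \<epsilon> *\<^sub>R mat 1)))
        \<in> borel_measurable A"
      by (rule borel_measurable_precond(2)[OF \<epsilon>])
        (measurable, intro scaleR_one_le_add psd_alg_state \<beta>)
    show ?case
      unfolding alg_state_Suc_components(2) by (intro conjI snd) measurable
  qed auto
  then show "(\<lambda>\<omega>. fst (?st t \<omega>)) \<in> borel_measurable A" "(\<lambda>\<omega>. snd (?st t \<omega>)) \<in> borel_measurable A"
    by auto
qed

section \<open>The stochastic run\<close>

locale stochastic_run = sym_algebra L + prob_space M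
  for L :: "(real^'n^'n) set" and M :: "'w measure" +
  fixes \<epsilon> \<beta> \<eta> :: real and T :: nat
    and f :: "real^'n \<Rightarrow> real" and x0 :: "real^'n"
    and F :: "nat \<Rightarrow> 'w \<Rightarrow> (real^'n \<Rightarrow> real)"
    and \<Sigma> :: "real^'n^'n"
  assumes eps: "0 < \<epsilon>" and beta: "0 < \<beta>" "\<beta> \<le> 1" and eta: "0 < \<eta>"
    and f_diff: "\<forall>x. f differentiable (at x)"
    and gradf_diff: "\<forall>x. grad f differentiable (at x)"
    and F_rv: "\<forall>t<T. F t \<in> M \<rightarrow>\<^sub>M fun_space"
    and F_indep: "indep_vars (\<lambda>_. fun_space) F {..<T}"
    and F_diff: "\<forall>t<T. \<forall>\<omega>\<in>space M. \<forall>x. F t \<omega> differentiable (at x)"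
    and Sigma_psd: "psd \<Sigma>"
    and unbiased_int: "\<forall>t<T. \<forall>x. integrable M (\<lambda>\<omega>. grad (F t \<omega>) x)"
    and unbiased: "\<forall>t<T. \<forall>x. (\<integral>\<omega>. grad (F t \<omega>) x \<partial>M) = grad f x"
    and noise: "\<forall>t<T. \<forall>x. AE \<omega> in M.
        loewner_le (- \<Sigma>) (outer (grad f x) (grad f x) - outer (grad (F t \<omega>) x) (grad (F t \<omega>) x)) \<and>
        loewner_le (outer (grad f x) (grad f x) - outer (grad (F t \<omega>) x) (grad (F t \<omega>) x)) \<Sigma>"
begin

abbreviation run :: "(nat \<Rightarrow> real^'n \<Rightarrow> real^'n) \<Rightarrow> nat \<Rightarrow> (real^'n) \<times> (real^'n^'n)" where
  "run \<equiv> alg_state psd_L \<epsilon> \<beta> \<eta> x0"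

definition X :: "nat \<Rightarrow> 'w \<Rightarrow> real^'n" where
  "X t \<omega> = fst (run (\<lambda>s. grad (F s \<omega>)) t)"

text \<open>This is M_(t-1) of the algorithm, which is why V_t is formed from
  \<open>P (Suc t)\<close>.\<close>

definition P :: "nat \<Rightarrow> 'w \<Rightarrow> real^'n^'n" where
  "P t \<omega> = snd (run (\<lambda>s. grad (F s \<omega>)) t)"

definition g :: "nat \<Rightarrow> 'w \<Rightarrow> real^'n" where
  "g t \<omega> = grad (F t \<omega>) (X t \<omega>)"

definition a :: "nat \<Rightarrow> 'w \<Rightarrow> real^'n" where
  "a t \<omega> = grad f (X t \<omega>)"

definition V :: "nat \<Rightarrow> 'w \<Rightarrow> real^'n^'n" where
  "V t \<omega> = precond psd_L (P (Suc t) \<omega> + \<epsilon> *\<^sub>R mat 1)"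

definition V_prev :: "nat \<Rightarrow> 'w \<Rightarrow> real^'n^'n" where
  "V_prev t \<omega> = (if t = 0 then sqrt \<epsilon> *\<^sub>R mat 1 else V (t - 1) \<omega>)"

definition S :: "nat \<Rightarrow> 'w \<Rightarrow> real^'n^'n" where
  "S t \<omega> = matrix_inv (V t \<omega>) ** (V t \<omega> ** V t \<omega> - \<beta> *\<^sub>R (V_prev t \<omega> ** V_prev t \<omega>)) ** matrix_inv (V t \<omega>)"

text \<open>A preconditioner dominating \<^term>\<open>V t \<omega>\<close> but depending only on \<open>F 0, \<dots>, F (t - 1)\<close>.\<close>

definition U :: "nat \<Rightarrow> 'w \<Rightarrow> real^'n^'n" where
  "U t \<omega> = precond psd_L (\<beta> *\<^sub>R P t \<omega> + outer (a t \<omega>) (a t \<omega>) + \<Sigma> + \<epsilon> *\<^sub>R mat 1)"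

lemma P_0: "P 0 \<omega> = 0"
  and P_Suc: "P (Suc t) \<omega> = \<beta> *\<^sub>R P t \<omega> + outer (g t \<omega>) (g t \<omega>)"
  and X_0: "X 0 \<omega> = x0"
  and X_Suc: "X (Suc t) \<omega> = X t \<omega> - \<eta> *\<^sub>R (matrix_inv (V t \<omega>) *v g t \<omega>)"
  by (simp_all add: P_def X_def V_def g_def alg_state_Suc_components del: alg_state.simps(2))

lemma psd_P: "psd (P t \<omega>)"
  using beta by (simp add: P_def psd_alg_state)

lemma V_eq: "V t \<omega> = precond psd_L (\<beta> *\<^sub>R P t \<omega> + outer (g t \<omega>) (g t \<omega>) + \<epsilon> *\<^sub>R mat 1)"
  by (simp add: V_def P_Suc)

text \<open>The convention V_(-1) = sqrt \<epsilon> I fits: its square is \<epsilon> I, the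
  projection of P_0 + \<epsilon> I with P_0 = 0. Time 0 thus needs no separate treatment in the
  increment bounds.\<close>

lemma V_prev_props:
  "sym_mat (V_prev t \<omega>)" "V_prev t \<omega> ** V_prev t \<omega> = proj_L (P t \<omega> + \<epsilon> *\<^sub>R mat 1)"
proof -
  note pd = pd_add_scaleR_one[OF psd_P eps]
  show "sym_mat (V_prev t \<omega>)"
    by (simp add: V_prev_def V_def sym_mat_intros sym_L precond_L[OF pd])
  show "V_prev t \<omega> ** V_prev t \<omega> = proj_L (P t \<omega> + \<epsilon> *\<^sub>R mat 1)"
    using eps by (cases t) (simp_all add: V_prev_def V_def precond_square[OF pd] P_0 proj_L_simps
        matrix_mult_linear_simps(5,6))
qed

lemmas increment = preconditioned_increment[OF psd_P eps less_imp_le[OF beta(1)] beta(2)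
    V_eq V_prev_props S_def]

lemma psd_pre_U: "psd (\<beta> *\<^sub>R P t \<omega> + outer (a t \<omega>) (a t \<omega>) + \<Sigma>)"
  using beta by (intro psd_add psd_scaleR psd_P psd_outer Sigma_psd) auto

lemma pd_U: "pd (U t \<omega>)"
  unfolding U_def by (rule pd_precond[OF pd_add_scaleR_one[OF psd_pre_U eps]])

lemma sym_inv_U: "sym_mat (matrix_inv (U t \<omega>))"
  using pd_inv[OF pd_U] by (simp add: pd_def)

lemma norm_inv_U: "norm (matrix_inv (U t \<omega>) *v y) \<le> 1 / sqrt \<epsilon> * norm y"
  unfolding U_def using eps
  by (intro norm_matrix_inv_le precond_scaleR_one_le scaleR_one_le_add psd_pre_U) auto

text \<open>On every path |V_t^-1 g_t|^2 <= tr S_t <= tr I, whatever the size of the gradient.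
  Continuous functions of the iterates are therefore bounded, and in particular integrable.\<close>

lemma X_bounded: "norm (X t \<omega> - x0) \<le> real t * (\<eta> * sqrt (real CARD('n)))"
proof (induction t)
  case (Suc t)
  have "(norm (matrix_inv (V t \<omega>) *v g t \<omega>))\<^sup>2 \<le> real CARD('n)"
    using increment(2)[of t \<omega>] trace_mono[OF increment(4)[of t \<omega>]] by (simp add: trace_I)
  then have "norm (matrix_inv (V t \<omega>) *v g t \<omega>) \<le> sqrt (real CARD('n))"
    by (rule real_le_rsqrt)
  then have "\<eta> * norm (matrix_inv (V t \<omega>) *v g t \<omega>) \<le> \<eta> * sqrt (real CARD('n))"
    using eta by (intro mult_left_mono) auto
  moreover have "norm (X (Suc t) \<omega> - x0) \<le> norm (X t \<omega> - x0) + \<eta> * norm (matrix_inv (V t \<omega>) *v g t \<omega>)"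
    using norm_triangle_ineq4[of "X t \<omega> - x0" "\<eta> *\<^sub>R (matrix_inv (V t \<omega>) *v g t \<omega>)"] eta
    by (simp add: X_Suc algebra_simps)
  ultimately show ?case using Suc by (simp add: algebra_simps)
qed (simp add: X_0)

lemma continuous_along_run_bounded:
  fixes h :: "real^'n \<Rightarrow> 'b::real_normed_vector"
  assumes "continuous_on UNIV h"
  obtains C where "0 \<le> C" "\<And>t \<omega>. t \<le> T \<Longrightarrow> norm (h (X t \<omega>)) \<le> C"
proof -
  let ?K = "cball x0 (real T * (\<eta> * sqrt (real CARD('n))))"
  have "compact (h ` ?K)"
    using assms continuous_on_subset by (intro compact_continuous_image) auto
  then obtain C where C: "\<And>y. y \<in> ?K \<Longrightarrow> norm (h y) \<le> C"
    using compact_imp_bounded bounded_iff by (metis imageI)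
  have "X t \<omega> \<in> ?K" if "t \<le> T" for t \<omega>
  proof -
    have "real t * (\<eta> * sqrt (real CARD('n))) \<le> real T * (\<eta> * sqrt (real CARD('n)))"
      using that eta by (intro mult_right_mono) auto
    then show ?thesis using X_bounded[of t \<omega>] by (simp add: dist_norm norm_minus_commute)
  qed
  with C show ?thesis by (intro that[of "max C 0"]) (auto simp: le_max_iff_disj)
qed

lemma continuous_f: "continuous_on UNIV f" and continuous_grad_f: "continuous_on UNIV (grad f)"
  using f_diff gradf_diff by (auto intro!: differentiable_imp_continuous_on simp: differentiable_on_def)

lemma grad_lim_F: "t < T \<Longrightarrow> \<omega> \<in> space M \<Longrightarrow> grad_lim (F t \<omega>) = grad (F t \<omega>)"
  using F_diff grad_lim_eq by blast

lemma run_grad_lim: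
  "t \<le> T \<Longrightarrow> \<omega> \<in> space M \<Longrightarrow> run (\<lambda>s. grad_lim (F s \<omega>)) t = run (\<lambda>s. grad (F s \<omega>)) t"
  by (rule alg_state_cong) (simp add: grad_lim_F)

lemma measurable_X: "t \<le> T \<Longrightarrow> X t \<in> borel_measurable M"
  and measurable_P: "t \<le> T \<Longrightarrow> P t \<in> borel_measurable M"
proof -
  assume t: "t \<le> T"
  then have F: "\<And>s. s < t \<Longrightarrow> F s \<in> M \<rightarrow>\<^sub>M fun_space" using F_rv by auto
  note m = measurable_alg_state[of \<epsilon> \<beta> t F M \<eta> x0, OF eps less_imp_le[OF beta(1)] F]
  show "X t \<in> borel_measurable M"
    by (rule measurable_cong[THEN iffD1, OF _ m(1)]) (simp_all add: X_def run_grad_lim t)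
  show "P t \<in> borel_measurable M"
    by (rule measurable_cong[THEN iffD1, OF _ m(2)]) (simp_all add: P_def run_grad_lim t)
qed

lemma measurable_run:
  assumes "t < T"
  shows "a t \<in> borel_measurable M" "g t \<in> borel_measurable M" "V t \<in> borel_measurable M"
    "(\<lambda>\<omega>. matrix_inv (V t \<omega>)) \<in> borel_measurable M"
    "(\<lambda>\<omega>. matrix_inv (U t \<omega>)) \<in> borel_measurable M" "S t \<in> borel_measurable M"
proof -
  have [measurable]: "X t \<in> borel_measurable M" "P t \<in> borel_measurable M" "P (Suc t) \<in> borel_measurable M"
    "F t \<in> M \<rightarrow>\<^sub>M fun_space"
    using assms F_rv measurable_X measurable_P by auto
  have [measurable]: "grad f \<in> borel_measurable borel"
    by (rule borel_measurable_continuous_onI[OF continuous_grad_f])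
  show a [measurable]: "a t \<in> borel_measurable M"
    unfolding a_def[abs_def] by measurable
  have "(\<lambda>\<omega>. grad_lim (F t \<omega>) (X t \<omega>)) \<in> borel_measurable M"
    by (rule measurable_grad_lim) measurable
  then show "g t \<in> borel_measurable M"
    by (rule measurable_cong[THEN iffD1, rotated]) (simp add: g_def grad_lim_F assms)
  show V [measurable]: "V t \<in> borel_measurable M"
    unfolding V_def[abs_def]
    by (rule borel_measurable_precond(1)[OF eps]) (measurable, intro scaleR_one_le_add psd_P)
  show Vi [measurable]: "(\<lambda>\<omega>. matrix_inv (V t \<omega>)) \<in> borel_measurable M"
    unfolding V_def[abs_def]
    by (rule borel_measurable_precond(2)[OF eps]) (measurable, intro scaleR_one_le_add psd_P)
  show "(\<lambda>\<omega>. matrix_inv (U t \<omega>)) \<in> borel_measurable M"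
    unfolding U_def[abs_def]
    by (rule borel_measurable_precond(2)[OF eps]) (measurable, intro scaleR_one_le_add psd_pre_U)
  have [measurable]: "V_prev t \<in> borel_measurable M"
  proof (cases t)
    case 0
    then show ?thesis by (simp add: V_prev_def[abs_def])
  next
    case (Suc s)
    have "V s \<in> borel_measurable M"
      using assms Suc measurable_P[of t] unfolding V_def[abs_def]
      by (intro borel_measurable_precond(1)[OF eps] scaleR_one_le_add psd_P) auto
    then show ?thesis by (simp add: V_prev_def[abs_def] Suc)
  qed
  show "S t \<in> borel_measurable M" unfolding S_def[abs_def] by measurable
qed

text \<open>The past \<open>F 0, \<dots>, F (t - 1)\<close> is independent of \<open>F t\<close>; \<open>past_X\<close> and \<open>past_P\<close> express the
  state at time \<open>t\<close> as a function of it.\<close>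

abbreviation past :: "nat \<Rightarrow> 'w \<Rightarrow> nat \<Rightarrow> real^'n \<Rightarrow> real" where
  "past t \<omega> \<equiv> restrict (\<lambda>s. F s \<omega>) {..<t}"

text \<open>Kept as a family over the singleton {t} so that past and present have the same type, as
  \<open>indep_var\<close> demands.\<close>

abbreviation present :: "nat \<Rightarrow> 'w \<Rightarrow> nat \<Rightarrow> real^'n \<Rightarrow> real" where
  "present t \<omega> \<equiv> restrict (\<lambda>s. F s \<omega>) {t}"

abbreviation past_space :: "nat \<Rightarrow> (nat \<Rightarrow> real^'n \<Rightarrow> real) measure" where
  "past_space t \<equiv> PiM {..<t} (\<lambda>_. fun_space)"

abbreviation present_space :: "nat \<Rightarrow> (nat \<Rightarrow> real^'n \<Rightarrow> real) measure" where
  "present_space t \<equiv> PiM {t} (\<lambda>_. fun_space)"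

definition past_X :: "nat \<Rightarrow> (nat \<Rightarrow> real^'n \<Rightarrow> real) \<Rightarrow> real^'n" where
  "past_X t \<phi> = fst (run (\<lambda>s. grad_lim (\<phi> s)) t)"

definition past_P :: "nat \<Rightarrow> (nat \<Rightarrow> real^'n \<Rightarrow> real) \<Rightarrow> real^'n^'n" where
  "past_P t \<phi> = snd (run (\<lambda>s. grad_lim (\<phi> s)) t)"

lemma past_state:
  assumes "t < T" "\<omega> \<in> space M"
  shows "past_X t (past t \<omega>) = X t \<omega>" "past_P t (past t \<omega>) = P t \<omega>"
proof -
  have "run (\<lambda>s. grad_lim (past t \<omega> s)) t = run (\<lambda>s. grad (F s \<omega>)) t"
    using assms by (intro alg_state_cong) (simp add: grad_lim_F)
  then show "past_X t (past t \<omega>) = X t \<omega>" "past_P t (past t \<omega>) = P t \<omega>"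
    by (simp_all add: past_X_def past_P_def X_def P_def)
qed

lemma measurable_past:
  "past_X t \<in> borel_measurable (past_space t)" "past_P t \<in> borel_measurable (past_space t)"
  unfolding past_X_def[abs_def] past_P_def[abs_def]
  using measurable_alg_state[of \<epsilon> \<beta> t "\<lambda>s \<phi>. \<phi> s" "past_space t" \<eta> x0, OF eps less_imp_le[OF beta(1)]]
  by (auto intro: measurable_component_singleton)

lemma indep_past_present:
  "t < T \<Longrightarrow> indep_var (past_space t) (past t) (present_space t) (present t)"
  by (rule indep_var_restrict[OF F_indep]) auto

lemma measurable_past_present [measurable]:
  "(\<lambda>p. past_X t (fst p)) \<in> borel_measurable (past_space t \<Otimes>\<^sub>M present_space t)"
  "(\<lambda>p. grad_lim (snd p t) (past_X t (fst p))) \<in> borel_measurable (past_space t \<Otimes>\<^sub>M present_space t)"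
proof -
  show X [measurable]: "(\<lambda>p. past_X t (fst p)) \<in> borel_measurable (past_space t \<Otimes>\<^sub>M present_space t)"
    by (rule measurable_compose[OF measurable_fst measurable_past(1)])
  have "(\<lambda>p. snd p t) \<in> past_space t \<Otimes>\<^sub>M present_space t \<rightarrow>\<^sub>M fun_space"
    by (rule measurable_compose[OF measurable_snd measurable_component_singleton]) simp
  then show "(\<lambda>p. grad_lim (snd p t) (past_X t (fst p))) \<in> borel_measurable (past_space t \<Otimes>\<^sub>M present_space t)"
    using X by (rule measurable_grad_lim)
qed

text \<open>X_t is a function of the past and so independent of F_t; \<open>indep_var_AE\<close> can
  therefore insert it for the fixed point of \<open>noise\<close>.\<close>

lemma noise_at_iterate:
  assumes t: "t < T"
  shows "AE \<omega> in M. loewner_le (- \<Sigma>) (outer (a t \<omega>) (a t \<omega>) - outer (g t \<omega>) (g t \<omega>)) \<and>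
    loewner_le (outer (a t \<omega>) (a t \<omega>) - outer (g t \<omega>) (g t \<omega>)) \<Sigma>"
proof -
  have [measurable]: "grad f \<in> borel_measurable borel"
    by (rule borel_measurable_continuous_onI[OF continuous_grad_f])
  define D where "D x \<phi> = outer (grad f x) (grad f x) - outer (grad_lim \<phi> x) (grad_lim \<phi> x)" for x \<phi>
  have [measurable]: "(\<lambda>p. D (past_X t (fst p)) (snd p t)) \<in> borel_measurable (past_space t \<Otimes>\<^sub>M present_space t)"
    unfolding D_def by measurable
  have "AE \<omega> in M. loewner_le (- \<Sigma>) (D (past_X t (past t \<omega>)) (present t \<omega> t)) \<and>
      loewner_le (D (past_X t (past t \<omega>)) (present t \<omega> t)) \<Sigma>"
  proof (rule indep_var_AE[OF indep_past_present[OF t]])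
    fix \<phi>
    show "AE \<omega> in M. loewner_le (- \<Sigma>) (D (past_X t \<phi>) (present t \<omega> t)) \<and>
        loewner_le (D (past_X t \<phi>) (present t \<omega> t)) \<Sigma>"
      using noise[rule_format, OF t, of "past_X t \<phi>"] AE_space
      by eventually_elim (simp add: D_def grad_lim_F t)
  qed measurable
  then show ?thesis
    using AE_space by eventually_elim (simp add: D_def past_state grad_lim_F t a_def g_def)
qed

text \<open>The weight k may depend on the state before g_t is drawn, but not on g_t; U_t^-1 a_t is
  of this kind, V_t^-1 a_t in general is not.\<close>

lemma unbiased_at_iterate:
  fixes k :: "real^'n \<Rightarrow> real^'n^'n \<Rightarrow> real^'n"
  assumes t: "t < T"
    and k: "(\<lambda>\<phi>. k (past_X t \<phi>) (past_P t \<phi>)) \<in> borel_measurable (past_space t)"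
    and int: "integrable M (\<lambda>\<omega>. k (X t \<omega>) (P t \<omega>) \<bullet> g t \<omega>)"
  shows "(\<integral>\<omega>. k (X t \<omega>) (P t \<omega>) \<bullet> g t \<omega> \<partial>M) = (\<integral>\<omega>. k (X t \<omega>) (P t \<omega>) \<bullet> a t \<omega> \<partial>M)"
proof -
  define h where "h \<phi> \<psi> = k (past_X t \<phi>) (past_P t \<phi>) \<bullet> grad_lim (\<psi> t) (past_X t \<phi>)" for \<phi> \<psi>
  have h_eq: "h (past t \<omega>) (present t \<omega>) = k (X t \<omega>) (P t \<omega>) \<bullet> g t \<omega>" if "\<omega> \<in> space M" for \<omega>
    using that t by (simp add: h_def past_state grad_lim_F g_def)
  have [measurable]: "(\<lambda>p. k (past_X t (fst p)) (past_P t (fst p)))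
      \<in> borel_measurable (past_space t \<Otimes>\<^sub>M present_space t)"
    by (rule measurable_compose[OF measurable_fst k])
  have "(\<integral>\<omega>. h (past t \<omega>) (present t \<omega>) \<partial>M)
      = (\<integral>\<omega>. k (past_X t (past t \<omega>)) (past_P t (past t \<omega>)) \<bullet> grad f (past_X t (past t \<omega>)) \<partial>M)"
  proof (rule indep_var_integral[OF indep_past_present[OF t]])
    show "(\<lambda>p. h (fst p) (snd p)) \<in> borel_measurable (past_space t \<Otimes>\<^sub>M present_space t)"
      unfolding h_def by measurable
    show "integrable M (\<lambda>\<omega>. h (past t \<omega>) (present t \<omega>))"
      using int by (rule Bochner_Integration.integrable_cong[THEN iffD1, rotated 2]) (simp_all add: h_eq)
    fix \<phi>
    let ?x = "past_X t \<phi>" and ?k = "k (past_X t \<phi>) (past_P t \<phi>)"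
    have "(\<integral>\<omega>. h \<phi> (present t \<omega>) \<partial>M) = (\<integral>\<omega>. ?k \<bullet> grad (F t \<omega>) ?x \<partial>M)"
      by (rule Bochner_Integration.integral_cong) (simp_all add: h_def grad_lim_F t)
    also have "\<dots> = ?k \<bullet> grad f ?x"
      using unbiased_int unbiased t by (simp add: integral_inner_right)
    finally show "(\<integral>\<omega>. h \<phi> (present t \<omega>) \<partial>M) = ?k \<bullet> grad f ?x" .
  qed
  moreover have "(\<integral>\<omega>. h (past t \<omega>) (present t \<omega>) \<partial>M) = (\<integral>\<omega>. k (X t \<omega>) (P t \<omega>) \<bullet> g t \<omega> \<partial>M)"
    by (rule Bochner_Integration.integral_cong) (simp_all add: h_eq)
  moreover have "(\<integral>\<omega>. k (past_X t (past t \<omega>)) (past_P t (past t \<omega>)) \<bullet> grad f (past_X t (past t \<omega>)) \<partial>M)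
      = (\<integral>\<omega>. k (X t \<omega>) (P t \<omega>) \<bullet> a t \<omega> \<partial>M)"
    by (rule Bochner_Integration.integral_cong) (simp_all add: past_state t a_def)
  ultimately show ?thesis by simp
qed

end


subsection \<open>Convergence in expectation\<close>

context stochastic_run
begin

lemma noise_upper:
  assumes "t < T"
  shows "AE \<omega> in M. loewner_le (outer (g t \<omega>) (g t \<omega>)) (outer (a t \<omega>) (a t \<omega>) + \<Sigma>)"
  using noise_at_iterate[OF assms] by eventually_elim (simp add: loewner_le_def algebra_simps)

lemma noise_lower:
  assumes "t < T"
  shows "AE \<omega> in M. loewner_le (outer (a t \<omega>) (a t \<omega>)) (outer (g t \<omega>) (g t \<omega>) + \<Sigma>)"
  using noise_at_iterate[OF assms] by eventually_elim (simp add: loewner_le_def algebra_simps)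

lemma a_bounded: obtains C where "0 \<le> C" "\<And>t \<omega>. t \<le> T \<Longrightarrow> norm (a t \<omega>) \<le> C"
  using continuous_along_run_bounded[OF continuous_grad_f] unfolding a_def by blast

text \<open>The trace of the noise inequality reads |g_t|^2 <= |a_t|^2 + tr \<Sigma>, and a_t is
  bounded along the run.\<close>

lemma g_bounded:
  assumes t: "t < T"
  obtains C where "0 \<le> C" "AE \<omega> in M. norm (g t \<omega>) \<le> C"
proof -
  obtain B where B: "0 \<le> B" "\<And>t \<omega>. t \<le> T \<Longrightarrow> norm (a t \<omega>) \<le> B" using a_bounded by blast
  have "AE \<omega> in M. norm (g t \<omega>) \<le> sqrt (B\<^sup>2 + trace \<Sigma>)"
    using noise_upper[OF t]
  proof eventually_elim
    case (elim \<omega>)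
    have "(norm (g t \<omega>))\<^sup>2 \<le> (norm (a t \<omega>))\<^sup>2 + trace \<Sigma>"
      using trace_mono[OF elim] by (simp add: trace_add trace_outer power2_norm_eq_inner)
    also have "\<dots> \<le> B\<^sup>2 + trace \<Sigma>" using B t by (intro add_right_mono power_mono) auto
    finally show ?case by (rule real_le_rsqrt)
  qed
  moreover have "0 \<le> sqrt (B\<^sup>2 + trace \<Sigma>)" by (simp add: psd_trace_nonneg[OF Sigma_psd])
  ultimately show ?thesis by (rule that[rotated])
qed

lemma integrable_S: "t < T \<Longrightarrow> integrable M (S t)"
  using psd_le_one_norm[OF increment(3,4)] measurable_run(6) by (intro integrable_const_bound) auto

lemma integrable_f_X: "t \<le> T \<Longrightarrow> integrable M (\<lambda>\<omega>. f (X t \<omega>))"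
proof -
  assume t: "t \<le> T"
  obtain C where C: "\<And>t \<omega>. t \<le> T \<Longrightarrow> norm (f (X t \<omega>)) \<le> C"
    using continuous_along_run_bounded[OF continuous_f] by blast
  have "(\<lambda>\<omega>. f (X t \<omega>)) \<in> borel_measurable M"
    using measurable_compose[OF measurable_X[OF t] borel_measurable_continuous_onI[OF continuous_f]] .
  then show ?thesis using C[OF t] by (intro integrable_const_bound[of _ C]) auto
qed

definition p :: "nat \<Rightarrow> 'w \<Rightarrow> real^'n" where
  "p t \<omega> = matrix_inv (U t \<omega>) *v a t \<omega>"

lemma measurable_p: "t < T \<Longrightarrow> p t \<in> borel_measurable M"
  using measurable_run(1,5)[of t] unfolding p_def[abs_def] by (intro borel_measurable_matrix_vector) auto

lemma p_bounded: obtains C where "0 \<le> C" "\<And>t \<omega>. t \<le> T \<Longrightarrow> norm (p t \<omega>) \<le> C"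
proof -
  obtain B where B: "0 \<le> B" "\<And>t \<omega>. t \<le> T \<Longrightarrow> norm (a t \<omega>) \<le> B" using a_bounded by blast
  have "norm (p t \<omega>) \<le> 1 / sqrt \<epsilon> * B" if "t \<le> T" for t \<omega>
    unfolding p_def using B(2)[OF that] eps
    by (intro order_trans[OF norm_inv_U] mult_left_mono) auto
  moreover have "0 \<le> 1 / sqrt \<epsilon> * B" using B(1) eps by simp
  ultimately show ?thesis by (rule that[rotated])
qed

lemma integrable_inner:
  assumes "y \<in> borel_measurable M" "z \<in> borel_measurable M"
    and "\<And>\<omega>. norm (y \<omega> :: real^'n) \<le> B" and "AE \<omega> in M. norm (z \<omega>) \<le> C"
  shows "integrable M (\<lambda>\<omega>. y \<omega> \<bullet> z \<omega>)"
proof (rule integrable_const_bound)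
  show "AE \<omega> in M. norm (y \<omega> \<bullet> z \<omega>) \<le> B * C"
    using assms(4)
  proof eventually_elim
    case (elim \<omega>)
    have "\<bar>y \<omega> \<bullet> z \<omega>\<bar> \<le> norm (y \<omega>) * norm (z \<omega>)" by (rule Cauchy_Schwarz_ineq2)
    also have "\<dots> \<le> B * C"
      using assms(3)[of \<omega>] elim by (intro mult_mono) (auto intro: order_trans[OF norm_ge_zero])
    finally show ?case by simp
  qed
qed (use assms in measurable)

lemma integrable_run:
  assumes t: "t < T"
  shows "integrable M (\<lambda>\<omega>. a t \<omega> \<bullet> p t \<omega>)" "integrable M (\<lambda>\<omega>. (norm (p t \<omega>))\<^sup>2)"
    "integrable M (\<lambda>\<omega>. p t \<omega> \<bullet> g t \<omega>)" "integrable M (\<lambda>\<omega>. (matrix_inv (U t \<omega>) *v p t \<omega>) \<bullet> g t \<omega>)"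
proof -
  obtain A where A: "0 \<le> A" "\<And>\<omega>. norm (a t \<omega>) \<le> A" using a_bounded t by (metis less_imp_le)
  obtain B where B: "0 \<le> B" "\<And>\<omega>. norm (p t \<omega>) \<le> B" using p_bounded t by (metis less_imp_le)
  obtain C where C: "0 \<le> C" "AE \<omega> in M. norm (g t \<omega>) \<le> C" using g_bounded[OF t] by blast
  have B': "norm (matrix_inv (U t \<omega>) *v p t \<omega>) \<le> 1 / sqrt \<epsilon> * B" for \<omega>
    using B(2)[of \<omega>] eps by (intro order_trans[OF norm_inv_U] mult_left_mono) auto
  note m = measurable_run[OF t] measurable_p[OF t]
  show "integrable M (\<lambda>\<omega>. a t \<omega> \<bullet> p t \<omega>)" "integrable M (\<lambda>\<omega>. p t \<omega> \<bullet> g t \<omega>)"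
    using m A B C by (auto intro!: integrable_inner)
  show "integrable M (\<lambda>\<omega>. (matrix_inv (U t \<omega>) *v p t \<omega>) \<bullet> g t \<omega>)"
    using m B' C by (intro integrable_inner borel_measurable_matrix_vector) auto
  show "integrable M (\<lambda>\<omega>. (norm (p t \<omega>))\<^sup>2)"
    using m B by (auto intro!: integrable_inner simp: power2_norm_eq_inner)
qed

text \<open>The weights are U_t^-1 a_t for the linear descent term and U_t^-1 p_t for the error
  term, where U_t^-1 p_t . a_t = |p_t|^2 by symmetry.\<close>

lemma expectation_oracle:
  assumes t: "t < T"
  shows "expectation (\<lambda>\<omega>. p t \<omega> \<bullet> g t \<omega>) = expectation (\<lambda>\<omega>. a t \<omega> \<bullet> p t \<omega>)"
    and "expectation (\<lambda>\<omega>. (matrix_inv (U t \<omega>) *v p t \<omega>) \<bullet> g t \<omega>) = expectation (\<lambda>\<omega>. (norm (p t \<omega>))\<^sup>2)"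
proof -
  define W where "W x N = matrix_inv (precond psd_L
    (\<beta> *\<^sub>R N + outer (grad f x) (grad f x) + \<Sigma> + \<epsilon> *\<^sub>R mat 1))" for x N
  have W: "matrix_inv (U t \<omega>) = W (X t \<omega>) (P t \<omega>)" for \<omega>
    by (simp add: U_def W_def a_def)
  have [measurable]: "grad f \<in> borel_measurable borel"
    by (rule borel_measurable_continuous_onI[OF continuous_grad_f])
  note [measurable] = measurable_past
  have psd_past: "psd (past_P t \<phi>)" for \<phi>
    using beta by (simp add: past_P_def psd_alg_state)
  have [measurable]: "(\<lambda>\<phi>. W (past_X t \<phi>) (past_P t \<phi>)) \<in> borel_measurable (past_space t)"
    unfolding W_def using beta
    by (intro borel_measurable_precond(2)[OF eps] scaleR_one_le_add psd_add psd_scaleR psd_past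
        psd_outer Sigma_psd) auto
  show "expectation (\<lambda>\<omega>. p t \<omega> \<bullet> g t \<omega>) = expectation (\<lambda>\<omega>. a t \<omega> \<bullet> p t \<omega>)"
    using unbiased_at_iterate[OF t, of "\<lambda>x N. W x N *v grad f x"] integrable_run(3)[OF t]
    by (simp add: p_def W a_def inner_commute)
  have "(matrix_inv (U t \<omega>) *v p t \<omega>) \<bullet> a t \<omega> = (norm (p t \<omega>))\<^sup>2" for \<omega>
    unfolding power2_norm_eq_inner by (subst sym_mat_inner[OF sym_inv_U]) (simp add: p_def)
  then show "expectation (\<lambda>\<omega>. (matrix_inv (U t \<omega>) *v p t \<omega>) \<bullet> g t \<omega>) = expectation (\<lambda>\<omega>. (norm (p t \<omega>))\<^sup>2)"
    using unbiased_at_iterate[OF t, of "\<lambda>x N. W x N *v (W x N *v grad f x)"] integrable_run(4)[OF t]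
    by (simp add: p_def W a_def)
qed

text \<open>The second inequality is |p_t - U_t^-1 g_t|^2 >= 0 expanded. Bounding |p_t|^2 pathwise
  is avoided: by \<open>expectation_oracle\<close> the left-hand side has expectation exactly E
  |p_t|^2.\<close>

lemma step_inequalities:
  assumes t: "t < T" and H: "H \<in> psd_L" "\<And>x. loewner_le (hess f x) H"
  shows "AE \<omega> in M. f (X (Suc t) \<omega>) \<le> f (X t \<omega>) - \<eta> * (p t \<omega> \<bullet> g t \<omega>)
      + \<eta> * sqrt (2 * op_norm \<Sigma>) / 2 * ((norm (p t \<omega>))\<^sup>2 + mat 1 \<bullet> S t \<omega>) + \<eta>\<^sup>2 / 2 * (H \<bullet> S t \<omega>)"
    and "AE \<omega> in M. 2 * ((matrix_inv (U t \<omega>) *v p t \<omega>) \<bullet> g t \<omega>) - (norm (p t \<omega>))\<^sup>2 \<le> mat 1 \<bullet> S t \<omega>"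
proof -
  define Q where "Q \<omega> = \<beta> *\<^sub>R P t \<omega> + \<epsilon> *\<^sub>R mat 1" for \<omega>
  have Q: "pd (Q \<omega>)" for \<omega>
    unfolding Q_def using beta by (intro pd_add_scaleR_one psd_scaleR psd_P eps) auto
  have VQ: "V t \<omega> = precond psd_L (Q \<omega> + outer (g t \<omega>) (g t \<omega>))"
    and UQ: "U t \<omega> = precond psd_L (Q \<omega> + outer (a t \<omega>) (a t \<omega>) + \<Sigma>)" for \<omega>
    by (simp_all add: V_eq U_def Q_def algebra_simps)
  define q where "q \<omega> = matrix_inv (V t \<omega>) *v g t \<omega>" for \<omega>
  have trS: "(norm (q \<omega>))\<^sup>2 \<le> mat 1 \<bullet> S t \<omega>" for \<omega>
    using increment(2)[of t \<omega>] by (simp add: q_def trace_eq_inner)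
  have \<sigma>: "0 \<le> sqrt (2 * op_norm \<Sigma>)" using op_norm_nonneg[of \<Sigma>] by simp
  show "AE \<omega> in M. f (X (Suc t) \<omega>) \<le> f (X t \<omega>) - \<eta> * (p t \<omega> \<bullet> g t \<omega>)
      + \<eta> * sqrt (2 * op_norm \<Sigma>) / 2 * ((norm (p t \<omega>))\<^sup>2 + mat 1 \<bullet> S t \<omega>) + \<eta>\<^sup>2 / 2 * (H \<bullet> S t \<omega>)"
    using noise_upper[OF t] noise_lower[OF t]
  proof eventually_elim
    case (elim \<omega>)
    note pert = precond_perturbation(1)[OF Q Sigma_psd elim VQ UQ]
    have "a t \<omega> \<bullet> (matrix_inv (U t \<omega>) *v g t \<omega>) = p t \<omega> \<bullet> g t \<omega>"
      by (simp add: p_def sym_mat_inner[OF sym_inv_U])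
    with pert have "- (a t \<omega> \<bullet> q \<omega>) \<le> - (p t \<omega> \<bullet> g t \<omega>)
        + sqrt (2 * op_norm \<Sigma>) / 2 * ((norm (p t \<omega>))\<^sup>2 + (norm (q \<omega>))\<^sup>2)"
      by (simp add: p_def q_def)
    also have "\<dots> \<le> - (p t \<omega> \<bullet> g t \<omega>)
        + sqrt (2 * op_norm \<Sigma>) / 2 * ((norm (p t \<omega>))\<^sup>2 + mat 1 \<bullet> S t \<omega>)"
      using \<sigma> trS by (intro add_left_mono mult_left_mono) auto
    finally have "\<eta> * - (a t \<omega> \<bullet> q \<omega>) \<le> \<eta> * (- (p t \<omega> \<bullet> g t \<omega>)
        + sqrt (2 * op_norm \<Sigma>) / 2 * ((norm (p t \<omega>))\<^sup>2 + mat 1 \<bullet> S t \<omega>))"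
      using eta by (intro mult_left_mono) auto
    moreover have "\<eta>\<^sup>2 / 2 * (q \<omega> \<bullet> (H *v q \<omega>)) \<le> \<eta>\<^sup>2 / 2 * (H \<bullet> S t \<omega>)"
      unfolding q_def by (intro mult_left_mono increment(1) H) simp
    moreover have "f (X (Suc t) \<omega>) \<le> f (X t \<omega>) + \<eta> * - (a t \<omega> \<bullet> q \<omega>) + \<eta>\<^sup>2 / 2 * (q \<omega> \<bullet> (H *v q \<omega>))"
    proof -
      have X: "X (Suc t) \<omega> = X t \<omega> + (- \<eta>) *\<^sub>R q \<omega>" by (simp add: X_Suc q_def)
      show ?thesis
        unfolding X using descent_inequality[OF f_diff gradf_diff H(2), of "X t \<omega>" "(- \<eta>) *\<^sub>R q \<omega>"]
        by (simp add: a_def matrix_vector_mult_scaleR power2_eq_square del: scaleR_minus_left)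
    qed
    ultimately show ?case by (simp add: algebra_simps)
  qed
  show "AE \<omega> in M. 2 * ((matrix_inv (U t \<omega>) *v p t \<omega>) \<bullet> g t \<omega>) - (norm (p t \<omega>))\<^sup>2 \<le> mat 1 \<bullet> S t \<omega>"
    using noise_upper[OF t] noise_lower[OF t]
  proof eventually_elim
    case (elim \<omega>)
    let ?r = "matrix_inv (U t \<omega>) *v g t \<omega>"
    have "(norm ?r)\<^sup>2 \<le> mat 1 \<bullet> S t \<omega>"
      using precond_perturbation(2)[OF Q Sigma_psd elim VQ UQ] trS[of \<omega>] unfolding q_def
      by (rule order_trans)
    moreover have "(matrix_inv (U t \<omega>) *v p t \<omega>) \<bullet> g t \<omega> = p t \<omega> \<bullet> ?r"
      by (rule sym_mat_inner[OF sym_inv_U])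
    moreover have "0 \<le> (norm (p t \<omega> - ?r))\<^sup>2" by simp
    then have "2 * (p t \<omega> \<bullet> ?r) - (norm (p t \<omega>))\<^sup>2 \<le> (norm ?r)\<^sup>2"
      by (simp add: power2_norm_eq_inner inner_diff_left inner_diff_right inner_commute)
    ultimately show ?case by simp
  qed
qed

text \<open>The two halves of the AM-GM error, |p_t|^2 and tr S_t, have expectation at most tr E S_t
  each, so the 1/2 disappears.\<close>

lemma expected_descent:
  assumes t: "t < T" and H: "H \<in> psd_L" "\<And>x. loewner_le (hess f x) H"
  shows "\<eta> * expectation (\<lambda>\<omega>. a t \<omega> \<bullet> p t \<omega>)
    \<le> expectation (\<lambda>\<omega>. f (X t \<omega>)) - expectation (\<lambda>\<omega>. f (X (Suc t) \<omega>))
      + (\<eta> * sqrt (2 * op_norm \<Sigma>) * trace (expectation (S t)) + \<eta>\<^sup>2 / 2 * (H \<bullet> expectation (S t)))"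
proof -
  let ?\<kappa> = "\<eta> * sqrt (2 * op_norm \<Sigma>) / 2"
  note [simp] = integrable_run[OF t] integrable_S[OF t] integrable_f_X[of t] integrable_f_X[of "Suc t"]
  have tS: "t \<le> T" "Suc t \<le> T" using t by auto
  have "expectation (\<lambda>\<omega>. 2 * ((matrix_inv (U t \<omega>) *v p t \<omega>) \<bullet> g t \<omega>) - (norm (p t \<omega>))\<^sup>2)
      \<le> expectation (\<lambda>\<omega>. mat 1 \<bullet> S t \<omega>)"
    by (rule integral_mono_AE[OF _ _ step_inequalities(2)[OF t H]]) simp_all
  then have pS: "expectation (\<lambda>\<omega>. (norm (p t \<omega>))\<^sup>2) \<le> trace (expectation (S t))"
    by (simp add: expectation_oracle(2)[OF t] trace_eq_inner)
  have "expectation (\<lambda>\<omega>. f (X (Suc t) \<omega>)) \<le> expectation (\<lambda>\<omega>. f (X t \<omega>) - \<eta> * (p t \<omega> \<bullet> g t \<omega>)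
      + ?\<kappa> * ((norm (p t \<omega>))\<^sup>2 + mat 1 \<bullet> S t \<omega>) + \<eta>\<^sup>2 / 2 * (H \<bullet> S t \<omega>))"
    by (rule integral_mono_AE[OF _ _ step_inequalities(1)[OF t H]]) (simp_all add: tS)
  also have "\<dots> = expectation (\<lambda>\<omega>. f (X t \<omega>)) - \<eta> * expectation (\<lambda>\<omega>. a t \<omega> \<bullet> p t \<omega>)
      + ?\<kappa> * (expectation (\<lambda>\<omega>. (norm (p t \<omega>))\<^sup>2) + trace (expectation (S t)))
      + \<eta>\<^sup>2 / 2 * (H \<bullet> expectation (S t))"
    by (simp add: tS expectation_oracle(1)[OF t] trace_eq_inner)
  also have "\<dots> \<le> expectation (\<lambda>\<omega>. f (X t \<omega>)) - \<eta> * expectation (\<lambda>\<omega>. a t \<omega> \<bullet> p t \<omega>)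
      + ?\<kappa> * (trace (expectation (S t)) + trace (expectation (S t)))
      + \<eta>\<^sup>2 / 2 * (H \<bullet> expectation (S t))"
    using eta op_norm_nonneg[of \<Sigma>] pS by (intro add_right_mono add_left_mono mult_left_mono) auto
  finally show ?thesis by (simp add: algebra_simps)
qed

definition E :: "'w \<Rightarrow> real" where
  "E \<omega> = (\<Sum>t<T. a t \<omega> \<bullet> p t \<omega>)"

lemma E_nonneg: "0 \<le> E \<omega>"
  unfolding E_def p_def by (intro sum_nonneg psd_nonneg pd_imp_psd pd_inv pd_U)

lemma integrable_E: "integrable M E"
  unfolding E_def[abs_def] by (intro Bochner_Integration.integrable_sum integrable_run) auto

text \<open>Function values telescope from f(x_0) to an expectation at least m, and linearity
  assembles the S_t into S_T before any norm is taken.\<close>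

lemma expectation_E_le_of_hessian_bound:
  assumes H: "H \<in> psd_L" "\<And>x. loewner_le (hess f x) H" and lb: "\<And>x. m \<le> f x"
  defines "S_T \<equiv> expectation (\<lambda>\<omega>. \<Sum>t<T. S t \<omega>)"
  shows "expectation E \<le> (f x0 - m) / \<eta> + \<eta> / 2 * (trace H * op_norm S_T)
    + sqrt 2 * sqrt (op_norm \<Sigma>) * (real CARD('n) * op_norm S_T)"
proof -
  have S_T: "S_T = (\<Sum>t<T. expectation (S t))"
    unfolding S_T_def by (intro Bochner_Integration.integral_sum integrable_S) auto
  have "\<eta> * expectation E = (\<Sum>t<T. \<eta> * expectation (\<lambda>\<omega>. a t \<omega> \<bullet> p t \<omega>))"
    unfolding E_def using integrable_run(1)
    by (simp add: Bochner_Integration.integral_sum sum_distrib_left)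
  also have "\<dots> \<le> (\<Sum>t<T. expectation (\<lambda>\<omega>. f (X t \<omega>)) - expectation (\<lambda>\<omega>. f (X (Suc t) \<omega>))
      + (\<eta> * sqrt (2 * op_norm \<Sigma>) * trace (expectation (S t)) + \<eta>\<^sup>2 / 2 * (H \<bullet> expectation (S t))))"
    by (intro sum_mono expected_descent H) auto
  also have "\<dots> = f x0 - expectation (\<lambda>\<omega>. f (X T \<omega>))
      + \<eta> * sqrt (2 * op_norm \<Sigma>) * trace S_T + \<eta>\<^sup>2 / 2 * (H \<bullet> S_T)"
    using sum_lessThan_telescope'[of "\<lambda>t. expectation (\<lambda>\<omega>. f (X t \<omega>))" T]
    by (simp add: sum.distrib S_T inner_sum_right trace_eq_inner X_0 sum_distrib_left prob_space)
  also have "expectation (\<lambda>\<omega>. f (X T \<omega>)) \<ge> m"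
    using integral_mono[OF _ integrable_f_X[of T], of "\<lambda>_. m"] lb by (simp add: prob_space)
  then have "f x0 - expectation (\<lambda>\<omega>. f (X T \<omega>))
      + \<eta> * sqrt (2 * op_norm \<Sigma>) * trace S_T + \<eta>\<^sup>2 / 2 * (H \<bullet> S_T)
      \<le> f x0 - m + \<eta> * sqrt (2 * op_norm \<Sigma>) * (real CARD('n) * op_norm S_T)
      + \<eta>\<^sup>2 / 2 * (trace H * op_norm S_T)"
    using inner_le_trace_op_norm[OF psd_one, of S_T] inner_le_trace_op_norm[of H S_T] H eta op_norm_nonneg[of \<Sigma>]
    by (intro add_mono diff_mono mult_left_mono) (auto simp: trace_I trace_eq_inner[of S_T])
  finally have "\<eta> * expectation E \<le> \<eta> * ((f x0 - m) / \<eta> + \<eta> / 2 * (trace H * op_norm S_T)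
    + sqrt 2 * sqrt (op_norm \<Sigma>) * (real CARD('n) * op_norm S_T))"
    using eta by (simp add: real_sqrt_mult power2_eq_square distrib_left mult_ac)
  then show ?thesis using eta by simp
qed

text \<open>The estimate is affine in tr H with nonnegative slope and S_T is independent of H, so it
  passes to the infimum without a minimizing H.\<close>

lemma expectation_E_le:
  assumes fin: "\<exists>H\<in>psd_L. \<forall>x. loewner_le (- H) (hess f x) \<and> loewner_le (hess f x) H"
    and bdd: "bdd_below (range f)"
  defines "S_T \<equiv> expectation (\<lambda>\<omega>. \<Sum>t<T. S t \<omega>)" and "\<Delta> \<equiv> f x0 - Inf (range f)"
  shows "expectation E \<le> \<Delta> / \<eta> + \<eta> / 2 * (adaptive_smoothness psd_L f * op_norm S_T)
    + sqrt 2 * sqrt (op_norm \<Sigma>) * (real CARD('n) * op_norm S_T)"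
    and "0 \<le> adaptive_smoothness psd_L f"
proof -
  let ?A = "{trace H | H. H \<in> psd_L \<and> (\<forall>x. loewner_le (- H) (hess f x) \<and> loewner_le (hess f x) H)}"
  have ne: "?A \<noteq> {}" using fin by blast
  show "0 \<le> adaptive_smoothness psd_L f"
    unfolding adaptive_smoothness_def by (rule cInf_greatest[OF ne]) (auto intro: psd_trace_nonneg)
  define c where "c = \<Delta> / \<eta> + sqrt 2 * sqrt (op_norm \<Sigma>) * (real CARD('n) * op_norm S_T)"
  define s where "s = \<eta> / 2 * op_norm S_T"
  have "0 \<le> s" using eta op_norm_nonneg[of S_T] by (simp add: s_def)
  have le: "expectation E \<le> c + s * h" if "h \<in> ?A" for h
    using that expectation_E_le_of_hessian_bound[of _ "Inf (range f)"] cINF_lower[OF bdd]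
    by (auto simp: c_def s_def S_T_def \<Delta>_def algebra_simps)
  have "expectation E \<le> c + s * Inf ?A"
  proof (cases "s = 0")
    case True
    with le ne show ?thesis by auto
  next
    case False
    with \<open>0 \<le> s\<close> have s: "0 < s" by simp
    have "(expectation E - c) / s \<le> Inf ?A"
      using le s by (intro cInf_greatest[OF ne]) (simp add: divide_le_eq algebra_simps)
    with s show ?thesis by (simp add: divide_le_eq algebra_simps)
  qed
  then show "expectation E \<le> \<Delta> / \<eta> + \<eta> / 2 * (adaptive_smoothness psd_L f * op_norm S_T)
    + sqrt 2 * sqrt (op_norm \<Sigma>) * (real CARD('n) * op_norm S_T)"
    by (simp add: adaptive_smoothness_def c_def s_def algebra_simps)
qed

lemma sum_dual_norm_along_run:
  "AE \<omega> in M. (\<Sum>t<T. dual_norm psd_L (a t \<omega>)) \<le>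
    sqrt (real T * trace (precond psd_L ((\<Sum>i<T. \<beta> ^ i) *\<^sub>R \<Sigma> + \<epsilon> *\<^sub>R mat 1)) * E \<omega>)
      + sqrt (\<Sum>i<T. sqrt \<beta> ^ i) * E \<omega>"
proof -
  have "AE \<omega> in M. \<forall>t. t < T \<longrightarrow> loewner_le (outer (g t \<omega>) (g t \<omega>)) (outer (a t \<omega>) (a t \<omega>) + \<Sigma>)"
    unfolding AE_all_countable using noise_upper by auto
  then show ?thesis
  proof eventually_elim
    case (elim \<omega>)
    show ?case
      by (rule sum_dual_norm_le[where M = "\<lambda>t. P t \<omega>" and g = "\<lambda>t. g t \<omega>" and V = "\<lambda>t. U t \<omega>" and \<beta> = \<beta>
            and \<epsilon> = \<epsilon> and \<Sigma> = \<Sigma>])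
        (use elim beta eps Sigma_psd in \<open>auto simp: P_0 P_Suc U_def E_def p_def\<close>)
  qed
qed

text \<open>Jensen for the square root, in the form that the variance of sqrt E is
  nonnegative.\<close>

lemma expectation_sqrt_E_le: "expectation (\<lambda>\<omega>. sqrt (E \<omega>)) \<le> sqrt (expectation E)"
  and integrable_sqrt_E: "integrable M (\<lambda>\<omega>. sqrt (E \<omega>))"
proof -
  have sq: "(\<lambda>\<omega>. (sqrt (E \<omega>))\<^sup>2) = E" using E_nonneg by auto
  have [measurable]: "E \<in> borel_measurable M" using integrable_E by auto
  show int: "integrable M (\<lambda>\<omega>. sqrt (E \<omega>))"
    by (rule square_integrable_imp_integrable) (use integrable_E in \<open>auto simp: sq\<close>)
  have "0 \<le> variance (\<lambda>\<omega>. sqrt (E \<omega>))" by (rule variance_positive)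
  also have "\<dots> = expectation E - (expectation (\<lambda>\<omega>. sqrt (E \<omega>)))\<^sup>2"
    using variance_eq[OF int] integrable_E by (simp add: sq)
  finally show "expectation (\<lambda>\<omega>. sqrt (E \<omega>)) \<le> sqrt (expectation E)"
    by (intro real_le_rsqrt) simp
qed

lemma convergence_rate:
  assumes fin: "\<exists>H\<in>psd_L. \<forall>x. loewner_le (- H) (hess f x) \<and> loewner_le (hess f x) H"
    and bdd: "bdd_below (range f)"
  defines "S_T \<equiv> expectation (\<lambda>\<omega>. \<Sum>t<T. S t \<omega>)"
  defines "\<xi> \<equiv> 2 * (f x0 - Inf (range f)) / \<eta> + \<eta> * adaptive_smoothness psd_L f * op_norm S_T
      + sqrt 2 * real CARD('n) * sqrt (op_norm \<Sigma>) * op_norm S_T"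
  shows "(\<integral>\<^sup>+\<omega>. ennreal ((1 / real T) * (\<Sum>t<T. dual_norm psd_L (a t \<omega>))) \<partial>M)
    \<le> ennreal (sqrt (\<Sum>i<T. \<beta> powr (real i / 2)) / real T * \<xi>
      + sqrt (trace (precond psd_L ((\<Sum>i<T. \<beta> ^ i) *\<^sub>R \<Sigma> + \<epsilon> *\<^sub>R mat 1))) / sqrt (real T) * sqrt \<xi>)"
\<comment> \<open>For T = 0 the sum is empty and the left-hand side is the integral of 0.\<close>
proof (cases "T = 0")
  case False
  then have T: "0 < real T" by simp
  define R where "R = trace (precond psd_L ((\<Sum>i<T. \<beta> ^ i) *\<^sub>R \<Sigma> + \<epsilon> *\<^sub>R mat 1))"
  define b where "b = (\<Sum>i<T. sqrt \<beta> ^ i)"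
  have b_eq: "(\<Sum>i<T. \<beta> powr (real i / 2)) = b"
    unfolding b_def using beta
    by (intro sum.cong refl) (simp add: powr_half_sqrt[symmetric] powr_realpow[symmetric] powr_powr)
  have b0: "0 \<le> b" unfolding b_def using beta by (intro sum_nonneg) auto
  have R0: "0 \<le> R"
    unfolding R_def using beta
    by (intro psd_trace_nonneg pd_imp_psd pd_precond pd_add_scaleR_one psd_scaleR Sigma_psd eps sum_nonneg) auto
  have E0: "0 \<le> expectation E" by (intro integral_nonneg_AE AE_I2 E_nonneg)
  have \<Delta>0: "0 \<le> f x0 - Inf (range f)" using cINF_lower[OF bdd, of x0] by simp
  have E_le: "expectation E \<le> \<xi>"
  proof -
    note * = expectation_E_le[OF fin bdd]
    define D where "D = (f x0 - Inf (range f)) / \<eta>"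
    have n: "0 \<le> D" "0 \<le> adaptive_smoothness psd_L f * op_norm S_T * \<eta>"
      using \<Delta>0 eta *(2) op_norm_nonneg[of S_T] by (auto simp: D_def)
    have \<xi>: "\<xi> = 2 * D + \<eta> * adaptive_smoothness psd_L f * op_norm S_T
      + sqrt 2 * real CARD('n) * sqrt (op_norm \<Sigma>) * op_norm S_T"
      by (simp add: \<xi>_def D_def)
    have "expectation E \<le> D + \<eta> / 2 * (adaptive_smoothness psd_L f * op_norm S_T)
      + sqrt 2 * sqrt (op_norm \<Sigma>) * (real CARD('n) * op_norm S_T)"
      using *(1) by (simp add: S_T_def D_def)
    \<comment> \<open>The bound just obtained is \<xi> with its first two terms halved; both are
      nonnegative.\<close>
    also have "\<dots> \<le> \<xi>"
      using n by (simp add: \<xi> mult_ac)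
    finally show ?thesis .
  qed
  let ?Z = "\<lambda>\<omega>. (1 / real T) * (sqrt (real T * R) * sqrt (E \<omega>) + sqrt b * E \<omega>)"
  have "AE \<omega> in M. ennreal ((1 / real T) * (\<Sum>t<T. dual_norm psd_L (a t \<omega>))) \<le> ennreal (?Z \<omega>)"
    using sum_dual_norm_along_run
    by eventually_elim (intro ennreal_leI mult_left_mono, simp_all add: R_def b_def real_sqrt_mult)
  then have "(\<integral>\<^sup>+\<omega>. ennreal ((1 / real T) * (\<Sum>t<T. dual_norm psd_L (a t \<omega>))) \<partial>M) \<le> (\<integral>\<^sup>+\<omega>. ennreal (?Z \<omega>) \<partial>M)"
    by (rule nn_integral_mono_AE)
  also have "\<dots> = ennreal (expectation ?Z)"
    using b0 R0 E_nonneg T integrable_sqrt_E integrable_E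
    by (intro nn_integral_eq_integral) auto
  also have "expectation ?Z = (1 / real T) * (sqrt (real T * R) * expectation (\<lambda>\<omega>. sqrt (E \<omega>)) + sqrt b * expectation E)"
    using integrable_sqrt_E integrable_E by simp
  also have "\<dots> \<le> (1 / real T) * (sqrt (real T * R) * sqrt \<xi> + sqrt b * \<xi>)"
    using T R0 b0 E0 E_le expectation_sqrt_E_le
    by (intro mult_left_mono add_mono order_trans[OF expectation_sqrt_E_le] real_sqrt_le_mono) auto
  also have "\<dots> = sqrt b / real T * \<xi> + sqrt R / sqrt (real T) * sqrt \<xi>"
  proof -
    have "sqrt (real T * R) / real T = sqrt R / sqrt (real T)"
      using T by (simp add: real_sqrt_mult field_simps)
    then show ?thesis using T by (simp add: field_simps)
  qed
  finally show ?thesis by (simp add: R_def b_eq ennreal_leI)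
qed simp

end

theorem theorem3p1:
  fixes Hs :: "(real^'n^'n) set"
    and \<epsilon> \<beta> \<eta> :: real and T :: nat
    and f :: "real^'n \<Rightarrow> real" and x0 :: "real^'n"
    and M :: "'w measure"
    and F :: "nat \<Rightarrow> 'w \<Rightarrow> (real^'n \<Rightarrow> real)"
    and \<Sigma> :: "real^'n^'n"
  assumes ws: "well_structured Hs"
    and eps: "\<epsilon> > 0" and beta: "0 < \<beta>" "\<beta> \<le> 1" and eta: "\<eta> > 0"
    and f_diff: "\<forall>x. f differentiable (at x)"
    and gradf_diff: "\<forall>x. grad f differentiable (at x)"
    and hess_cont: "continuous_on UNIV (hess f)"
    and f_bdd: "bdd_below (range f)"
    and Lambda_fin: "\<exists>H\<in>Hs. \<forall>x. loewner_le (- H) (hess f x) \<and> loewner_le (hess f x) H"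
    and prob: "prob_space M"
    and F_rv: "\<forall>t<T. F t \<in> M \<rightarrow>\<^sub>M (\<Pi>\<^sub>M x\<in>UNIV. (borel :: real measure))"
    and F_indep: "prob_space.indep_vars M (\<lambda>_. \<Pi>\<^sub>M x\<in>UNIV. (borel :: real measure)) F {..<T}"
    and F_diff: "\<forall>t<T. \<forall>\<omega>\<in>space M. \<forall>x. F t \<omega> differentiable (at x)"
    and Sigma_psd: "psd \<Sigma>"
    and unbiased_int: "\<forall>t<T. \<forall>x. integrable M (\<lambda>\<omega>. grad (F t \<omega>) x)"
    and unbiased: "\<forall>t<T. \<forall>x. (\<integral>\<omega>. grad (F t \<omega>) x \<partial>M) = grad f x"
    and noise: "\<forall>t<T. \<forall>x. AE \<omega> in M.
        loewner_le (- \<Sigma>) (outer (grad f x) (grad f x) - outer (grad (F t \<omega>) x) (grad (F t \<omega>) x)) \<and>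
        loewner_le (outer (grad f x) (grad f x) - outer (grad (F t \<omega>) x) (grad (F t \<omega>) x)) \<Sigma>"
  shows
    "let G = (\<lambda>\<omega> t. grad (F t \<omega>));
         xs = (\<lambda>\<omega> t. alg_x Hs \<epsilon> \<beta> \<eta> x0 (G \<omega>) t);
         V = (\<lambda>\<omega> t. alg_V Hs \<epsilon> \<beta> \<eta> x0 (G \<omega>) t);
         Vp = (\<lambda>\<omega> t. alg_V_prev Hs \<epsilon> \<beta> \<eta> x0 (G \<omega>) t);
         d = real CARD('n);
         \<Delta>0 = f x0 - Inf (range f);
         \<Lambda> = adaptive_smoothness Hs f;
         S = (\<integral>\<omega>. (\<Sum>t<T. matrix_inv (V \<omega> t) **
                  (V \<omega> t ** V \<omega> t - \<beta> *\<^sub>R (Vp \<omega> t ** Vp \<omega> t)) ** matrix_inv (V \<omega> t)) \<partial>M);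
         \<xi> = 2 * \<Delta>0 / \<eta> + \<eta> * \<Lambda> * op_norm S + sqrt 2 * d * sqrt (op_norm \<Sigma>) * op_norm S
     in (\<integral>\<^sup>+\<omega>. ennreal ((1 / real T) * (\<Sum>t<T. dual_norm Hs (grad f (xs \<omega> t)))) \<partial>M)
        \<le> ennreal (sqrt (\<Sum>i<T. \<beta> powr (real i / 2)) / real T * \<xi>
           + sqrt (trace (precond Hs ((\<Sum>i<T. \<beta> ^ i) *\<^sub>R \<Sigma> + \<epsilon> *\<^sub>R mat 1))) / sqrt (real T) * sqrt \<xi>)"
proof -
  obtain K where K: "\<forall>c A. A \<in> K \<longrightarrow> c *\<^sub>R A \<in> K" "\<forall>A\<in>K. \<forall>B\<in>K. A + B \<in> K"
    "\<forall>A\<in>K. \<forall>B\<in>K. A ** B \<in> K" "mat 1 \<in> K" "Hs = {A. psd A} \<inter> K"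
    using ws unfolding well_structured_def by (elim exE conjE) (rule that)
  \<comment> \<open>Positive semidefinite matrices are symmetric, so restricting K to its symmetric
    part leaves \<open>Hs\<close> unchanged.\<close>
  define L where "L = {A \<in> K. sym_mat A}"
  have "0 \<in> K" using K(1)[rule_format, OF K(4), of 0] by simp
  interpret prob_space M by (rule prob)
  interpret stochastic_run L M \<epsilon> \<beta> \<eta> T f x0 F \<Sigma>
  proof unfold_locales
    show "subspace L"
      using K \<open>0 \<in> K\<close> by (auto simp: L_def subspace_def sym_mat_intros)
  qed (use assms K in \<open>auto simp: L_def sym_mat_intros\<close>)
  have Hs: "Hs = psd_L" by (auto simp: K(5) L_def psd_sym)
  have run_eq: "alg_x Hs \<epsilon> \<beta> \<eta> x0 (\<lambda>t. grad (F t \<omega>)) t = X t \<omega>"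
    "alg_V Hs \<epsilon> \<beta> \<eta> x0 (\<lambda>t. grad (F t \<omega>)) t = V t \<omega>"
    "alg_V_prev Hs \<epsilon> \<beta> \<eta> x0 (\<lambda>t. grad (F t \<omega>)) t = V_prev t \<omega>" for t \<omega>
    unfolding Hs alg_x_def alg_V_def alg_V_prev_def alg_M_def X_def V_def V_prev_def P_def by simp_all
  show ?thesis
    unfolding Let_def run_eq
    using convergence_rate[OF Lambda_fin[unfolded Hs] f_bdd]
    unfolding a_def S_def Hs[symmetric] .
qed

end
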